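(* Let $A,B$ be finite-dimensional Hilbert spaces, $\rho_{AB}\in \mathrm{S}(A\otimes B)$ and $\sigma_A\in\mathrm{S}(A)$. Then the family $$\sigma_{A_1^nB_1^n}:=\int_{-\infty}^{\infty}\beta_0(t)\,\big(\sigma_A^{\frac{1+\mathrm{i}t}{2}}\big)^{\otimes n}\big(\rho_A^{-\frac{1+\mathrm{i}t}{2}}\big)^{\otimes n}\rho_{AB}^{\otimes n}\big(\rho_A^{-\frac{1-\mathrm{i}t}{2}}\big)^{\otimes n}\big(\sigma_A^{\frac{1-\mathrm{i}t}{2}}\big)^{\otimes n}\,\mathrm{d}t ,\qquad n\in\mathbb{N},$$ of extensions of $\sigma_A^{\otimes n}$, where $\beta_0(t):=\frac{\pi}{2}(\cosh(\pi t)+1)^{-1}$ is a probability distribution on $\mathbb{R}$, satisfies $$D(\rho_A\|\sigma_A)=\lim_{n\to\infty}\frac1n D(\rho_{AB}^{\otimes n}\|\sigma_{A_1^nB_1^n}).$$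
   Context: $\mathrm{S}(A)$ is the set of density matrices (positive semidefinite, trace one) on the finite-dimensional Hilbert space $A$; $\rho_A=\mathrm{tr}_B[\rho_{AB}]$; $A_1^n=A^{\otimes n}$, $B_1^n=B^{\otimes n}$. Operators on $A_1^n$ act on $A_1^n\otimes B_1^n$ as $X\otimes\mathbb{1}_{B_1^n}$. The inverse (in the negative powers of $\rho_A$) is only relevant on the support of $\rho_A^{\otimes n}$. An extension of $\sigma_A^{\otimes n}$ is a density matrix $\sigma'$ on $A_1^n\otimes B_1^n$ with $\mathrm{tr}_{B_1^n}[\sigma']=\sigma_A^{\otimes n}$. The relative entropy is $D(\rho\|\sigma):=\mathrm{tr}[\rho(\log\rho-\log\sigma)]$ if $\mathrm{supp}\,\rho\subseteq\mathrm{supp}\,\sigma$, and $+\infty$ otherwise.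
   Formalization: That the family consists of extensions of σ_A^{⊗n} is stated only when supp σ_A ⊆ supp ρ_A, since otherwise it fails (for ρ_A=|0><0|, σ_A=|1><1| the integral is 0); the limit formula is stated for all ρ_AB, σ_A. *)

theory Defs
  imports
    "HOL-Probability.Probability"
    "Jordan_Normal_Form.Schur_Decomposition"
    "Jordan_Normal_Form.Matrix_Kernel"
begin

text \<open>
  A \<open>d\<close>-dimensional Hilbert space is \<open>carrier_vec d\<close> over the complex numbers, with inner product
  \<open>\<bullet>c\<close>; operators on it are \<open>carrier_mat d d\<close>.  The basis vector
  \<open>e\<^sub>i \<otimes> e\<^sub>j\<close> of a tensor product has index \<open>i * d' + j\<close>, where \<open>d'\<close> is the
  dimension of the right-hand factor.
\<close>

definition mat_trace :: "complex mat \<Rightarrow> complex" where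
  "mat_trace M = (\<Sum>i<dim_row M. M $$ (i, i))"

text \<open>
  Here \<open>0 \<le> z\<close> is the order on the complex numbers, i.e. \<open>z\<close> is real and nonnegative;
  this makes a positive semidefinite matrix Hermitian.
\<close>

definition positive_semidefinite :: "nat \<Rightarrow> complex mat \<Rightarrow> bool" where
  "positive_semidefinite d M \<longleftrightarrow>
     M \<in> carrier_mat d d \<and> (\<forall>v\<in>carrier_vec d. 0 \<le> (M *\<^sub>v v) \<bullet>c v)"

definition density_matrices :: "nat \<Rightarrow> complex mat set" where
  "density_matrices d = {M. positive_semidefinite d M \<and> mat_trace M = 1}"

definition kron :: "complex mat \<Rightarrow> complex mat \<Rightarrow> complex mat" where
  "kron X Y = mat (dim_row X * dim_row Y) (dim_col X * dim_col Y)
     (\<lambda>(i, j). X $$ (i div dim_row Y, j div dim_col Y) * Y $$ (i mod dim_row Y, j mod dim_col Y))"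

primrec tensor_power :: "complex mat \<Rightarrow> nat \<Rightarrow> complex mat" where
  "tensor_power X 0 = 1\<^sub>m 1"
| "tensor_power X (Suc n) = kron (tensor_power X n) X"

text \<open>Partial trace over the right-hand factor of a tensor product of dimensions \<open>dA\<close>, \<open>dB\<close>.\<close>

definition partial_trace :: "nat \<Rightarrow> nat \<Rightarrow> complex mat \<Rightarrow> complex mat" where
  "partial_trace dA dB M = mat dA dA (\<lambda>(i, j). \<Sum>k<dB. M $$ (i * dB + k, j * dB + k))"

text \<open>
  The canonical identification of \<open>A\<^sup>\<otimes>\<^sup>n \<otimes> B\<^sup>\<otimes>\<^sup>n\<close> with
  \<open>(A \<otimes> B)\<^sup>\<otimes>\<^sup>n\<close>:  \<open>interleave dA dB n i j\<close> is the index in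
  \<open>(A \<otimes> B)\<^sup>\<otimes>\<^sup>n\<close> of the basis vector with index \<open>i\<close> in \<open>A\<^sup>\<otimes>\<^sup>n\<close> and
  index \<open>j\<close> in \<open>B\<^sup>\<otimes>\<^sup>n\<close>, and \<open>regroup\<close> carries an operator on
  \<open>(A \<otimes> B)\<^sup>\<otimes>\<^sup>n\<close> over to \<open>A\<^sup>\<otimes>\<^sup>n \<otimes> B\<^sup>\<otimes>\<^sup>n\<close>.
\<close>

primrec interleave :: "nat \<Rightarrow> nat \<Rightarrow> nat \<Rightarrow> nat \<Rightarrow> nat \<Rightarrow> nat" where
  "interleave dA dB 0 i j = 0"
| "interleave dA dB (Suc n) i j =
     interleave dA dB n (i div dA) (j div dB) * (dA * dB) + ((i mod dA) * dB + j mod dB)"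

definition regroup :: "nat \<Rightarrow> nat \<Rightarrow> nat \<Rightarrow> complex mat \<Rightarrow> complex mat" where
  "regroup dA dB n M = mat (dA ^ n * dB ^ n) (dA ^ n * dB ^ n)
     (\<lambda>(x, y). M $$ (interleave dA dB n (x div dB ^ n) (x mod dB ^ n),
                     interleave dA dB n (y div dB ^ n) (y mod dB ^ n)))"

text \<open>
  Functional calculus for Hermitian \<open>M\<close>: \<open>f\<close> is applied to the eigenvalues in a unitary
  diagonalization of \<open>M\<close>.  The result does not depend on the diagonalization.
\<close>

definition mat_fun :: "(real \<Rightarrow> complex) \<Rightarrow> complex mat \<Rightarrow> complex mat" where
  "mat_fun f M = (let d = dim_row M in
     THE N. \<exists>U\<in>carrier_mat d d. \<exists>l :: nat \<Rightarrow> real.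
       U * mat_adjoint U = 1\<^sub>m d \<and>
       M = U * mat_diag d (\<lambda>i. complex_of_real (l i)) * mat_adjoint U \<and>
       N = U * mat_diag d (\<lambda>i. f (l i)) * mat_adjoint U)"

text \<open>Powers and logarithms are taken on the support, and are zero on its orthogonal complement.\<close>

definition mat_cpow :: "complex mat \<Rightarrow> complex \<Rightarrow> complex mat" where
  "mat_cpow M z = mat_fun (\<lambda>x. if x = 0 then 0 else complex_of_real x powr z) M"

definition mat_log :: "complex mat \<Rightarrow> complex mat" where
  "mat_log M = mat_fun (\<lambda>x. if x = 0 then 0 else complex_of_real (ln x)) M"

definition supp :: "complex mat \<Rightarrow> complex vec set" where
  "supp M = {v \<in> carrier_vec (dim_row M). \<forall>w\<in>mat_kernel M. v \<bullet>c w = 0}"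

definition relative_entropy :: "complex mat \<Rightarrow> complex mat \<Rightarrow> ereal" where
  "relative_entropy \<rho> \<sigma> =
     (if supp \<rho> \<subseteq> supp \<sigma> then ereal (Re (mat_trace (\<rho> * (mat_log \<rho> - mat_log \<sigma>)))) else \<infinity>)"

definition is_extension :: "nat \<Rightarrow> nat \<Rightarrow> complex mat \<Rightarrow> complex mat \<Rightarrow> bool" where
  "is_extension dA dB \<tau> \<tau>' \<longleftrightarrow>
     \<tau>' \<in> density_matrices (dA * dB) \<and> partial_trace dA dB \<tau>' = \<tau>"

definition beta0 :: "real \<Rightarrow> real" where
  "beta0 t = pi / 2 * inverse (cosh (pi * t) + 1)"

definition sigma_integrand ::
  "nat \<Rightarrow> nat \<Rightarrow> complex mat \<Rightarrow> complex mat \<Rightarrow> nat \<Rightarrow> real \<Rightarrow> complex mat" where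
  "sigma_integrand dA dB \<rho> \<sigma> n t =
     (let \<rho>A = partial_trace dA dB \<rho>;
          z = (1 + \<i> * complex_of_real t) / 2;
          w = (1 - \<i> * complex_of_real t) / 2;
          onA = (\<lambda>X. kron (tensor_power X n) (1\<^sub>m (dB ^ n)))
      in complex_of_real (beta0 t) \<cdot>\<^sub>m
           (onA (mat_cpow \<sigma> z) * onA (mat_cpow \<rho>A (- z)) *
            regroup dA dB n (tensor_power \<rho> n) *
            onA (mat_cpow \<rho>A (- w)) * onA (mat_cpow \<sigma> w)))"

definition sigma_ext :: "nat \<Rightarrow> nat \<Rightarrow> complex mat \<Rightarrow> complex mat \<Rightarrow> nat \<Rightarrow> complex mat" where
  "sigma_ext dA dB \<rho> \<sigma> n = mat (dA ^ n * dB ^ n) (dA ^ n * dB ^ n)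
     (\<lambda>(i, j). LINT t|lborel. sigma_integrand dA dB \<rho> \<sigma> n t $$ (i, j))"

end

theory Submission
  imports Defs "HOL-Complex_Analysis.Complex_Analysis" "HOL-Real_Asymp.Real_Asymp"
begin

text \<open>
  Write \<open>P\<close> for \<open>\<rho>\<^sub>A\<^sub>B\<^sup>\<otimes>\<^sup>n\<close>, \<open>R\<close> and \<open>S\<close> for \<open>\<rho>\<^sub>A\<^sup>\<otimes>\<^sup>n\<close> and \<open>\<sigma>\<^sub>A\<^sup>\<otimes>\<^sup>n\<close> acting on the larger space, and \<open>\<tau>\<close> for the
  extension.  For a product \<open>F (z)\<close> of complex powers of Hermitian matrices, the function
  \<open>h (z) = (tr P F (z))\<^sup>2\<close> satisfies \<open>h (0) = 1\<close>, has modulus at most \<open>1\<close> on the imaginary axis, and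
  \<open>h' (0)\<close> is a sum of logarithmic expectation values.  The Poisson formula for the strip
  \<open>0 \<le> Re z \<le> 1\<close>, differentiated at its boundary point \<open>0\<close>, where the kernel becomes \<open>\<beta>\<^sub>0\<close>, bounds
  \<open>Re (h' (0))\<close> by the logarithm of the \<open>\<beta>\<^sub>0\<close>-average of \<open>tr F P F\<^sup>\<dagger>\<close> over the line \<open>Re z = 1\<close>.

  With \<open>F = R\<^sup>z\<^sup>/\<^sup>2 S\<^sup>-\<^sup>z\<^sup>/\<^sup>2 \<tau>\<^sup>z\<^sup>/\<^sup>2 P\<^sup>-\<^sup>z\<^sup>/\<^sup>2\<close> this is the data-processing inequality
  \<open>n D(\<rho>\<^sub>A\<parallel>\<sigma>\<^sub>A) \<le> D(P\<parallel>\<tau>)\<close>.  With \<open>F = P\<^sup>z\<^sup>/\<^sup>2 f(\<tau>)\<^sup>-\<^sup>z\<^sup>/\<^sup>2 S\<^sup>z\<^sup>/\<^sup>2 R\<^sup>-\<^sup>z\<^sup>/\<^sup>2\<close>, where \<open>f (\<tau>)\<close> is \<open>\<tau>\<^sup>1\<^sup>-\<^sup>\<epsilon>\<close> with its eigenvalues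
  rounded to a geometric grid, it gives the converse up to a term that does not depend on \<open>n\<close>.
  Letting \<open>n \<rightarrow> \<infinity>\<close> and then \<open>\<epsilon> \<rightarrow> 0\<close> yields the limit.
\<close>

subsection \<open>An infinitesimal three-lines estimate\<close>

text \<open>The square in h comes from Cauchy-Schwarz: |tr P F|^2 is at most the trace of the
  sandwich of P by F, so the average on Re z = 1 is linear in P, and exponents z/2 turn into whole
  powers there. In the data-processing product R and S stand outside, act on A alone and see only
  the marginal of \<tau>. In the converse product they stand next to P, where their sandwich
  averages to \<tau>; but powers of \<tau> itself would add phases that depend on t, and the average
  could no longer be taken inside. Pinching removes phases at the price of a factor. With equal
  weights the factor is a number of eigenvalues, which would have to be counted; here level k of the
  grid has weight exp(-\<epsilon> k). The exponent 1 - \<epsilon> makes x / f(x) about x^\<epsilon>,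
  which this weight absorbs, and the weights sum to at most 1 / (1 - exp(-\<epsilon>)) in every
  dimension. Powers vanish off the support, so F(0) is built from support projections that have to
  fix P. The value f(0) is kept free: letting it tend to 0 proves that P is supported in
  \<tau>.\<close>

lemma cosh_gt_minus_one: "cosh x + 1 > (0::real)"
  using cosh_real_ge_1[of x] by linarith

lemma beta0_eq: "beta0 t = pi / (2 * (cosh (pi * t) + 1))"
  by (simp add: beta0_def field_simps)

lemma beta0_pos: "beta0 t > 0"
  using cosh_gt_minus_one[of "pi * t"] by (simp add: beta0_eq)

lemma continuous_on_beta0: "continuous_on A beta0"
  unfolding beta0_def
  by (intro continuous_intros) (use cosh_gt_minus_one in \<open>auto simp: less_imp_neq[symmetric]\<close>)

lemma borel_measurable_beta0 [measurable]: "beta0 \<in> borel_measurable borel"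
  by (intro borel_measurable_continuous_onI continuous_on_beta0)

text \<open>The half-angle identity turns \<open>beta0 t\<close> into pi/4 divided by the square of
  cosh(pi t / 2). The limits -1/2 and 1/2 of this antiderivative then give integrability and total
  mass 1 together.\<close>

lemma tanh_half_has_beta0_derivative:
  "((\<lambda>t. tanh (pi / 2 * t) / 2) has_real_derivative beta0 t) (at t)"
proof -
  have c: "cosh (pi / 2 * t) \<noteq> 0" by simp
  have "cosh (pi * t) + 1 = 2 * (cosh (pi / 2 * t))\<^sup>2"
    using cosh_double_cosh[of "pi / 2 * t"] by simp
  moreover have "1 - (tanh (pi / 2 * t))\<^sup>2 = ((cosh (pi / 2 * t))\<^sup>2 - (sinh (pi / 2 * t))\<^sup>2) / (cosh (pi / 2 * t))\<^sup>2"
    using c by (simp add: tanh_def power_divide diff_divide_distrib)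
  then have "1 - (tanh (pi / 2 * t))\<^sup>2 = 1 / (cosh (pi / 2 * t))\<^sup>2"
    by (simp only: hyperbolic_pythagoras)
  ultimately have *: "beta0 t = (1 - (tanh (pi / 2 * t))\<^sup>2) * (pi / 2) / 2"
    by (simp add: beta0_eq)
  show ?thesis unfolding *
    by (auto intro!: derivative_eq_intros c)
qed

lemma
  shows integrable_beta0: "integrable lborel beta0"
    and integral_beta0: "(LINT t|lborel. beta0 t) = 1"
proof -
  have lim1: "((\<lambda>t::real. tanh (pi / 2 * t) / 2) \<longlongrightarrow> 1 / 2) at_top"
    by (intro tendsto_intros filterlim_compose[OF tanh_real_at_top]
        filterlim_tendsto_pos_mult_at_top[OF tendsto_const] filterlim_ident) auto
  have lim2: "((\<lambda>t::real. tanh (pi / 2 * t) / 2) \<longlongrightarrow> (- 1) / 2) at_bot"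
    by (intro tendsto_intros filterlim_compose[OF tanh_real_at_bot]
        filterlim_tendsto_pos_mult_at_bot[OF tendsto_const] filterlim_ident) auto
  note * = interval_integral_FTC_nonneg[where a = "-\<infinity>" and b = "\<infinity>" and f = beta0
      and F = "\<lambda>t. tanh (pi / 2 * t) / 2" and A = "-1/2" and B = "1/2"]
  have 1: "set_integrable lborel (einterval (-\<infinity>) \<infinity>) beta0"
    by (rule *(1)) (use lim1 lim2 tanh_half_has_beta0_derivative beta0_pos in
        \<open>auto simp: ereal_tendsto_simps less_imp_le continuous_on_beta0
          intro!: continuous_on_interior[OF continuous_on_beta0[of UNIV]]\<close>)
  have 2: "(LBINT x=-\<infinity>..\<infinity>. beta0 x) = 1/2 - (-1/2)"
    by (rule *(2)) (use lim1 lim2 tanh_half_has_beta0_derivative beta0_pos in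
        \<open>auto simp: ereal_tendsto_simps less_imp_le continuous_on_beta0
          intro!: continuous_on_interior[OF continuous_on_beta0[of UNIV]]\<close>)
  show "integrable lborel beta0"
    using 1 by (simp add: set_integrable_def)
  show "(LINT t|lborel. beta0 t) = 1"
    using 2 by (simp add: interval_lebesgue_integral_def set_lebesgue_integral_def)
qed

lemma prob_space_beta0: "prob_space (density lborel (\<lambda>t. ennreal (beta0 t)))"
proof (rule prob_spaceI)
  have "emeasure (density lborel (\<lambda>t. ennreal (beta0 t))) (space (density lborel (\<lambda>t. ennreal (beta0 t))))
    = (\<integral>\<^sup>+ t. ennreal (beta0 t) \<partial>lborel)"
    by (simp add: emeasure_density)
  also have "\<dots> = ennreal (LINT t|lborel. beta0 t)"
    by (intro nn_integral_eq_integral integrable_beta0) (simp add: beta0_pos less_imp_le)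
  finally show "emeasure (density lborel (\<lambda>t. ennreal (beta0 t))) (space (density lborel (\<lambda>t. ennreal (beta0 t)))) = 1"
    by (simp add: integral_beta0)
qed

section \<open>Poisson formula for the strip\<close>

lemma integrable_beta0_mult:
  fixes g :: "real \<Rightarrow> 'a :: {banach, second_countable_topology}"
  assumes [measurable]: "g \<in> borel_measurable borel" and "\<And>t. norm (g t) \<le> B * beta0 t"
  shows "integrable lborel g"
  by (rule Bochner_Integration.integrable_bound[of lborel "\<lambda>t. B * beta0 t"])
    (use assms(2) integrable_beta0 in \<open>auto intro: order_trans[OF _ abs_ge_self]\<close>)

text \<open>Harmonic measure of the strip 0 \<le> Re z \<le> 1 seen from the real point \<theta>:
  its density on the line Re z = 0, while \<open>strip_kernel1\<close> is the density on Re z = 1.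
  As \<theta> tends to 0, \<open>strip_kernel1 \<theta> t / \<theta>\<close> tends to
  \<open>beta0 t\<close>.\<close>

definition strip_kernel0 :: "real \<Rightarrow> real \<Rightarrow> real" where
  "strip_kernel0 \<theta> t = sin (pi * \<theta>) / (2 * (cosh (pi * t) - cos (pi * \<theta>)))"

definition strip_kernel1 :: "real \<Rightarrow> real \<Rightarrow> real" where
  "strip_kernel1 \<theta> t = sin (pi * \<theta>) / (2 * (cosh (pi * t) + cos (pi * \<theta>)))"

context
  fixes \<theta> :: real
  assumes \<theta>: "0 < \<theta>" "\<theta> < 1"
begin

lemma abs_cos_pi_lt_one: "\<bar>cos (pi * \<theta>)\<bar> < 1"
proof -
  have "0 < sin (pi * \<theta>)" using \<theta> by (intro sin_gt_zero) auto
  then have "(cos (pi * \<theta>))\<^sup>2 < 1"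
    using sin_cos_squared_add[of "pi * \<theta>"] by (smt (verit) zero_less_power)
  then show ?thesis by (simp add: abs_square_less_1)
qed

lemma sin_pi_pos: "0 < sin (pi * \<theta>)"
  using \<theta> by (intro sin_gt_zero) auto

lemma cosh_minus_cos_pos: "cosh (pi * t) - cos (pi * \<theta>) > 0"
  using abs_cos_pi_lt_one cosh_real_ge_1[of "pi * t"] by linarith

lemma cosh_plus_cos_pos: "cosh (pi * t) + cos (pi * \<theta>) > 0"
  using abs_cos_pi_lt_one cosh_real_ge_1[of "pi * t"] by linarith

lemma strip_kernel_nonneg: "0 \<le> strip_kernel0 \<theta> t" "0 \<le> strip_kernel1 \<theta> t"
  using cosh_minus_cos_pos[of t] cosh_plus_cos_pos[of t] sin_pi_pos
  by (auto simp: strip_kernel0_def strip_kernel1_def)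

lemma strip_kernel_continuous:
  "continuous_on A (strip_kernel0 \<theta>)" "continuous_on A (strip_kernel1 \<theta>)"
  unfolding strip_kernel0_def strip_kernel1_def
proof -
  have "2 * (cosh (pi * t) - cos (pi * \<theta>)) \<noteq> 0" "2 * (cosh (pi * t) + cos (pi * \<theta>)) \<noteq> 0" for t
    using cosh_minus_cos_pos[of t] cosh_plus_cos_pos[of t] by simp_all
  then show "continuous_on A (\<lambda>t. sin (pi * \<theta>) / (2 * (cosh (pi * t) - cos (pi * \<theta>))))"
    "continuous_on A (\<lambda>t. sin (pi * \<theta>) / (2 * (cosh (pi * t) + cos (pi * \<theta>))))"
    by (intro continuous_intros ballI; blast)+
qed

lemma strip_kernel_measurable [measurable]:
  "strip_kernel0 \<theta> \<in> borel_measurable borel" "strip_kernel1 \<theta> \<in> borel_measurable borel"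
  by (intro borel_measurable_continuous_onI strip_kernel_continuous)+

text \<open>Serves both kernels, with a = cos(pi \<theta>) and a = -cos(pi \<theta>). Domination by
  a multiple of \<open>beta0\<close> makes the integrability of \<open>beta0\<close> the only one
  that has to be computed. For \<open>strip_kernel1\<close> the multiple is of order \<theta>, which
  later allows division by \<theta> under the integral.\<close>

lemma frac_le_beta0:
  assumes a: "\<bar>a\<bar> < 1" and s: "0 \<le> s"
  shows "s / (2 * (cosh (pi * t) - a)) \<le> 2 * s / (pi * (1 - a)) * beta0 t"
proof -
  let ?c = "cosh (pi * t)"
  have c: "?c \<ge> 1" by (rule cosh_real_ge_1)
  have "(1 - a) * (?c + 1) \<le> 2 * (?c - a)"
  proof -
    have "2 * (?c - a) - (1 - a) * (?c + 1) = (1 + a) * (?c - 1)" by (simp add: algebra_simps)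
    also have "\<dots> \<ge> 0" using a c by (intro mult_nonneg_nonneg) auto
    finally show ?thesis by simp
  qed
  moreover have "(1 - a) * (?c + 1) > 0" using a c by (intro mult_pos_pos) auto
  ultimately have "s / (2 * (?c - a)) \<le> s / ((1 - a) * (?c + 1))"
    using s a cosh_gt_minus_one[of "pi * t"] c by (intro divide_left_mono mult_pos_pos) auto
  also have "\<dots> = 2 * s / (pi * (1 - a)) * beta0 t"
  proof -
    have "s / (x * D) = 2 * s / (pi * x) * (pi / (2 * D))" for x D :: real by simp
    then show ?thesis by (simp only: beta0_eq)
  qed
  finally show ?thesis .
qed

lemma strip_kernel0_le: "strip_kernel0 \<theta> t \<le> 2 * sin (pi * \<theta>) / (pi * (1 - cos (pi * \<theta>))) * beta0 t"
  unfolding strip_kernel0_def using abs_cos_pi_lt_one sin_pi_pos by (intro frac_le_beta0) auto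

lemma strip_kernel1_le: "strip_kernel1 \<theta> t \<le> 2 * sin (pi * \<theta>) / (pi * (1 + cos (pi * \<theta>))) * beta0 t"
  using frac_le_beta0[of "- cos (pi * \<theta>)" "sin (pi * \<theta>)" t] abs_cos_pi_lt_one sin_pi_pos
  by (simp add: strip_kernel1_def)

lemma integrable_strip_kernel:
  fixes g :: "real \<Rightarrow> complex"
  assumes [measurable]: "g \<in> borel_measurable borel" and g: "\<And>t. norm (g t) \<le> B"
  shows "integrable lborel (\<lambda>t. of_real (strip_kernel0 \<theta> t) * g t)"
    "integrable lborel (\<lambda>t. of_real (strip_kernel1 \<theta> t) * g t)"
proof -
  have B: "B \<ge> 0" using g[of 0] norm_ge_zero by (rule order_trans[rotated])
  show "integrable lborel (\<lambda>t. of_real (strip_kernel0 \<theta> t) * g t)"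
    by (rule integrable_beta0_mult[of _ "2 * sin (pi * \<theta>) / (pi * (1 - cos (pi * \<theta>))) * B"])
      (use mult_mono[OF strip_kernel0_le g] B sin_pi_pos abs_cos_pi_lt_one beta0_pos in
        \<open>auto simp: norm_mult strip_kernel_nonneg mult_ac less_imp_le order_trans[OF strip_kernel_nonneg(1) strip_kernel0_le]\<close>)
  show "integrable lborel (\<lambda>t. of_real (strip_kernel1 \<theta> t) * g t)"
    by (rule integrable_beta0_mult[of _ "2 * sin (pi * \<theta>) / (pi * (1 + cos (pi * \<theta>))) * B"])
      (use mult_mono[OF strip_kernel1_le g] B sin_pi_pos abs_cos_pi_lt_one beta0_pos in
        \<open>auto simp: norm_mult strip_kernel_nonneg mult_ac less_imp_le order_trans[OF strip_kernel_nonneg(2) strip_kernel1_le]\<close>)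
qed

text \<open>Residue theorem on the rectangle 0 \<le> Re z \<le> 1, |Im z| \<le> T. The weight
  multiplying h has a simple pole of residue 1 at \<theta>. On the two vertical sides cos(pi z) is
  real, namely cosh(pi t) and -cosh(pi t), so there the weight is a strip kernel up to the factor 2
  pi and a sign.\<close>

lemma poisson_strip_rectangle:
  fixes h :: "complex \<Rightarrow> complex"
  assumes hol: "h holomorphic_on UNIV" and T: "T > 0"
  defines "f \<equiv> \<lambda>z. h z * of_real (pi * sin (pi * \<theta>)) / (of_real (cos (pi * \<theta>)) - cos (of_real pi * z))"
  shows "contour_integral (linepath (Complex 0 (-T)) (Complex 1 (-T))) f
      + \<i> * integral {-T..T} (\<lambda>x. f (Complex 1 x))
      + contour_integral (linepath (Complex 1 T) (Complex 0 T)) f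
      - \<i> * integral {-T..T} (\<lambda>x. f (Complex 0 x)) = 2 * of_real pi * \<i> * h (of_real \<theta>)"
proof -
  \<comment> \<open>The zeros of the denominator are \<theta> and -\<theta> shifted by even
    integers. The neighbours -\<theta> and 2 - \<theta> of \<theta> bound this strip, so \<theta> is
    the only singularity in it.\<close>
  define S where "S = {z. Re z > -\<theta>} \<inter> {z. Re z < 2 - \<theta>}"
  define a1 where "a1 = Complex 0 (-T)"
  define a2 where "a2 = Complex 1 (-T)"
  define a3 where "a3 = Complex 1 T"
  define a4 where "a4 = Complex 0 T"
  have S: "open S" "connected S"
    unfolding S_def by (auto intro!: open_Int open_halfspace_Re_gt open_halfspace_Re_lt
        convex_connected convex_Int convex_halfspace_Re_gt convex_halfspace_Re_lt)
  have zero: "of_real (cos (pi * \<theta>)) - cos (of_real pi * z) \<noteq> 0" if "z \<in> S - {of_real \<theta>}" for z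
  proof
    assume "of_real (cos (pi * \<theta>)) - cos (of_real pi * z) = 0"
    then have "cos (of_real (pi * \<theta>)) = cos (of_real pi * z)"
      by (simp add: cos_of_real del: of_real_mult)
    then obtain n :: real where n: "n \<in> \<int>" and
      e: "of_real (pi * \<theta>) = of_real pi * z + of_real (2 * n * pi) \<or> of_real (pi * \<theta>) = - (of_real pi * z) + of_real (2 * n * pi)"
      unfolding complex_cos_eq by blast
    from e have "z = of_real (\<theta> - 2 * n) \<or> z = of_real (2 * n - \<theta>)"
    proof
      assume "of_real (pi * \<theta>) = of_real pi * z + of_real (2 * n * pi)"
      then have "of_real pi * z = of_real pi * of_real (\<theta> - 2 * n)" by (simp add: algebra_simps)
      then show ?thesis by simp
    next
      assume "of_real (pi * \<theta>) = - (of_real pi * z) + of_real (2 * n * pi)"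
      then have "of_real pi * z = of_real pi * of_real (2 * n - \<theta>)" by (simp add: algebra_simps)
      then show ?thesis by simp
    qed
    with that n \<theta> show False unfolding S_def Ints_def by auto
  qed
  have path: "path_image (rectpath a1 a3) \<subseteq> S - {of_real \<theta>}"
  proof -
    have "path_image (rectpath a1 a3) \<subseteq> cbox a1 a3 - box a1 a3"
      by (subst path_image_rectpath_cbox_minus_box) (use T in \<open>auto simp: a1_def a3_def\<close>)
    moreover have "of_real \<theta> \<in> box a1 a3" "cbox a1 a3 \<subseteq> S"
      using \<theta> T by (auto simp: in_box_complex_iff in_cbox_complex_iff a1_def a3_def S_def)
    ultimately show ?thesis by auto
  qed
  have hol_f: "f holomorphic_on S - {of_real \<theta>}"
    unfolding f_def by (intro holomorphic_intros holomorphic_on_subset[OF hol]) (use zero in auto)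
  have res: "residue f (of_real \<theta>) = h (of_real \<theta>)"
  proof (rule residue_simple'[OF S(1) _ hol_f])
    show "complex_of_real \<theta> \<in> S" using \<theta> by (auto simp: S_def)
    have s0: "sin (of_real pi * complex_of_real \<theta>) \<noteq> 0"
      using sin_pi_pos by (simp add: sin_of_real flip: of_real_mult)
    have "((\<lambda>z. cos (of_real pi * z)) has_field_derivative - sin (of_real pi * of_real \<theta>) * of_real pi) (at (of_real \<theta>))"
      by (auto intro!: derivative_eq_intros)
    then have l1: "((\<lambda>z. (cos (of_real pi * z) - cos (of_real pi * of_real \<theta>)) / (z - of_real \<theta>))
        \<longlongrightarrow> - sin (of_real pi * of_real \<theta>) * of_real pi) (at (complex_of_real \<theta>))"
      by (simp add: has_field_derivative_iff)
    have "h \<midarrow>of_real \<theta>\<rightarrow> h (of_real \<theta>)"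
      using holomorphic_on_imp_continuous_on[OF hol] by (simp add: continuous_on_eq_continuous_at isContD)
    then have "((\<lambda>z. - h z * of_real (pi * sin (pi * \<theta>)) / ((cos (of_real pi * z) - cos (of_real pi * of_real \<theta>)) / (z - of_real \<theta>)))
        \<longlongrightarrow> - h (of_real \<theta>) * of_real (pi * sin (pi * \<theta>)) / (- sin (of_real pi * of_real \<theta>) * of_real pi)) (at (complex_of_real \<theta>))"
      by (intro tendsto_intros l1) (use s0 in auto)
    also have "- h (of_real \<theta>) * of_real (pi * sin (pi * \<theta>)) / (- sin (of_real pi * of_real \<theta>) * of_real pi) = h (of_real \<theta>)"
      using s0 by (simp add: field_simps sin_of_real flip: of_real_mult)
    also have "(\<lambda>z. - h z * of_real (pi * sin (pi * \<theta>)) / ((cos (of_real pi * z) - cos (of_real pi * of_real \<theta>)) / (z - of_real \<theta>)))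
       = (\<lambda>z. f z * (z - of_real \<theta>))"
    proof
      fix z :: complex
      \<comment> \<open>Division by 0 yields 0, so the identity has no exceptions and the two
        functions agree even at z = \<theta>.\<close>
      have gen: "- a * k / (- D / w) = a * k / D * w" for a k D w :: complex
        by (cases "D = 0"; cases "w = 0"; simp add: field_simps)
      have m: "cos (of_real pi * z) - cos (of_real pi * of_real \<theta>) = - (of_real (cos (pi * \<theta>)) - cos (of_real pi * z))"
        by (simp add: cos_of_real flip: of_real_mult)
      show "- h z * of_real (pi * sin (pi * \<theta>)) / ((cos (of_real pi * z) - cos (of_real pi * of_real \<theta>)) / (z - of_real \<theta>))
         = f z * (z - of_real \<theta>)"
        unfolding f_def m by (rule gen)
    qed
    finally show "(\<lambda>w. f w * (w - of_real \<theta>)) \<midarrow>of_real \<theta>\<rightarrow> h (of_real \<theta>)" .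
  qed
  have "contour_integral (rectpath a1 a3) f = of_real (2 * pi) * \<i> *
       (\<Sum>p\<in>{of_real \<theta>}. winding_number (rectpath a1 a3) p * residue f p)"
  proof (rule Residue_theorem[OF S _ hol_f])
    show "\<forall>z. z \<notin> S \<longrightarrow> winding_number (rectpath a1 a3) z = 0"
    proof (intro allI impI)
      fix z assume "z \<notin> S"
      then have "z \<notin> cbox a1 a3" using \<theta> by (auto simp: S_def in_cbox_complex_iff a1_def a3_def)
      then show "winding_number (rectpath a1 a3) z = 0"
        by (intro winding_number_rectpath_outside) (use T in \<open>auto simp: a1_def a3_def\<close>)
    qed
  qed (use path in \<open>auto simp: rectpath_def Let_def\<close>)
  also have "\<dots> = 2 * of_real pi * \<i> * h (of_real \<theta>)"
    by (subst sum.insert)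
      (use \<theta> T in \<open>auto simp: res in_box_complex_iff a1_def a3_def winding_number_rectpath\<close>)
  finally have main: "contour_integral (rectpath a1 a3) f = 2 * of_real pi * \<i> * h (of_real \<theta>)" .
  have pi: "path_image (rectpath a1 a3) = closed_segment a1 a2 \<union> closed_segment a2 a3 \<union> closed_segment a3 a4 \<union> closed_segment a4 a1"
    by (simp add: rectpath_def Let_def path_image_join a1_def a2_def a3_def a4_def Un_assoc)
  have "continuous_on (S - {of_real \<theta>}) f"
    by (rule holomorphic_on_imp_continuous_on[OF hol_f])
  then have cont: "continuous_on (closed_segment a1 a2) f" "continuous_on (closed_segment a2 a3) f"
      "continuous_on (closed_segment a3 a4) f" "continuous_on (closed_segment a4 a1) f"
    using path unfolding pi by (auto elim: continuous_on_subset)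
  note int = this[THEN contour_integrable_continuous_linepath]
  have "contour_integral (rectpath a1 a3) f = contour_integral (linepath a1 a2) f
      + contour_integral (linepath a2 a3) f + contour_integral (linepath a3 a4) f + contour_integral (linepath a4 a1) f"
    using int by (simp add: rectpath_def Let_def a1_def a2_def a3_def a4_def)
  also have "contour_integral (linepath a4 a1) f = - contour_integral (linepath a1 a4) f"
    using cont(4) by (subst contour_integral_reverse_linepath) (auto simp: closed_segment_commute)
  also have "contour_integral (linepath a1 a4) f = \<i> * integral {-T..T} (\<lambda>x. f (Complex 0 x))"
    by (rule contour_integral_linepath_same_Re) (use T in \<open>auto simp: a1_def a4_def\<close>)
  also have "contour_integral (linepath a2 a3) f = \<i> * integral {-T..T} (\<lambda>x. f (Complex 1 x))"
    by (rule contour_integral_linepath_same_Re) (use T in \<open>auto simp: a2_def a3_def\<close>)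
  finally show ?thesis using main unfolding a1_def a2_def a3_def a4_def by simp
qed

text \<open>The rectangle formula as T tends to infinity. On the horizontal sides |cos(pi z)| is at
  least sinh(pi T), so a bounded h contributes nothing in the limit.\<close>

lemma poisson_strip:
  fixes h :: "complex \<Rightarrow> complex"
  assumes hol: "h holomorphic_on UNIV" and bnd: "\<And>z. 0 \<le> Re z \<Longrightarrow> Re z \<le> 1 \<Longrightarrow> norm (h z) \<le> B"
  shows "h (of_real \<theta>) = (LINT t|lborel. of_real (strip_kernel0 \<theta> t) * h (Complex 0 t))
    + (LINT t|lborel. of_real (strip_kernel1 \<theta> t) * h (Complex 1 t))"
proof -
  define f where "f = (\<lambda>z. h z * of_real (pi * sin (pi * \<theta>)) / (of_real (cos (pi * \<theta>)) - cos (of_real pi * z)))"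
  define k0 where "k0 = (\<lambda>t. of_real (strip_kernel0 \<theta> t) * h (Complex 0 t))"
  define k1 where "k1 = (\<lambda>t. of_real (strip_kernel1 \<theta> t) * h (Complex 1 t))"
  \<comment> \<open>The shift makes \<open>pi * T n\<close> exceed 1, so that the lower bound
    \<open>sinh (pi * T n) - 1\<close> for the denominator is positive for every n.\<close>
  define T where "T = (\<lambda>n. real n + 1)"
  define E where "E = (\<lambda>n. contour_integral (linepath (Complex 0 (- T n)) (Complex 1 (- T n))) f
     + contour_integral (linepath (Complex 1 (T n)) (Complex 0 (T n))) f)"
  have hcont: "continuous_on A h" for A
    using holomorphic_on_imp_continuous_on[OF hol] continuous_on_subset by blast
  have B: "0 \<le> B" using bnd[of 0] order_trans[OF norm_ge_zero] by auto
  have cos_pi: "cos (of_real pi * Complex 0 x) = of_real (cosh (pi * x))"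
    "cos (of_real pi * Complex 1 x) = - of_real (cosh (pi * x))" for x
    by (auto simp: complex_eq_iff Re_cos Im_cos cosh_def exp_minus field_simps sin_gt_zero)
  have f0: "f (Complex 0 x) = - (2 * of_real pi * k0 x)" for x
  proof -
    have "a * (p * s) / (- D) = - (2 * p * (s / (2 * D) * a))" for a p s D :: complex by simp
    from this[of "h (Complex 0 x)" "of_real pi" "of_real (sin (pi * \<theta>))" "of_real (cosh (pi * x) - cos (pi * \<theta>))"]
    show ?thesis by (simp add: f_def k0_def cos_pi strip_kernel0_def)
  qed
  have f1: "f (Complex 1 x) = 2 * of_real pi * k1 x" for x
  proof -
    have "a * (p * s) / D = 2 * p * (s / (2 * D) * a)" for a p s D :: complex by simp
    from this[of "h (Complex 1 x)" "of_real pi" "of_real (sin (pi * \<theta>))" "of_real (cosh (pi * x) + cos (pi * \<theta>))"]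
    show ?thesis by (simp add: f_def k1_def cos_pi strip_kernel1_def add.commute)
  qed
  have lim: "(\<lambda>n. integral {- T n..T n} k) \<longlonglongrightarrow> (LINT x|lborel. k x)"
    if k: "integrable lborel k" for k :: "real \<Rightarrow> complex"
  proof -
    have "integral {- T n..T n} k = (LINT x:{- T n..T n}|lborel. k x)" for n
      by (rule set_borel_integral_eq_integral(2)[symmetric])
        (use k in \<open>auto intro!: set_integrable_subset[of lborel UNIV] simp: set_integrable_def integrable_mult_indicator\<close>)
    moreover have "(\<lambda>n. LINT x:{- T n..T n}|lborel. k x) \<longlonglongrightarrow> (LINT x|lborel. k x)"
      unfolding set_lebesgue_integral_def
    proof (rule integral_dominated_convergence[where w = "\<lambda>x. norm (k x)"])
      show "AE x in lborel. (\<lambda>n. indicator {- T n..T n} x *\<^sub>R k x) \<longlonglongrightarrow> k x"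
      proof (intro AE_I2 tendsto_eventually)
        fix x
        have "eventually (\<lambda>n. real n \<ge> \<bar>x\<bar>) sequentially"
          using eventually_ge_at_top[of "nat \<lceil>\<bar>x\<bar>\<rceil>"] by eventually_elim linarith
        then show "\<forall>\<^sub>F n in sequentially. indicator {- T n..T n} x *\<^sub>R k x = k x"
          by eventually_elim (auto simp: T_def indicator_def)
      qed
    qed (use k in \<open>auto simp: indicator_def\<close>)
    ultimately show ?thesis by simp
  qed
  have meas: "(\<lambda>t. h (Complex c t)) \<in> borel_measurable borel" for c
    by (intro borel_measurable_continuous_onI continuous_on_compose2[OF hcont] continuous_intros) auto
  have i0: "integrable lborel k0"
    unfolding k0_def k1_def by (rule integrable_strip_kernel(1)[OF meas, of _ B]) (auto intro: bnd)
  have i1: "integrable lborel k1"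
    unfolding k0_def k1_def by (rule integrable_strip_kernel(2)[OF meas, of _ B]) (auto intro: bnd)
  have eq: "2 * of_real pi * \<i> * h (of_real \<theta>) - E n
    = 2 * of_real pi * \<i> * integral {- T n..T n} k0
    + 2 * of_real pi * \<i> * integral {- T n..T n} k1" for n
  proof -
    have "integral {- T n..T n} (\<lambda>x. f (Complex 0 x)) = - (2 * of_real pi * integral {- T n..T n} k0)"
      "integral {- T n..T n} (\<lambda>x. f (Complex 1 x)) = 2 * of_real pi * integral {- T n..T n} k1"
      unfolding f0 f1 by simp_all
    moreover have "contour_integral (linepath (Complex 0 (- T n)) (Complex 1 (- T n))) f
      + \<i> * integral {- T n..T n} (\<lambda>x. f (Complex 1 x))
      + contour_integral (linepath (Complex 1 (T n)) (Complex 0 (T n))) f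
      - \<i> * integral {- T n..T n} (\<lambda>x. f (Complex 0 x)) = 2 * of_real pi * \<i> * h (of_real \<theta>)"
      unfolding f_def by (rule poisson_strip_rectangle[OF hol]) (simp add: T_def)
    ultimately show ?thesis
      unfolding E_def by (simp add: algebra_simps)
  qed
  have E0: "E \<longlonglongrightarrow> 0"
  proof -
    have sinh_eq: "sinh x = (exp x - inverse (exp x)) / 2" for x :: real
      by (simp add: sinh_def exp_minus)
    have horizontal: "norm (contour_integral (linepath a b) f) \<le> B * pi / (sinh (pi * T n) - 1)"
      if ab: "Im a = s * T n" "Im b = s * T n" "{Re a, Re b} = {0, 1}" and s: "s = 1 \<or> s = -1" for a b s n
    proof -
      have sh: "sinh (pi * T n) > 1"
      proof -
        have "1 * 1 < pi * T n"
          by (rule mult_less_le_imp_less) (use pi_gt3 in \<open>auto simp: T_def\<close>)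
        then have "1 < pi * T n" "0 \<le> pi * T n" by auto
        note this(1)
        also have "pi * T n \<le> sinh (pi * T n)"
          unfolding sinh_eq by (rule real_le_x_sinh) fact
        finally show ?thesis .
      qed
      have den: "sinh (pi * T n) - 1 \<le> norm (of_real (cos (pi * \<theta>)) - cos (of_real pi * z))"
        if "z \<in> closed_segment a b" for z
      proof -
        have "Im z = s * T n" using that ab closed_segment_same_Im[of a b] by auto
        \<comment> \<open>Because |cos(x + iy)|^2 = cos(x)^2 + sinh(y)^2.\<close>
        then have "(sinh (pi * T n))\<^sup>2 \<le> (norm (cos (of_real pi * z)))\<^sup>2"
          using s by (auto simp: norm_cos_squared sinh_eq exp_minus power_divide power2_commute[of "inverse _"])
        then have "sinh (pi * T n) \<le> norm (cos (of_real pi * z))"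
          by (rule power2_le_imp_le) simp
        moreover have "norm (cos (of_real pi * z)) - \<bar>cos (pi * \<theta>)\<bar> \<le> norm (of_real (cos (pi * \<theta>)) - cos (of_real pi * z))"
          using norm_triangle_ineq2[of "cos (of_real pi * z)" "complex_of_real (cos (pi * \<theta>))"]
          by (simp add: norm_minus_commute)
        moreover have "\<bar>cos (pi * \<theta>)\<bar> \<le> 1" by (rule abs_cos_le_one)
        ultimately show ?thesis by linarith
      qed
      have re: "0 \<le> Re z" "Re z \<le> 1" if "z \<in> closed_segment a b" for z
      proof -
        have "Re z \<in> closed_segment (Re a) (Re b)"
          using that by (auto simp: closed_segment_def)
        then show "0 \<le> Re z" "Re z \<le> 1"
          using ab(3) by (auto simp: doubleton_eq_iff closed_segment_eq_real_ivl)
      qed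
      have "norm (contour_integral (linepath a b) f) \<le> B * pi / (sinh (pi * T n) - 1) * norm (b - a)"
      proof (rule contour_integral_bound_linepath)
        show "f contour_integrable_on linepath a b"
          unfolding f_def
          by (intro contour_integrable_continuous_linepath continuous_intros hcont)
            (use den sh in fastforce)
        show "0 \<le> B * pi / (sinh (pi * T n) - 1)" using B sh by simp
        fix z assume z: "z \<in> closed_segment a b"
        have "norm (f z) = norm (h z) * (pi * \<bar>sin (pi * \<theta>)\<bar>) / norm (of_real (cos (pi * \<theta>)) - cos (of_real pi * z))"
          by (simp add: f_def norm_mult norm_divide abs_mult)
        also have "\<dots> \<le> B * (pi * 1) / (sinh (pi * T n) - 1)"
          by (intro frac_le mult_mono den z bnd re[OF z]) (use B sh in auto)
        finally show "norm (f z) \<le> B * pi / (sinh (pi * T n) - 1)" by simp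
      qed
      also have "b - a = 1 \<or> b - a = -1"
        using ab by (auto simp: doubleton_eq_iff complex_eq_iff)
      then have "norm (b - a) = 1" by auto
      finally show ?thesis by simp
    qed
    show ?thesis
    proof (rule Lim_null_comparison)
      have "norm (E n) \<le> 2 * B * pi / of_nat (Suc n)" for n
      proof -
        have "norm (E n) \<le> B * pi / (sinh (pi * T n) - 1) + B * pi / (sinh (pi * T n) - 1)"
          unfolding E_def
          by (intro norm_triangle_le add_mono horizontal[where s = "-1"] horizontal[where s = 1]) auto
        also have "\<dots> = 2 * B * pi / (sinh (pi * T n) - 1)" by simp
        also have "\<dots> \<le> 2 * B * pi / of_nat (Suc n)"
        proof (rule divide_left_mono)
          have "3 * T n \<le> pi * T n" using pi_gt3 by (intro mult_right_mono) (auto simp: T_def)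
          also have "\<dots> \<le> sinh (pi * T n)"
            unfolding sinh_eq by (rule real_le_x_sinh) (simp add: T_def)
          finally show "of_nat (Suc n) \<le> sinh (pi * T n) - 1" by (simp add: T_def)
          then show "0 < (sinh (pi * T n) - 1) * of_nat (Suc n)" by (intro mult_pos_pos) auto
        qed (use B in simp)
        finally show ?thesis .
      qed
      then show "\<forall>\<^sub>F n in sequentially. norm (E n) \<le> 2 * B * pi / of_nat (Suc n)"
        by simp
      show "(\<lambda>n. 2 * B * pi / of_nat (Suc n)) \<longlonglongrightarrow> 0"
        by (rule LIMSEQ_Suc[OF lim_const_over_n])
    qed
  qed
  have "(\<lambda>n. 2 * of_real pi * \<i> * h (of_real \<theta>) - E n) \<longlonglongrightarrow> 2 * of_real pi * \<i> * h (of_real \<theta>) - 0"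
    by (intro tendsto_intros E0)
  moreover have "(\<lambda>n. 2 * of_real pi * \<i> * h (of_real \<theta>) - E n) \<longlonglongrightarrow>
     2 * of_real pi * \<i> * (LINT t|lborel. k0 t)
    + 2 * of_real pi * \<i> * (LINT t|lborel. k1 t)"
    unfolding eq by (intro tendsto_intros lim i0 i1)
  ultimately have "2 * of_real pi * \<i> * h (of_real \<theta>) - 0 =
     2 * of_real pi * \<i> * (LINT t|lborel. k0 t)
    + 2 * of_real pi * \<i> * (LINT t|lborel. k1 t)"
    by (rule LIMSEQ_unique)
  then have "2 * of_real pi * \<i> * h (of_real \<theta>) = 2 * of_real pi * \<i> * ((LINT t|lborel. k0 t)
    + (LINT t|lborel. k1 t))"
    by (simp add: algebra_simps)
  then show ?thesis
    by (subst (asm) mult_left_cancel) (auto simp: k0_def k1_def)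
qed

end

text \<open>In the Poisson formula at \<theta> the left line contributes at most its mass. Since
  both masses add up to 1, Re h(\<theta>) - 1 is at most the integral of
  \<open>strip_kernel1\<close> times |h| - 1. Division by \<theta> and the limit \<theta> to 0 give
  Re D on the left and the \<open>beta0\<close>-average of |h| - 1 on the right.\<close>

lemma strip_derivative_le_zero:
  fixes h :: "complex \<Rightarrow> complex"
  assumes hol: "h holomorphic_on UNIV" and bnd: "\<And>z. 0 \<le> Re z \<Longrightarrow> Re z \<le> 1 \<Longrightarrow> norm (h z) \<le> B"
    and h0: "h 0 = 1" and left: "\<And>t. norm (h (Complex 0 t)) \<le> 1"
    and deriv: "(h has_field_derivative D) (at 0)"
    and right: "(LINT t|lborel. beta0 t * norm (h (Complex 1 t))) \<le> 1"
  shows "Re D \<le> 0"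
proof -
  define \<theta> where "\<theta> = (\<lambda>n. 1 / (real n + 2))"
  \<comment> \<open>The bound 1/2 keeps cos(pi \<theta>) nonnegative; together with sin x \<le> x
    this dominates the divided kernel by \<open>2 * beta0 t\<close>.\<close>
  have \<theta>: "0 < \<theta> n" "\<theta> n < 1" "\<theta> n \<le> 1 / 2" for n by (auto simp: \<theta>_def field_simps)
  have hcont: "continuous_on A h" for A
    using holomorphic_on_imp_continuous_on[OF hol] continuous_on_subset by blast
  have meas [measurable]: "(\<lambda>t. h (Complex c t)) \<in> borel_measurable borel" for c
    by (intro borel_measurable_continuous_onI continuous_on_compose2[OF hcont] continuous_intros) auto
  have B: "0 \<le> B" using bnd[of 0] order_trans[OF norm_ge_zero] by auto
  define k where "k = (\<lambda>t. norm (h (Complex 1 t)) - 1)"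
  have k_bound: "\<bar>k t\<bar> \<le> B + 1" for t
    using bnd[of "Complex 1 t"] norm_ge_zero[of "h (Complex 1 t)"] B by (simp add: k_def abs_le_iff del: norm_ge_zero)
  have [measurable]: "k \<in> borel_measurable borel" unfolding k_def by measurable
  have upper: "(Re (h (of_real (\<theta> n))) - 1) / \<theta> n \<le> (LINT t|lborel. strip_kernel1 (\<theta> n) t / \<theta> n * k t)" for n
  proof -
    note [measurable] = strip_kernel_measurable[OF \<theta>(1,2)[of n]]
    let ?K0 = "strip_kernel0 (\<theta> n)" and ?K1 = "strip_kernel1 (\<theta> n)"
    note ik = integrable_strip_kernel[OF \<theta>(1,2)[of n]]
    have i0: "integrable lborel (\<lambda>t. of_real (?K0 t) * h (Complex 0 t))"
      by (rule ik(1)[OF meas, of _ B]) (auto intro: bnd)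
    have i1: "integrable lborel (\<lambda>t. of_real (?K1 t) * h (Complex 1 t))"
      by (rule ik(2)[OF meas, of _ B]) (auto intro: bnd)
    have j: "integrable lborel ?K0" "integrable lborel ?K1"
      using ik(1)[of "\<lambda>_. 1" 1, THEN integrable_norm] ik(2)[of "\<lambda>_. 1" 1, THEN integrable_norm]
      by (auto simp: strip_kernel_nonneg[OF \<theta>(1,2)])
    have j1: "integrable lborel (\<lambda>t. ?K1 t * norm (h (Complex 1 t)))"
      using i1[THEN integrable_norm] by (simp add: norm_mult strip_kernel_nonneg[OF \<theta>(1,2)])
    \<comment> \<open>The total mass of the kernels is the Poisson formula for the constant function
      1.\<close>
    have "complex_of_real 1 = (LINT t|lborel. of_real (?K0 t) * 1) + (LINT t|lborel. of_real (?K1 t) * 1)"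
      using poisson_strip[OF \<theta>(1,2), of "\<lambda>_. 1" 1 n] by simp
    also have "\<dots> = of_real ((LINT t|lborel. ?K0 t) + (LINT t|lborel. ?K1 t))"
      by simp
    finally have one: "(LINT t|lborel. ?K0 t) + (LINT t|lborel. ?K1 t) = 1"
      unfolding of_real_eq_iff by simp
    have "Re (h (of_real (\<theta> n))) = (LINT t|lborel. Re (of_real (?K0 t) * h (Complex 0 t)))
        + (LINT t|lborel. Re (of_real (?K1 t) * h (Complex 1 t)))"
      by (subst poisson_strip[OF \<theta>(1,2) hol bnd]) (simp_all only: plus_complex.sel integral_Re[OF i0] integral_Re[OF i1])
    also have "\<dots> \<le> (LINT t|lborel. ?K0 t) + (LINT t|lborel. ?K1 t * norm (h (Complex 1 t)))"
    proof (intro add_mono integral_mono)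
      show "Re (of_real (?K0 t) * h (Complex 0 t)) \<le> ?K0 t" for t
        using mult_left_mono[OF order_trans[OF complex_Re_le_cmod left[of t]] strip_kernel_nonneg(1)[OF \<theta>(1,2)[of n], of t]] by simp
      show "Re (of_real (?K1 t) * h (Complex 1 t)) \<le> ?K1 t * norm (h (Complex 1 t))" for t
        using mult_left_mono[OF complex_Re_le_cmod[of "h (Complex 1 t)"] strip_kernel_nonneg(2)[OF \<theta>(1,2)[of n], of t]] by simp
    qed (use integrable_Re[OF i0] integrable_Re[OF i1] j j1 in auto)
    also have "\<dots> = 1 + (LINT t|lborel. ?K1 t * k t)"
      using one j(2) j1 by (simp add: k_def algebra_simps Bochner_Integration.integral_diff)
    finally have "(Re (h (of_real (\<theta> n))) - 1) / \<theta> n \<le> (LINT t|lborel. ?K1 t * k t) / \<theta> n"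
      using \<theta>[of n] by (intro divide_right_mono) auto
    then show ?thesis by simp
  qed
  have \<theta>_lim: "\<theta> \<longlonglongrightarrow> 0" unfolding \<theta>_def by real_asymp
  have "(\<lambda>n. (h (of_real (\<theta> n)) - 1) / of_real (\<theta> n)) \<longlonglongrightarrow> D"
  proof -
    have "(\<lambda>z. (h z - h 0) / (z - 0)) \<midarrow>0\<rightarrow> D"
      using deriv by (simp add: has_field_derivative_iff)
    moreover have "filterlim (\<lambda>n. complex_of_real (\<theta> n)) (at 0) sequentially"
      unfolding filterlim_at using \<theta>(1) tendsto_of_real[OF \<theta>_lim, where 'a = complex]
      by (auto simp: less_imp_neq[symmetric])
    ultimately show ?thesis
      using filterlim_compose[of "\<lambda>z. (h z - h 0) / (z - 0)"] h0 by fastforce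
  qed
  then have "(\<lambda>n. Re ((h (of_real (\<theta> n)) - 1) / of_real (\<theta> n))) \<longlonglongrightarrow> Re D"
    by (rule tendsto_Re)
  then have lim1: "(\<lambda>n. (Re (h (of_real (\<theta> n))) - 1) / \<theta> n) \<longlonglongrightarrow> Re D"
    by simp
  have lim2: "(\<lambda>n. LINT t|lborel. strip_kernel1 (\<theta> n) t / \<theta> n * k t) \<longlonglongrightarrow> (LINT t|lborel. beta0 t * k t)"
  proof (rule integral_dominated_convergence[where w = "\<lambda>t. 2 * (B + 1) * beta0 t"])
    show "(\<lambda>t. strip_kernel1 (\<theta> n) t / \<theta> n * k t) \<in> borel_measurable lborel" for n
      using strip_kernel_measurable[OF \<theta>(1,2)[of n]] by measurable
    show "AE t in lborel. (\<lambda>n. strip_kernel1 (\<theta> n) t / \<theta> n * k t) \<longlonglongrightarrow> beta0 t * k t"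
    proof (intro AE_I2)
      fix t
      have "(\<lambda>n. sin (pi * \<theta> n) / \<theta> n) \<longlonglongrightarrow> pi" "(\<lambda>n. cos (pi * \<theta> n)) \<longlonglongrightarrow> 1"
        unfolding \<theta>_def by real_asymp+
      then have "(\<lambda>n. (sin (pi * \<theta> n) / \<theta> n) / (2 * (cosh (pi * t) + cos (pi * \<theta> n))) * k t) \<longlonglongrightarrow> pi / (2 * (cosh (pi * t) + 1)) * k t"
        by (intro tendsto_intros) (use cosh_gt_minus_one[of "pi * t"] in auto)
      then show "(\<lambda>n. strip_kernel1 (\<theta> n) t / \<theta> n * k t) \<longlonglongrightarrow> beta0 t * k t"
        by (simp add: strip_kernel1_def beta0_eq divide_divide_eq_left mult.commute)
    qed
    show "AE t in lborel. norm (strip_kernel1 (\<theta> n) t / \<theta> n * k t) \<le> 2 * (B + 1) * beta0 t" for n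
    proof (intro AE_I2)
      fix t
      have "strip_kernel1 (\<theta> n) t \<le> 2 * sin (pi * \<theta> n) / (pi * (1 + cos (pi * \<theta> n))) * beta0 t"
        by (rule strip_kernel1_le[OF \<theta>(1,2)])
      also have "2 * sin (pi * \<theta> n) / (pi * (1 + cos (pi * \<theta> n))) \<le> 2 * (pi * \<theta> n) / (pi * 1)"
      proof (intro frac_le mult_left_mono)
        show "sin (pi * \<theta> n) \<le> pi * \<theta> n" by (rule sin_x_le_x) (use \<theta>(1)[of n] in auto)
        show "1 \<le> 1 + cos (pi * \<theta> n)" using \<theta>[of n] by (auto intro!: cos_ge_zero simp: field_simps intro: order_trans[of _ 0])
      qed (use \<theta>(1)[of n] in auto)
      finally have "strip_kernel1 (\<theta> n) t / \<theta> n \<le> 2 * beta0 t"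
        using \<theta>(1)[of n] beta0_pos[of t] by (simp add: field_simps)
      then have "\<bar>strip_kernel1 (\<theta> n) t / \<theta> n\<bar> * \<bar>k t\<bar> \<le> (2 * beta0 t) * (B + 1)"
        using \<theta>(1)[of n] by (intro mult_mono k_bound) (auto simp: strip_kernel_nonneg[OF \<theta>(1,2)] beta0_pos less_imp_le)
      then show "norm (strip_kernel1 (\<theta> n) t / \<theta> n * k t) \<le> 2 * (B + 1) * beta0 t"
        by (simp add: abs_mult mult_ac)
    qed
  qed (use integrable_beta0 in auto)
  have "Re D \<le> (LINT t|lborel. beta0 t * k t)"
    by (rule LIMSEQ_le[OF lim1 lim2]) (use upper in auto)
  also have "\<dots> = (LINT t|lborel. beta0 t * norm (h (Complex 1 t))) - (LINT t|lborel. beta0 t)"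
  proof -
    have "integrable lborel (\<lambda>t. beta0 t * norm (h (Complex 1 t)))"
      by (rule integrable_beta0_mult[of _ B])
        (use bnd beta0_pos in \<open>auto simp: abs_mult less_imp_le intro!: mult_mono\<close>)
    then show ?thesis
      using integrable_beta0 by (simp add: k_def algebra_simps)
  qed
  also have "\<dots> \<le> 0" using right integral_beta0 by simp
  finally show ?thesis .
qed

text \<open>Reduction to the case c = 1: multiplying h by c^(-z) keeps moduli on the imaginary axis,
  divides them by c on Re z = 1 and shifts the derivative at 0 by -ln c.\<close>

lemma strip_derivative_le_ln:
  fixes h :: "complex \<Rightarrow> complex"
  assumes hol: "h holomorphic_on UNIV" and bnd: "\<And>z. 0 \<le> Re z \<Longrightarrow> Re z \<le> 1 \<Longrightarrow> norm (h z) \<le> B"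
    and h0: "h 0 = 1" and left: "\<And>t. norm (h (Complex 0 t)) \<le> 1"
    and deriv: "(h has_field_derivative D) (at 0)" and c: "c > 0"
    and right: "(LINT t|lborel. beta0 t * norm (h (Complex 1 t))) \<le> c"
  shows "Re D \<le> ln c"
proof -
  define k where "k = (\<lambda>z. h z * exp (- of_real (ln c) * z))"
  have "Re (D - of_real (ln c)) \<le> 0"
  proof (rule strip_derivative_le_zero)
    show "k holomorphic_on UNIV" unfolding k_def by (intro holomorphic_intros hol)
    show "norm (k z) \<le> B * exp \<bar>ln c\<bar>" if "0 \<le> Re z" "Re z \<le> 1" for z
    proof -
      have "- (ln c * Re z) \<le> \<bar>ln c\<bar> * 1"
        using that by (intro order_trans[OF abs_ge_minus_self]) (auto simp: abs_mult intro!: mult_left_le)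
      moreover have "0 \<le> B" using bnd[OF that] order_trans[OF norm_ge_zero] by auto
      ultimately show ?thesis
        using bnd[OF that] by (auto simp: k_def norm_mult norm_exp_eq_Re intro!: mult_mono)
    qed
    show "k 0 = 1" by (simp add: k_def h0)
    show "norm (k (Complex 0 t)) \<le> 1" for t using left[of t] by (simp add: k_def norm_mult norm_exp_eq_Re)
    show "(k has_field_derivative D - of_real (ln c)) (at 0)"
      unfolding k_def by (rule derivative_eq_intros deriv refl | simp add: h0)+
    have "norm (exp (- of_real (ln c) * Complex 1 t)) = 1 / c" for t
      unfolding norm_exp_eq_Re using c by (simp add: exp_minus inverse_eq_divide)
    then have "beta0 t * norm (k (Complex 1 t)) = (beta0 t * norm (h (Complex 1 t))) / c" for t
      by (simp add: k_def norm_mult)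
    then show "(LINT t|lborel. beta0 t * norm (k (Complex 1 t))) \<le> 1"
      using right c by simp
  qed
  then show ?thesis by simp
qed

subsection \<open>Complex matrices\<close>

abbreviation dag :: "complex mat \<Rightarrow> complex mat" where "dag \<equiv> mat_adjoint"

lemma dag_dim [simp]: "dim_row (dag A) = dim_col A" "dim_col (dag A) = dim_row A"
  by (auto simp: mat_adjoint_def)

lemma dag_carrier [simp, intro]: "A \<in> carrier_mat n m \<Longrightarrow> dag A \<in> carrier_mat m n"
  by (intro carrier_matI) (simp_all add: carrier_matD)

lemma dag_index [simp]: "i < dim_col A \<Longrightarrow> j < dim_row A \<Longrightarrow> dag A $$ (i, j) = cnj (A $$ (j, i))"
  by (simp add: mat_adjoint_def mat_of_rows_def)

lemma dag_dag [simp]: "dag (dag A) = A"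
  by (rule eq_matI) auto

lemma times_mat_index:
  assumes "A \<in> carrier_mat n m" "B \<in> carrier_mat m k" "i < n" "j < k"
  shows "(A * B) $$ (i, j) = (\<Sum>l<m. A $$ (i, l) * B $$ (l, j))"
  using assms by (auto simp: scalar_prod_def atLeast0LessThan intro!: sum.cong)

declare index_mult_mat(1) [simp del]

lemma dag_mult:
  assumes "A \<in> carrier_mat n m" "B \<in> carrier_mat m k"
  shows "dag (A * B) = dag B * dag A"
proof (rule eq_matI)
  fix i j assume "i < dim_row (dag B * dag A)" "j < dim_col (dag B * dag A)"
  then have ij: "i < k" "j < n" using assms by auto
  then show "dag (A * B) $$ (i, j) = (dag B * dag A) $$ (i, j)"
    using assms by (subst dag_index, simp, simp)
      (auto simp: times_mat_index[of A n m B k] times_mat_index[of "dag B" k m "dag A" n] mult.commute intro!: sum.cong)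
qed (use assms in auto)

lemma dag_one [simp]: "dag (1\<^sub>m n) = 1\<^sub>m n"
  by (rule eq_matI) auto

lemma dag_minus: "A \<in> carrier_mat n m \<Longrightarrow> B \<in> carrier_mat n m \<Longrightarrow> dag (A - B) = dag A - dag B"
  by (rule eq_matI) auto

lemma dag_mat_diag [simp]: "dag (mat_diag n f) = mat_diag n (\<lambda>i. cnj (f i))"
  by (rule eq_matI) (auto simp: mat_diag_def)

lemma mat_diag_index: "i < n \<Longrightarrow> j < n \<Longrightarrow> mat_diag n f $$ (i, j) = (if i = j then f j else 0)"
  by (simp add: mat_diag_def)

lemma mat_diag_cong: "(\<And>i. i < n \<Longrightarrow> f i = g i) \<Longrightarrow> mat_diag n f = mat_diag n g"
  by (rule eq_matI) (auto simp: mat_diag_def)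

lemma mat_diag_dims [simp]: "dim_row (mat_diag n f) = n" "dim_col (mat_diag n f) = n"
  by (auto simp: mat_diag_def)

lemma trace_one [simp]: "mat_trace (1\<^sub>m n) = of_nat n"
  by (simp add: mat_trace_def)

lemma trace_add: "A \<in> carrier_mat n n \<Longrightarrow> B \<in> carrier_mat n n \<Longrightarrow> mat_trace (A + B) = mat_trace A + mat_trace B"
  by (auto simp: mat_trace_def sum.distrib intro!: sum.cong)

lemma trace_minus: "A \<in> carrier_mat n n \<Longrightarrow> B \<in> carrier_mat n n \<Longrightarrow> mat_trace (A - B) = mat_trace A - mat_trace B"
  by (auto simp: mat_trace_def sum_subtractf intro!: sum.cong)

lemma trace_smult: "A \<in> carrier_mat n n \<Longrightarrow> mat_trace (c \<cdot>\<^sub>m A) = c * mat_trace A"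
  by (auto simp: mat_trace_def sum_distrib_left intro!: sum.cong)

lemma trace_mult:
  assumes "A \<in> carrier_mat n m" "B \<in> carrier_mat m n"
  shows "mat_trace (A * B) = (\<Sum>i<n. \<Sum>j<m. A $$ (i, j) * B $$ (j, i))"
  using assms by (auto simp: mat_trace_def times_mat_index intro!: sum.cong)

lemma trace_comm:
  assumes "A \<in> carrier_mat n m" "B \<in> carrier_mat m n"
  shows "mat_trace (A * B) = mat_trace (B * A)"
  unfolding trace_mult[OF assms] trace_mult[OF assms(2,1)]
  by (subst sum.swap) (simp add: mult.commute)

text \<open>A single dimension for all factors: in the general rule the inner dimensions occur only
  in the premises, where rewriting cannot determine them.\<close>

lemmas square_assoc = assoc_mult_mat[of _ n n _ n _ n for n]

lemma mult_carrier_square [simp, intro]: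
  "A \<in> carrier_mat n n \<Longrightarrow> B \<in> carrier_mat n n \<Longrightarrow> A * B \<in> carrier_mat n n"
  by (rule mult_carrier_mat)

lemma unitary_left: "U \<in> carrier_mat n n \<Longrightarrow> U * dag U = 1\<^sub>m n \<Longrightarrow> dag U * U = 1\<^sub>m n"
  by (rule mat_mult_left_right_inverse[of U n "dag U"]) auto

lemma one_mult_square [simp]:
  fixes A :: "complex mat"
  shows
  "A \<in> carrier_mat n n \<Longrightarrow> 1\<^sub>m n * A = A" "A \<in> carrier_mat n n \<Longrightarrow> A * 1\<^sub>m n = A"
  by (rule left_mult_one_mat, assumption) (rule right_mult_one_mat, assumption)

text \<open>Cancels an inverse pair at the head of a right-nested product, the shape that
  \<open>square_assoc\<close> produces.\<close>

lemma mult_cancel_inverse: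
  fixes A :: "complex mat"
  assumes "A \<in> carrier_mat n n" "B \<in> carrier_mat n n" "A * B = 1\<^sub>m n" "C \<in> carrier_mat n n"
  shows "A * (B * C) = C"
proof -
  have "A * (B * C) = (A * B) * C" by (rule assoc_mult_mat[OF assms(1,2,4), symmetric])
  then show ?thesis using assms by simp
qed

subsection \<open>The spectral theorem\<close>

definition spectral :: "nat \<Rightarrow> complex mat \<Rightarrow> complex mat \<Rightarrow> (nat \<Rightarrow> real) \<Rightarrow> bool" where
  "spectral n M U l \<longleftrightarrow> U \<in> carrier_mat n n \<and> U * dag U = 1\<^sub>m n \<and>
     M = U * mat_diag n (\<lambda>i. complex_of_real (l i)) * dag U"

text \<open>The reflection along u = e_0 - v exchanges e_0 and v. As v 0 is real, u has squared norm
  2 (1 - v 0), which explains the coefficient c = 1 / (1 - v 0). If v 0 = 1, then v is e_0 and the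
  identity matrix serves.\<close>

lemma householder:
  fixes v :: "nat \<Rightarrow> complex"
  assumes n: "0 < n" and unit: "(\<Sum>i<n. v i * cnj (v i)) = 1" and v0: "v 0 \<in> \<real>"
  obtains W where "W \<in> carrier_mat n n" "W * dag W = 1\<^sub>m n" "\<And>i. i < n \<Longrightarrow> W $$ (i, 0) = v i"
proof (cases "v 0 = 1")
  case True
  have "(\<Sum>i<n. (cmod (v i))\<^sup>2) = 1"
    using unit by (simp add: complex_norm_square[symmetric] flip: of_real_sum of_real_power) 
  moreover have "(\<Sum>i<n. (cmod (v i))\<^sup>2) = (cmod (v 0))\<^sup>2 + (\<Sum>i\<in>{..<n} - {0}. (cmod (v i))\<^sup>2)"
    using n by (intro sum.remove) auto
  ultimately have "(\<Sum>i\<in>{..<n} - {0}. (cmod (v i))\<^sup>2) = 0" using True by simp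
  then have z: "v i = 0" if "i < n" "i \<noteq> 0" for i
    using that by (subst (asm) sum_nonneg_eq_0_iff) auto
  show thesis
    by (rule that[of "1\<^sub>m n"]) (use True n z in \<open>auto\<close>)
next
  case False
  obtain r where r: "v 0 = complex_of_real r" using v0 by (auto simp: Reals_def)
  define u where "u = (\<lambda>i. (if i = 0 then 1 else 0) - v i)"
  define c where "c = 1 / (1 - v 0)"
  have c: "c * (1 - v 0) = 1" using False by (simp add: c_def)
  have cr: "cnj c = c" by (simp add: c_def r)
  have uu: "(\<Sum>k<n. u k * cnj (u k)) = 2 * (1 - v 0)"
  proof -
    have "(\<Sum>k<n. u k * cnj (u k)) = (\<Sum>k<n. v k * cnj (v k) + (if k = 0 then 1 - v k - cnj (v k) else 0))"
      by (intro sum.cong) (auto simp: u_def algebra_simps)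
    also have "\<dots> = 1 + (1 - v 0 - cnj (v 0))"
      using n by (simp add: sum.distrib unit)
    finally show ?thesis by (simp add: r)
  qed
  define W where "W = mat n n (\<lambda>(i, j). (if i = j then 1 else 0) - c * u i * cnj (u j))"
  have W: "W \<in> carrier_mat n n" by (simp add: W_def)
  have dW: "dag W = W"
    by (rule eq_matI) (auto simp: W_def cr)
  have "W * W = 1\<^sub>m n"
  proof (rule eq_matI)
    fix i j assume "i < dim_row (1\<^sub>m n :: complex mat)" "j < dim_col (1\<^sub>m n :: complex mat)"
    then have ij: "i < n" "j < n" by auto
    have "(W * W) $$ (i, j) = (\<Sum>k<n. ((if i = k then 1 else 0) - c * u i * cnj (u k)) * ((if k = j then 1 else 0) - c * u k * cnj (u j)))"
      using ij by (simp add: times_mat_index[OF W W]) (simp add: W_def)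
    also have "\<dots> = (\<Sum>k<n. (if k = i then (if k = j then 1 else 0) - c * u k * cnj (u j) else 0)
        - (if k = j then c * u i * cnj (u k) else 0) + c * c * u i * cnj (u j) * (u k * cnj (u k)))"
      by (intro sum.cong) (auto simp: algebra_simps)
    also have "\<dots> = ((if i = j then 1 else 0) - c * u i * cnj (u j)) - c * u i * cnj (u j)
        + c * c * u i * cnj (u j) * (\<Sum>k<n. u k * cnj (u k))"
      using ij by (simp add: sum.distrib sum_subtractf sum_distrib_left)
    also have "c * c * u i * cnj (u j) * (\<Sum>k<n. u k * cnj (u k)) = 2 * (c * (1 - v 0)) * (c * u i * cnj (u j))"
      unfolding uu by (simp add: algebra_simps)
    finally show "(W * W) $$ (i, j) = 1\<^sub>m n $$ (i, j)" using ij by (simp add: c)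
  qed (use W in auto)
  moreover have "W $$ (i, 0) = v i" if "i < n" for i
  proof -
    have "W $$ (i, 0) = (if i = 0 then 1 else 0) - (c * (1 - v 0)) * u i"
      using that n by (simp add: W_def u_def r)
    then show ?thesis unfolding c by (simp add: u_def)
  qed
  ultimately show thesis using that[OF W] dW by simp
qed

text \<open>An eigenvector may be multiplied by a phase; the factor p uses this freedom to make
  component 0 real, as \<open>householder\<close> requires.\<close>

lemma unit_eigenvector:
  assumes A: "(A :: complex mat) \<in> carrier_mat n n" and n: "0 < n"
  obtains v e where "(\<Sum>i<n. v i * cnj (v i)) = 1" "v 0 \<in> \<real>"
    "\<And>i. i < n \<Longrightarrow> (\<Sum>j<n. A $$ (i, j) * v j) = e * v i"
proof -
  have "degree (char_poly A) = n" using degree_monic_char_poly[OF A] by simp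
  then have "\<not> constant (poly (char_poly A))" using n by (simp add: constant_degree)
  then obtain e where "poly (char_poly A) e = 0" using Fundamental_Theorem_Algebra.fundamental_theorem_of_algebra by blast
  then have "eigenvalue A e" by (simp add: eigenvalue_root_char_poly[OF A])
  then obtain w where w: "w \<in> carrier_vec n" "w \<noteq> 0\<^sub>v n" "A *\<^sub>v w = e \<cdot>\<^sub>v w"
    using A by (auto simp: eigenvalue_def eigenvector_def)
  define s where "s = (\<Sum>i<n. (cmod (w $ i))\<^sup>2)"
  have "\<exists>i<n. w $ i \<noteq> 0" using w by (metis carrier_vecD eq_vecI index_zero_vec)
  then have "s \<noteq> 0" unfolding s_def by (subst sum_nonneg_eq_0_iff) auto
  then have s: "s > 0" unfolding s_def by (smt (verit) sum_nonneg zero_le_power2)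
  define p where "p = (if w $ 0 = 0 then 1 else cnj (w $ 0) / of_real (cmod (w $ 0)))"
  have p: "p * cnj p = 1"
    by (simp only: complex_norm_square[symmetric]) (auto simp: p_def norm_divide)
  define c where "c = p / of_real (sqrt s)"
  have cc: "c * cnj c = 1 / of_real s"
    using s by (simp add: c_def p flip: of_real_mult)
  define v where "v = (\<lambda>i. c * w $ i)"
  show thesis
  proof (rule that[of v e])
    have "(\<Sum>i<n. v i * cnj (v i)) = (\<Sum>i<n. (c * cnj c) * of_real ((cmod (w $ i))\<^sup>2))"
      by (intro sum.cong) (simp_all add: v_def complex_norm_square mult_ac flip: of_real_power)
    also have "\<dots> = 1" unfolding sum_distrib_left[symmetric] cc using s by (simp add: s_def flip: of_real_sum of_real_power)
    finally show "(\<Sum>i<n. v i * cnj (v i)) = 1" .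
    have "p * w $ 0 = of_real (cmod (w $ 0))"
      by (auto simp: p_def complex_norm_square[symmetric] power2_eq_square mult.commute[of "cnj _"])
    then have "v 0 = of_real (cmod (w $ 0) / sqrt s)" by (simp add: v_def c_def)
    then show "v 0 \<in> \<real>" by (metis Reals_of_real)
    fix i assume i: "i < n"
    have "(A *\<^sub>v w) $ i = e * w $ i" using w i by simp
    then have "(\<Sum>j<n. A $$ (i, j) * w $ j) = e * w $ i"
      using A i w(1) by (simp add: scalar_prod_def atLeast0LessThan)
    then have "c * (\<Sum>j<n. A $$ (i, j) * w $ j) = e * v i" by (simp add: v_def)
    then show "(\<Sum>j<n. A $$ (i, j) * v j) = e * v i"
      by (simp add: v_def sum_distrib_left mult_ac)
  qed
qed

text \<open>Deflation. A unitary W with an eigenvector as column 0 makes column 0 of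
  \<open>dag W * A * W\<close> vanish below the corner, and hermiticity carries this to row 0. The
  induction hypothesis diagonalizes the remaining block.\<close>

lemma spectral_theorem:
  assumes "A \<in> carrier_mat n n" "dag A = A"
  shows "\<exists>U l. spectral n A U l"
  using assms
proof (induction n arbitrary: A)
  case 0
  show ?case
    by (intro exI[of _ "1\<^sub>m 0"] exI[of _ "\<lambda>_. 0"]) (use 0 in \<open>auto simp: spectral_def intro!: eq_matI\<close>)
next
  case (Suc n)
  note A = Suc.prems
  obtain v e where v: "(\<Sum>i<Suc n. v i * cnj (v i)) = 1" "v 0 \<in> \<real>"
    "\<And>i. i < Suc n \<Longrightarrow> (\<Sum>j<Suc n. A $$ (i, j) * v j) = e * v i"
    using unit_eigenvector[OF A(1)] by blast
  obtain W where W: "W \<in> carrier_mat (Suc n) (Suc n)" "W * dag W = 1\<^sub>m (Suc n)"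
    "\<And>i. i < Suc n \<Longrightarrow> W $$ (i, 0) = v i"
    using householder[OF _ v(1,2)] by blast
  note W' = unitary_left[OF W(1,2)]
  define C where "C = dag W * A * W"
  have C: "C \<in> carrier_mat (Suc n) (Suc n)" using A W by (simp add: C_def)
  have dC: "dag C = C"
    unfolding C_def using A W
    by (simp add: dag_mult[of _ "Suc n" "Suc n" _ "Suc n"] square_assoc[of _ "Suc n"])
  have C0: "C $$ (i, 0) = (if i = 0 then e else 0)" if i: "i < Suc n" for i
  proof -
    have "(A * W) $$ (k, 0) = e * W $$ (k, 0)" if "k < Suc n" for k
      using that v(3)[OF that] W(3) by (simp add: times_mat_index[OF A(1) W(1)] del: sum.lessThan_Suc)
    then have "(dag W * (A * W)) $$ (i, 0) = (\<Sum>k<Suc n. dag W $$ (i, k) * (e * W $$ (k, 0)))"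
      using i A W by (subst times_mat_index[of _ "Suc n" "Suc n" _ "Suc n"]) (auto simp del: sum.lessThan_Suc)
    also have "\<dots> = e * (dag W * W) $$ (i, 0)"
      using i W by (subst times_mat_index[of "dag W" "Suc n" "Suc n" W "Suc n"]) (auto simp: sum_distrib_left mult_ac simp del: sum.lessThan_Suc)
    finally show ?thesis using i A W by (simp add: W' C_def square_assoc[of _ "Suc n"])
  qed
  have C0': "C $$ (0, i) = (if i = 0 then cnj e else 0)" if i: "i < Suc n" for i
  proof -
    have "C $$ (0, i) = dag C $$ (0, i)" by (simp add: dC)
    also have "\<dots> = cnj (C $$ (i, 0))" using C i by simp
    finally show ?thesis using C0[OF i] by simp
  qed
  \<comment> \<open>The corner entry equals its own conjugate, so the eigenvalue is real.\<close>
  have e: "of_real (Re e) = e" using C0[of 0] C0'[of 0] by (simp add: complex_eq_iff)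
  define B where "B = mat n n (\<lambda>(i, j). C $$ (Suc i, Suc j))"
  have "dag B = B"
  proof (rule eq_matI)
    fix i j assume "i < dim_row B" "j < dim_col B"
    then have ij: "i < n" "j < n" by (auto simp: B_def)
    have "C $$ (Suc i, Suc j) = dag C $$ (Suc i, Suc j)" by (simp add: dC)
    also have "\<dots> = cnj (C $$ (Suc j, Suc i))" using C ij by simp
    finally show "dag B $$ (i, j) = B $$ (i, j)" using ij by (simp add: B_def)
  qed (auto simp: B_def)
  then obtain V m where V: "spectral n B V m"
    using Suc.IH[of B] by (auto simp: B_def)
  then have V: "V \<in> carrier_mat n n" "V * dag V = 1\<^sub>m n" "B = V * mat_diag n (\<lambda>i. of_real (m i)) * dag V"
    by (auto simp: spectral_def)
  define X where "X = mat (Suc n) (Suc n) (\<lambda>(i, j). case i of 0 \<Rightarrow> (case j of 0 \<Rightarrow> 1 | Suc j \<Rightarrow> 0)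
    | Suc i \<Rightarrow> (case j of 0 \<Rightarrow> 0 | Suc j \<Rightarrow> V $$ (i, j)))"
  define l where "l = (\<lambda>i. case i of 0 \<Rightarrow> Re e | Suc i \<Rightarrow> m i)"
  have X: "X \<in> carrier_mat (Suc n) (Suc n)" by (simp add: X_def)
  have X_index: "X $$ (0, 0) = 1" "\<And>i. i < n \<Longrightarrow> X $$ (Suc i, 0) = 0" "\<And>i. i < n \<Longrightarrow> X $$ (0, Suc i) = 0"
    "\<And>i j. i < n \<Longrightarrow> j < n \<Longrightarrow> X $$ (Suc i, Suc j) = V $$ (i, j)"
    by (auto simp: X_def)
  have XX: "X * dag X = 1\<^sub>m (Suc n)"
  proof (rule eq_matI)
    fix i j assume "i < dim_row (1\<^sub>m (Suc n) :: complex mat)" "j < dim_col (1\<^sub>m (Suc n) :: complex mat)"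
    then have ij: "i < Suc n" "j < Suc n" by auto
    have V1: "(\<Sum>k<n. V $$ (i, k) * cnj (V $$ (j, k))) = (if i = j then 1 else 0)" if "i < n" "j < n" for i j
    proof -
      have "(V * dag V) $$ (i, j) = (\<Sum>k<n. V $$ (i, k) * cnj (V $$ (j, k)))"
        using that V(1) by (subst times_mat_index[of _ n n _ n]) auto
      then show ?thesis using that by (simp add: V(2))
    qed
    have "(X * dag X) $$ (i, j) = (\<Sum>k<Suc n. X $$ (i, k) * cnj (X $$ (j, k)))"
      using ij X by (subst times_mat_index[of _ "Suc n" "Suc n" _ "Suc n"]) (auto simp del: sum.lessThan_Suc)
    also have "\<dots> = X $$ (i, 0) * cnj (X $$ (j, 0)) + (\<Sum>k<n. X $$ (i, Suc k) * cnj (X $$ (j, Suc k)))"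
      by (rule sum.lessThan_Suc_shift)
    also have "\<dots> = 1\<^sub>m (Suc n) $$ (i, j)"
      using ij by (cases i; cases j) (auto simp: X_index V1)
    finally show "(X * dag X) $$ (i, j) = 1\<^sub>m (Suc n) $$ (i, j)" .
  qed (use X in auto)
  have CX: "C = X * mat_diag (Suc n) (\<lambda>i. of_real (l i)) * dag X"
  proof (rule eq_matI)
    fix i j assume "i < dim_row (X * mat_diag (Suc n) (\<lambda>i. of_real (l i)) * dag X)" "j < dim_col (X * mat_diag (Suc n) (\<lambda>i. of_real (l i)) * dag X)"
    then have ij: "i < Suc n" "j < Suc n" using X by auto
    have B1: "B $$ (i, j) = (\<Sum>k<n. V $$ (i, k) * of_real (m k) * cnj (V $$ (j, k)))" if "i < n" "j < n" for i j
      unfolding V(3) using that V(1)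
      by (subst times_mat_index[of _ n n _ n]) (auto simp: mat_diag_mult_right[OF V(1)])
    have "(X * mat_diag (Suc n) (\<lambda>i. of_real (l i)) * dag X) $$ (i, j) = (\<Sum>k<Suc n. X $$ (i, k) * of_real (l k) * cnj (X $$ (j, k)))"
      using ij X by (subst times_mat_index[of _ "Suc n" "Suc n" _ "Suc n"]) (auto simp: mat_diag_mult_right[OF X] simp del: sum.lessThan_Suc)
    also have "\<dots> = X $$ (i, 0) * of_real (l 0) * cnj (X $$ (j, 0)) + (\<Sum>k<n. X $$ (i, Suc k) * of_real (l (Suc k)) * cnj (X $$ (j, Suc k)))"
      by (rule sum.lessThan_Suc_shift)
    also have "\<dots> = C $$ (i, j)"
    proof (cases i; cases j)
      fix i' j' assume i': "i = Suc i'" "j = Suc j'"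
      then have "C $$ (i, j) = B $$ (i', j')" using ij by (simp add: B_def)
      then show ?thesis using ij i' by (simp add: X_index l_def B1)
    qed (use ij C0[of i] C0'[of j] e in \<open>auto simp: X_index l_def\<close>)
    finally show "C $$ (i, j) = (X * mat_diag (Suc n) (\<lambda>i. of_real (l i)) * dag X) $$ (i, j)" ..
  qed (use C X in auto)
  have "spectral (Suc n) A (W * X) l"
    unfolding spectral_def
  proof (intro conjI)
    show "W * X \<in> carrier_mat (Suc n) (Suc n)" using W X by simp
    show "W * X * dag (W * X) = 1\<^sub>m (Suc n)"
      using W X XX by (simp add: dag_mult[of _ "Suc n" "Suc n" _ "Suc n"] square_assoc[of _ "Suc n"] mult_cancel_inverse[of _ "Suc n"])
    have "A = W * C * dag W"
      using W A W' by (simp add: C_def square_assoc[of _ "Suc n"] mult_cancel_inverse[of _ "Suc n"])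
    then show "A = W * X * mat_diag (Suc n) (\<lambda>i. of_real (l i)) * dag (W * X)"
      unfolding CX using W X by (simp add: dag_mult[of _ "Suc n" "Suc n" _ "Suc n"] square_assoc[of _ "Suc n"])
  qed
  then show ?case by blast
qed

subsection \<open>Functional calculus and positive semidefinite matrices\<close>

lemma mat_diag_mult_assoc:
  assumes "(A :: complex mat) \<in> carrier_mat n n"
  shows "mat_diag n f * (mat_diag n g * A) = mat_diag n (\<lambda>i. f i * g i) * A"
  using assoc_mult_mat[OF mat_diag_dim mat_diag_dim assms, of f g] by simp

lemma spectralD:
  assumes "spectral n M U l"
  shows "U \<in> carrier_mat n n" "U * dag U = 1\<^sub>m n" "dag U * U = 1\<^sub>m n"
    "M = U * mat_diag n (\<lambda>i. complex_of_real (l i)) * dag U" "M \<in> carrier_mat n n" "dag M = M"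
  using assms unitary_left[of U n]
  by (auto simp: spectral_def dag_mult[of _ n n _ n] square_assoc[of _ n])

text \<open>The unitary \<open>W = dag V * U\<close> intertwines the two diagonal matrices, so its
  entry (i, j) is nonzero only where l j = m i. There f takes equal values, hence W intertwines the
  images under f too. This makes the definite description in \<open>mat_fun\<close>
  meaningful.\<close>

lemma spectral_fun_unique:
  assumes M: "spectral n M U l" and N: "spectral n M V m"
  shows "U * mat_diag n (\<lambda>i. f (l i)) * dag U = V * mat_diag n (\<lambda>i. f (m i)) * dag V"
proof -
  note U = spectralD[OF M] note V = spectralD[OF N]
  note [simp] = U(1) V(1)
  define W where "W = dag V * U"
  have W: "W \<in> carrier_mat n n" by (simp add: W_def)
  let ?D = "mat_diag n (\<lambda>i. complex_of_real (l i))" and ?E = "mat_diag n (\<lambda>i. complex_of_real (m i))"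
  have "dag V * M * U = W * ?D"
    by (subst U(4)) (simp add: W_def square_assoc[of _ n] U(3))
  moreover have "dag V * M * U = ?E * W"
    by (subst V(4)) (simp add: W_def square_assoc[of _ n] mult_cancel_inverse[of _ n] V(3))
  ultimately have WD: "W * ?D = ?E * W" by simp
  have WF: "W * mat_diag n (\<lambda>i. f (l i)) = mat_diag n (\<lambda>i. f (m i)) * W"
  proof (rule eq_matI)
    fix i j assume "i < dim_row (mat_diag n (\<lambda>i. f (m i)) * W)" "j < dim_col (mat_diag n (\<lambda>i. f (m i)) * W)"
    then have ij: "i < n" "j < n" using W by auto
    have "(W * ?D) $$ (i, j) = (?E * W) $$ (i, j)" by (simp add: WD)
    then have "W $$ (i, j) * of_real (l j) = of_real (m i) * W $$ (i, j)"
      using ij W by (simp add: mat_diag_mult_left[OF W] mat_diag_mult_right[OF W])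
    then have "W $$ (i, j) = 0 \<or> l j = m i" by (simp add: mult.commute)
    then show "(W * mat_diag n (\<lambda>i. f (l i))) $$ (i, j) = (mat_diag n (\<lambda>i. f (m i)) * W) $$ (i, j)"
      using ij W by (auto simp: mat_diag_mult_left[OF W] mat_diag_mult_right[OF W])
  qed (use W in auto)
  have VW: "V * W = U" and WU: "W * dag U = dag V"
    by (simp_all add: W_def square_assoc[of _ n] U(2) mult_cancel_inverse[of _ n] V(2))
  have "U * mat_diag n (\<lambda>i. f (l i)) * dag U = V * (W * mat_diag n (\<lambda>i. f (l i))) * dag U"
    using W by (simp add: VW[symmetric] square_assoc[of _ n])
  also have "\<dots> = V * mat_diag n (\<lambda>i. f (m i)) * (W * dag U)"
    using W by (simp add: WF square_assoc[of _ n])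
  finally show ?thesis unfolding WU .
qed

lemma mat_fun_spectral:
  assumes "spectral n M U l"
  shows "mat_fun f M = U * mat_diag n (\<lambda>i. f (l i)) * dag U"
proof -
  have d: "dim_row M = n" using spectralD(5)[OF assms] by simp
  show ?thesis
    unfolding mat_fun_def Let_def d
  proof (rule the_equality)
    show "\<exists>V\<in>carrier_mat n n. \<exists>m::nat \<Rightarrow> real. V * dag V = 1\<^sub>m n \<and>
       M = V * mat_diag n (\<lambda>i. complex_of_real (m i)) * dag V \<and>
       U * mat_diag n (\<lambda>i. f (l i)) * dag U = V * mat_diag n (\<lambda>i. f (m i)) * dag V"
      using assms unfolding spectral_def by blast
  next
    fix N assume "\<exists>V\<in>carrier_mat n n. \<exists>m::nat \<Rightarrow> real. V * dag V = 1\<^sub>m n \<and>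
       M = V * mat_diag n (\<lambda>i. complex_of_real (m i)) * dag V \<and>
       N = V * mat_diag n (\<lambda>i. f (m i)) * dag V"
    then obtain V m where "spectral n M V m" "N = V * mat_diag n (\<lambda>i. f (m i)) * dag V"
      unfolding spectral_def by blast
    then show "N = U * mat_diag n (\<lambda>i. f (l i)) * dag U"
      using spectral_fun_unique[OF assms] by simp
  qed
qed

text \<open>The weights on the right do not depend on f. Linearity, monotonicity and derivatives of
  the trace in f thereby become statements about scalars.\<close>

lemma trace_mat_fun_spectral:
  assumes S: "spectral n M U l" and C: "P \<in> carrier_mat n n"
  shows "mat_trace (P * mat_fun f M) = (\<Sum>i<n. (dag U * P * U) $$ (i, i) * f (l i))"
proof -
  note U = spectralD(1-3)[OF S]
  have "mat_trace (P * mat_fun f M) = mat_trace ((P * U * mat_diag n (\<lambda>i. f (l i))) * dag U)"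
    using U C by (simp add: mat_fun_spectral[OF S] square_assoc[of _ n])
  also have "\<dots> = mat_trace ((dag U * P * U) * mat_diag n (\<lambda>i. f (l i)))"
    using U C by (subst trace_comm[of _ n n]) (auto simp: square_assoc[of _ n])
  also have "\<dots> = (\<Sum>i<n. (dag U * P * U) $$ (i, i) * f (l i))"
    using U C by (subst mat_diag_mult_right[of _ n n]) (auto simp: mat_trace_def)
  finally show ?thesis .
qed

section \<open>Positive semidefinite matrices\<close>

lemma adjoint_inner:
  assumes "X \<in> carrier_mat m n" "w \<in> carrier_vec n" "v \<in> carrier_vec m"
  shows "(X *\<^sub>v w) \<bullet>c v = w \<bullet>c (dag X *\<^sub>v v)"
proof -
  have "(X *\<^sub>v w) \<bullet>c v = (\<Sum>i<m. \<Sum>j<n. X $$ (i, j) * w $ j * cnj (v $ i))"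
    using assms by (auto simp: scalar_prod_def atLeast0LessThan sum_distrib_right intro!: sum.cong)
  also have "\<dots> = (\<Sum>j<n. w $ j * (\<Sum>i<m. X $$ (i, j) * cnj (v $ i)))"
    by (subst sum.swap) (simp add: sum_distrib_left mult_ac)
  also have "\<dots> = w \<bullet>c (dag X *\<^sub>v v)"
    using assms by (auto simp: scalar_prod_def atLeast0LessThan intro!: sum.cong)
  finally show ?thesis .
qed

lemma psd_carrier: "positive_semidefinite n M \<Longrightarrow> M \<in> carrier_mat n n"
  by (simp add: positive_semidefinite_def)

lemma psd_congruence:
  assumes M: "positive_semidefinite n M" and X: "X \<in> carrier_mat m n"
  shows "positive_semidefinite m (X * M * dag X)"
  unfolding positive_semidefinite_def
proof (intro conjI ballI)
  note C = psd_carrier[OF M]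
  show "X * M * dag X \<in> carrier_mat m m" using X C by auto
  fix v :: "complex vec" assume v: "v \<in> carrier_vec m"
  have dv: "dag X *\<^sub>v v \<in> carrier_vec n" by (rule mult_mat_vec_carrier[OF dag_carrier[OF X] v])
  have "(X * M * dag X) *\<^sub>v v = X *\<^sub>v (M *\<^sub>v (dag X *\<^sub>v v))"
    using X C v dv by (simp add: assoc_mult_mat_vec[of _ m n _ n] assoc_mult_mat_vec[of _ m n _ m])
  also have "\<dots> \<bullet>c v = (M *\<^sub>v (dag X *\<^sub>v v)) \<bullet>c (dag X *\<^sub>v v)"
    by (rule adjoint_inner[OF X]) (use C dv v in auto)
  finally show "0 \<le> ((X * M * dag X) *\<^sub>v v) \<bullet>c v"
    using M dv by (simp add: positive_semidefinite_def)
qed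

lemma psd_one: "positive_semidefinite n (1\<^sub>m n)"
  by (auto simp: positive_semidefinite_def conjugate_square_positive)

lemma psd_mult_dag: "X \<in> carrier_mat m n \<Longrightarrow> positive_semidefinite m (X * dag X)"
  using psd_congruence[OF psd_one, of X m n] by simp

lemma psd_diagonal:
  assumes M: "positive_semidefinite n M" and i: "i < n"
  shows "0 \<le> M $$ (i, i)"
proof -
  have *: "(M *\<^sub>v unit_vec n i) $ a = M $$ (a, i)" if "a < n" for a
    using psd_carrier[OF M] i that by (simp add: scalar_prod_def atLeast0LessThan unit_vec_def if_distrib cong: if_cong)
  have "(M *\<^sub>v unit_vec n i) \<bullet>c unit_vec n i = (\<Sum>a<n. (M *\<^sub>v unit_vec n i) $ a * cnj (unit_vec n i $ a))"
    using psd_carrier[OF M] by (simp add: scalar_prod_def atLeast0LessThan)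
  also have "\<dots> = (\<Sum>a<n. if a = i then M $$ (a, i) else 0)"
    by (rule sum.cong) (use i in \<open>auto simp: * simp del: index_mult_mat_vec\<close>)
  finally have "(M *\<^sub>v unit_vec n i) \<bullet>c unit_vec n i = M $$ (i, i)" using i by simp
  then show ?thesis using M unit_vec_carrier[of n i] by (metis positive_semidefinite_def)
qed

lemma psd_trace_nonneg: "positive_semidefinite n M \<Longrightarrow> 0 \<le> mat_trace M"
  using psd_carrier[of n M] by (auto simp: mat_trace_def psd_diagonal intro!: sum_nonneg)

text \<open>Polarization with the test vectors e_i + c e_j, on which the form is real: c = 1 shows
  that the imaginary parts of the entries (i, j) and (j, i) are opposite, c = i that their real
  parts agree.\<close>

lemma psd_hermitian:
  assumes M: "positive_semidefinite n M"
  shows "dag M = M"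
proof (rule eq_matI)
  note C = psd_carrier[OF M]
  fix i j assume "i < dim_row M" "j < dim_col M"
  then have ij: "i < n" "j < n" using C by auto
  have q: "Im (M $$ (i, i) + c * M $$ (i, j) + cnj c * (M $$ (j, i) + c * M $$ (j, j))) = 0" for c
  proof -
    define v where "v = vec n (\<lambda>k. (if k = i then 1 else 0) + (if k = j then c else 0))"
    have v: "v \<in> carrier_vec n" by (simp add: v_def)
    have Mv: "(M *\<^sub>v v) $ a = M $$ (a, i) + c * M $$ (a, j)" if "a < n" for a
    proof -
      have "(M *\<^sub>v v) $ a = (\<Sum>b<n. M $$ (a, b) * v $ b)"
        using C v that by (simp add: scalar_prod_def atLeast0LessThan)
      also have "\<dots> = (\<Sum>b<n. (if b = i then M $$ (a, b) else 0) + (if b = j then c * M $$ (a, b) else 0))"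
        by (rule sum.cong) (auto simp: v_def algebra_simps)
      finally show ?thesis using ij by (simp add: sum.distrib)
    qed
    have "(M *\<^sub>v v) \<bullet>c v = (\<Sum>a<n. (M *\<^sub>v v) $ a * cnj (v $ a))"
      using C v by (simp add: scalar_prod_def atLeast0LessThan)
    also have "\<dots> = (\<Sum>a<n. (if a = i then (M *\<^sub>v v) $ a else 0) + (if a = j then cnj c * (M *\<^sub>v v) $ a else 0))"
      by (rule sum.cong) (auto simp: v_def algebra_simps)
    also have "\<dots> = M $$ (i, i) + c * M $$ (i, j) + cnj c * (M $$ (j, i) + c * M $$ (j, j))"
      using ij by (simp add: sum.distrib Mv)
    finally have "(M *\<^sub>v v) \<bullet>c v = M $$ (i, i) + c * M $$ (i, j) + cnj c * (M $$ (j, i) + c * M $$ (j, j))" .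
    moreover have "Im ((M *\<^sub>v v) \<bullet>c v) = 0"
      using M v by (auto simp: positive_semidefinite_def less_eq_complex_def)
    ultimately show ?thesis by (simp only:)
  qed
  have d: "Im (M $$ (i, i)) = 0" "Im (M $$ (j, j)) = 0"
    using psd_diagonal[OF M] ij by (simp_all add: less_eq_complex_def)
  show "dag M $$ (i, j) = M $$ (i, j)"
    using q[of 1] q[of \<i>] d ij C by (simp add: complex_eq_iff)
qed (use psd_carrier[OF M] in auto)

lemma psd_spectral:
  assumes M: "positive_semidefinite n M"
  obtains U l where "spectral n M U l" "\<And>i. 0 \<le> l i"
proof -
  obtain U m where U: "spectral n M U m"
    using spectral_theorem[OF psd_carrier[OF M] psd_hermitian[OF M]] by blast
  note S = spectralD[OF U]
  \<comment> \<open>\<open>spectral\<close> does not constrain the indices from n on; setting them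
    to 0 makes nonnegativity hold without a side condition.\<close>
  define l where "l = (\<lambda>i. if i < n then m i else 0)"
  have "spectral n M U l"
    using U mat_diag_cong[of n "\<lambda>i. complex_of_real (l i)" "\<lambda>i. complex_of_real (m i)"]
    by (simp add: spectral_def l_def)
  moreover have "0 \<le> m i" if i: "i < n" for i
  proof -
    have "positive_semidefinite n (dag U * M * dag (dag U))"
      by (rule psd_congruence[OF M]) (use S in auto)
    moreover have "dag U * M * dag (dag U) = mat_diag n (\<lambda>i. of_real (m i))"
      by (subst S(4)) (simp add: S(1-3) square_assoc[of _ n] mult_cancel_inverse[of _ n])
    ultimately show ?thesis using psd_diagonal[of n "mat_diag n (\<lambda>i. of_real (m i))" i] i
      by (simp add: mat_diag_index less_eq_complex_def)
  qed
  ultimately show thesis using that[of U l] by (simp add: l_def)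
qed

lemma spectral_nonneg_factor:
  assumes S: "spectral n M U l" and l: "\<And>i. 0 \<le> l i"
  defines "Y \<equiv> U * mat_diag n (\<lambda>i. complex_of_real (sqrt (l i)))"
  shows "Y \<in> carrier_mat n n" "M = Y * dag Y"
proof -
  note U = spectralD[OF S]
  show "Y \<in> carrier_mat n n" using U by (simp add: Y_def)
  show "M = Y * dag Y"
    by (subst U(4)) (simp add: U(1) l Y_def dag_mult[of _ n n _ n] square_assoc[of _ n] mat_diag_mult_assoc flip: of_real_mult)
qed

lemma psd_factor:
  assumes "positive_semidefinite n M"
  obtains Y where "Y \<in> carrier_mat n n" "M = Y * dag Y"
  using psd_spectral[OF assms] spectral_nonneg_factor by metis

lemma spectral_psd: "spectral n M U l \<Longrightarrow> (\<And>i. 0 \<le> l i) \<Longrightarrow> positive_semidefinite n M"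
  using spectral_nonneg_factor[of n M U l] psd_mult_dag by metis

lemma psd_trace_mult_nonneg:
  assumes A: "positive_semidefinite n A" and B: "positive_semidefinite n B"
  shows "0 \<le> mat_trace (A * B)"
proof -
  obtain Y where Y: "Y \<in> carrier_mat n n" "B = Y * dag Y" using psd_factor[OF B] .
  note C = psd_carrier[OF A]
  have "mat_trace (A * B) = mat_trace ((A * Y) * dag Y)" using Y C by (simp add: square_assoc[of _ n])
  also have "\<dots> = mat_trace (dag Y * A * dag (dag Y))"
    using Y C by (subst trace_comm[of _ n n]) (auto simp: square_assoc[of _ n])
  finally show ?thesis using psd_trace_nonneg[OF psd_congruence[OF A, of "dag Y" n]] Y by simp
qed

lemma trace_dag_mult:
  assumes "X \<in> carrier_mat n m"
  shows "mat_trace (dag X * X) = complex_of_real (\<Sum>i<m. \<Sum>j<n. (cmod (X $$ (j, i)))\<^sup>2)"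
  using assms by (subst trace_mult[of _ m n]) (auto simp: complex_norm_square mult.commute simp del: of_real_power intro!: sum.cong)

lemma trace_cauchy_schwarz:
  assumes "X \<in> carrier_mat n m" "Z \<in> carrier_mat n m"
  shows "(cmod (mat_trace (dag X * Z)))\<^sup>2 \<le> Re (mat_trace (dag X * X)) * Re (mat_trace (dag Z * Z))"
proof -
  let ?I = "{..<m} \<times> {..<n}"
  have "cmod (mat_trace (dag X * Z)) = cmod (\<Sum>(i, j)\<in>?I. cnj (X $$ (j, i)) * Z $$ (j, i))"
    using assms by (subst trace_mult[of _ m n]) (auto simp: sum.cartesian_product intro!: arg_cong[where f = cmod] sum.cong)
  also have "\<dots> \<le> (\<Sum>(i, j)\<in>?I. cmod (X $$ (j, i)) * cmod (Z $$ (j, i)))"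
    by (rule order_trans[OF norm_sum]) (auto simp: norm_mult intro!: sum_mono)
  finally have "(cmod (mat_trace (dag X * Z)))\<^sup>2 \<le> (\<Sum>p\<in>?I. cmod (X $$ (snd p, fst p)) * cmod (Z $$ (snd p, fst p)))\<^sup>2"
    by (intro power_mono) (auto simp: case_prod_unfold)
  also have "\<dots> \<le> (\<Sum>p\<in>?I. (cmod (X $$ (snd p, fst p)))\<^sup>2) * (\<Sum>p\<in>?I. (cmod (Z $$ (snd p, fst p)))\<^sup>2)"
    by (rule Cauchy_Schwarz_ineq_sum)
  also have "\<dots> = Re (mat_trace (dag X * X)) * Re (mat_trace (dag Z * Z))"
    by (simp add: trace_dag_mult[OF assms(1)] trace_dag_mult[OF assms(2)] sum.cartesian_product case_prod_unfold)
  finally show ?thesis .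
qed

text \<open>With \<open>A = Y * dag Y\<close> the trace is the squared Hilbert-Schmidt norm of
  \<open>dag Y * E\<close>, so already \<open>dag Y * E\<close> vanishes.\<close>

lemma psd_kernel:
  assumes A: "positive_semidefinite n A" and E: "E \<in> carrier_mat n m"
    and 0: "mat_trace (dag E * (A * E)) = 0"
  shows "A * E = 0\<^sub>m n m"
proof -
  obtain Y where Y: "Y \<in> carrier_mat n n" "A = Y * dag Y" using psd_factor[OF A] .
  have YE: "dag Y * E \<in> carrier_mat n m" using Y E by auto
  have A': "A * E = Y * (dag Y * E)" using Y E by (simp add: assoc_mult_mat[of _ n n _ n _ m])
  have "dag E * (A * E) = dag (dag Y * E) * (dag Y * E)"
    unfolding A' dag_mult[OF dag_carrier[OF Y(1)] E] dag_dag
    by (rule assoc_mult_mat[symmetric]) (use Y E YE in auto)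
  then have "(\<Sum>i<m. \<Sum>j<n. (cmod ((dag Y * E) $$ (j, i)))\<^sup>2) = 0"
    using 0 trace_dag_mult[OF YE] by (metis of_real_eq_0_iff)
  then have "(dag Y * E) $$ (j, i) = 0" if "i < m" "j < n" for i j
    using that by (subst (asm) sum_nonneg_eq_0_iff) (auto simp: sum_nonneg sum_nonneg_eq_0_iff)
  then have "dag Y * E = 0\<^sub>m n m" using YE by (intro eq_matI) auto
  then show ?thesis using Y A' by simp
qed

context
  fixes n M
  assumes M: "positive_semidefinite n M"
begin

lemma mat_fun_carrier [simp]: "mat_fun f M \<in> carrier_mat n n"
  by (rule psd_spectral[OF M]) (auto simp: mat_fun_spectral spectralD(1))

lemma mat_fun_mult: "mat_fun f M * mat_fun g M = mat_fun (\<lambda>x. f x * g x) M"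
proof (rule psd_spectral[OF M])
  fix U l assume S: "spectral n M U l"
  note U = spectralD(1-3)[OF S]
  show ?thesis
    using U by (simp add: mat_fun_spectral[OF S] square_assoc[of _ n] mult_cancel_inverse[of _ n] mat_diag_mult_assoc)
qed

lemma mat_fun_cong:
  assumes "\<And>x. 0 \<le> x \<Longrightarrow> f x = g x"
  shows "mat_fun f M = mat_fun g M"
  by (rule psd_spectral[OF M]) (simp add: mat_fun_spectral assms)

lemma mat_fun_dag: "dag (mat_fun f M) = mat_fun (\<lambda>x. cnj (f x)) M"
proof (rule psd_spectral[OF M])
  fix U l assume S: "spectral n M U l"
  note U = spectralD(1-3)[OF S]
  show ?thesis
    using U by (simp add: mat_fun_spectral[OF S] dag_mult[of _ n n _ n] square_assoc[of _ n])
qed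

lemma mat_fun_of_real: "mat_fun complex_of_real M = M"
  by (rule psd_spectral[OF M]) (metis mat_fun_spectral spectralD(4))

lemma mat_fun_one: "mat_fun (\<lambda>x. 1) M = 1\<^sub>m n"
proof (rule psd_spectral[OF M])
  fix U l assume S: "spectral n M U l"
  show ?thesis using spectralD(1-3)[OF S] by (simp add: mat_fun_spectral[OF S])
qed

lemma trace_mat_fun_mono:
  assumes P: "positive_semidefinite n P" and fg: "\<And>x. 0 \<le> x \<Longrightarrow> f x \<le> g x"
  shows "Re (mat_trace (P * mat_fun (\<lambda>x. complex_of_real (f x)) M)) \<le> Re (mat_trace (P * mat_fun (\<lambda>x. complex_of_real (g x)) M))"
proof (rule psd_spectral[OF M])
  fix U l assume S: "spectral n M U l" and l: "\<And>i. 0 \<le> l i"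
  have "0 \<le> (dag U * P * dag (dag U)) $$ (i, i)" if "i < n" for i
    by (rule psd_diagonal[OF psd_congruence[OF P] that]) (use spectralD(1)[OF S] in auto)
  then show ?thesis
    unfolding trace_mat_fun_spectral[OF S psd_carrier[OF P]] Re_sum using l fg
    by (intro sum_mono) (auto simp: less_eq_complex_def intro!: mult_left_mono)
qed

end

section \<open>Complex powers on the support\<close>

lemma of_real_powr_eq: "0 < x \<Longrightarrow> complex_of_real x powr z = exp (of_real (ln x) * z)"
  by (simp add: powr_def Ln_of_real mult.commute)

context
  fixes n M
  assumes M: "positive_semidefinite n M"
begin

lemma cpow_carrier [simp]: "mat_cpow M z \<in> carrier_mat n n"
  unfolding mat_cpow_def by (rule mat_fun_carrier[OF M])

text \<open>All powers vanish off the support, so the law holds for all exponents, negative ones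
  included. The unit of the resulting group is \<open>mat_cpow M 0\<close>, the support
  projection.\<close>

lemma cpow_mult: "mat_cpow M z * mat_cpow M w = mat_cpow M (z + w)"
  unfolding mat_cpow_def mat_fun_mult[OF M] by (rule arg_cong[where f = "\<lambda>f. mat_fun f M"]) (auto simp: powr_add)

lemma cpow_dag: "dag (mat_cpow M z) = mat_cpow M (cnj z)"
  unfolding mat_cpow_def mat_fun_dag[OF M] 
  by (rule mat_fun_cong[OF M]) (auto simp: of_real_powr_eq exp_cnj less_le)

lemma cpow_one: "mat_cpow M 1 = M"
  unfolding mat_cpow_def using mat_fun_cong[OF M, of _ complex_of_real] mat_fun_of_real[OF M] by simp

lemma log_carrier [simp]: "mat_log M \<in> carrier_mat n n"
  unfolding mat_log_def by (rule mat_fun_carrier[OF M])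

end

subsection \<open>Tensor products\<close>

lemma mult_add_less:
  assumes "i < a" "k < (b :: nat)"
  shows "i * b + k < a * b"
proof -
  have "i * b + k < Suc i * b" using assms by simp
  also have "\<dots> \<le> a * b" using assms by (intro mult_right_mono) auto
  finally show ?thesis .
qed

lemma mult_add_div_mod:
  assumes "r < (m :: nat)"
  shows "(q * m + r) div m = q" "(q * m + r) mod m = r"
  using assms by simp_all

lemma sum_div_mod:
  fixes f :: "nat \<Rightarrow> nat \<Rightarrow> 'a :: comm_monoid_add"
  shows "(\<Sum>k<a * b. f (k div b) (k mod b)) = (\<Sum>i<a. \<Sum>j<b. f i j)"
proof (cases "b = 0")
  case False
  have "(\<Sum>k<a * b. f (k div b) (k mod b)) = (\<Sum>(i, j)\<in>{..<a} \<times> {..<b}. f i j)"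
    by (rule sum.reindex_bij_witness[of _ "\<lambda>(i, j). i * b + j" "\<lambda>k. (k div b, k mod b)"])
      (use False in \<open>auto simp: less_mult_imp_div_less intro: mult_add_less\<close>)
  then show ?thesis by (simp add: sum.cartesian_product)
qed simp

lemma div_mod_less:
  assumes "i < a * (b :: nat)"
  shows "i div b < a" "i mod b < b" "0 < b"
  using assms by (auto simp: less_mult_imp_div_less) (metis mult_0_right not_gr_zero not_less_zero mod_less_divisor)+

lemma kron_dims [simp]: "dim_row (kron X Y) = dim_row X * dim_row Y" "dim_col (kron X Y) = dim_col X * dim_col Y"
  by (auto simp: kron_def)

lemma kron_carrier [simp, intro]:
  "X \<in> carrier_mat a b \<Longrightarrow> Y \<in> carrier_mat c d \<Longrightarrow> kron X Y \<in> carrier_mat (a * c) (b * d)"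
  by (intro carrier_matI) auto

lemma kron_index:
  assumes "X \<in> carrier_mat a b" "Y \<in> carrier_mat c d" "i < a * c" "j < b * d"
  shows "kron X Y $$ (i, j) = X $$ (i div c, j div d) * Y $$ (i mod c, j mod d)"
  using assms by (auto simp: kron_def)

lemma kron_mult:
  assumes "A \<in> carrier_mat a b" "C \<in> carrier_mat b c" "B \<in> carrier_mat a' b'" "D \<in> carrier_mat b' c'"
  shows "kron A B * kron C D = kron (A * C) (B * D)"
proof (rule eq_matI)
  fix i j assume "i < dim_row (kron (A * C) (B * D))" "j < dim_col (kron (A * C) (B * D))"
  then have ij: "i < a * a'" "j < c * c'" using assms by auto
  note I = div_mod_less[OF ij(1)] and J = div_mod_less[OF ij(2)]
  have "(kron A B * kron C D) $$ (i, j) = (\<Sum>k<b * b'. kron A B $$ (i, k) * kron C D $$ (k, j))"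
    by (rule times_mat_index) (use assms ij in auto)
  also have "\<dots> = (\<Sum>k<b * b'. (A $$ (i div a', k div b') * B $$ (i mod a', k mod b')) * (C $$ (k div b', j div c') * D $$ (k mod b', j mod c')))"
    using assms ij by (intro sum.cong refl) (simp add: kron_index[of A a b B a' b'] kron_index[of C b c D b' c'])
  also have "\<dots> = (\<Sum>k<b. \<Sum>l<b'. (A $$ (i div a', k) * B $$ (i mod a', l)) * (C $$ (k, j div c') * D $$ (l, j mod c')))"
    by (rule sum_div_mod)
  also have "\<dots> = (\<Sum>k<b. A $$ (i div a', k) * C $$ (k, j div c')) * (\<Sum>l<b'. B $$ (i mod a', l) * D $$ (l, j mod c'))"
    by (simp add: sum_product mult_ac)
  also have "\<dots> = kron (A * C) (B * D) $$ (i, j)"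
    using assms ij I J by (subst kron_index[of _ a c _ a' c'])
      (auto simp: times_mat_index[OF assms(1,2)] times_mat_index[OF assms(3,4)])
  finally show "(kron A B * kron C D) $$ (i, j) = kron (A * C) (B * D) $$ (i, j)" .
qed (use assms in auto)

lemma kron_one: "kron (1\<^sub>m a) (1\<^sub>m b) = 1\<^sub>m (a * b)"
proof (rule eq_matI)
  fix i j assume "i < dim_row (1\<^sub>m (a * b) :: complex mat)" "j < dim_col (1\<^sub>m (a * b) :: complex mat)"
  then have ij: "i < a * b" "j < a * b" by auto
  note I = div_mod_less[OF ij(1)] and J = div_mod_less[OF ij(2)]
  have "i = j \<longleftrightarrow> i div b = j div b \<and> i mod b = j mod b" by (metis div_mult_mod_eq)
  then show "kron (1\<^sub>m a) (1\<^sub>m b) $$ (i, j) = 1\<^sub>m (a * b) $$ (i, j)"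
    using ij I J by (subst kron_index[of _ a a _ b b]) auto
qed auto

lemma kron_mat_diag: "kron (mat_diag a f) (mat_diag b g) = mat_diag (a * b) (\<lambda>i. f (i div b) * g (i mod b))"
proof (rule eq_matI)
  fix i j assume "i < dim_row (mat_diag (a * b) (\<lambda>i. f (i div b) * g (i mod b)))" "j < dim_col (mat_diag (a * b) (\<lambda>i. f (i div b) * g (i mod b)))"
  then have ij: "i < a * b" "j < a * b" by auto
  note I = div_mod_less[OF ij(1)] and J = div_mod_less[OF ij(2)]
  have "i = j \<longleftrightarrow> i div b = j div b \<and> i mod b = j mod b" by (metis div_mult_mod_eq)
  then show "kron (mat_diag a f) (mat_diag b g) $$ (i, j) = mat_diag (a * b) (\<lambda>i. f (i div b) * g (i mod b)) $$ (i, j)"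
    using ij I J by (subst kron_index[of _ a a _ b b]) (auto simp: mat_diag_index)
qed auto

lemma kron_dag: "dag (kron A B) = kron (dag A) (dag B)"
proof (rule eq_matI)
  fix i j assume "i < dim_row (kron (dag A) (dag B))" "j < dim_col (kron (dag A) (dag B))"
  then have ij: "i < dim_col A * dim_col B" "j < dim_row A * dim_row B" by auto
  then show "dag (kron A B) $$ (i, j) = kron (dag A) (dag B) $$ (i, j)"
    using div_mod_less[OF ij(1)] div_mod_less[OF ij(2)] by (auto simp: kron_def)
qed auto

lemma kron_trace:
  assumes "A \<in> carrier_mat a a" "B \<in> carrier_mat b b"
  shows "mat_trace (kron A B) = mat_trace A * mat_trace B"
proof -
  have "mat_trace (kron A B) = (\<Sum>i<a * b. A $$ (i div b, i div b) * B $$ (i mod b, i mod b))"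
    using assms by (auto simp: mat_trace_def kron_index[OF assms] intro!: sum.cong)
  also have "\<dots> = (\<Sum>i<a. \<Sum>j<b. A $$ (i, i) * B $$ (j, j))"
    by (rule sum_div_mod)
  finally show ?thesis using assms by (auto simp: mat_trace_def sum_product)
qed

lemma spectral_kron:
  assumes A: "spectral a A U l" and B: "spectral b B V m"
  shows "spectral (a * b) (kron A B) (kron U V) (\<lambda>i. l (i div b) * m (i mod b))"
proof -
  note U = spectralD[OF A] and V = spectralD[OF B]
  show ?thesis
    unfolding spectral_def
  proof (intro conjI)
    show "kron U V \<in> carrier_mat (a * b) (a * b)" using U V by auto
    show "kron U V * dag (kron U V) = 1\<^sub>m (a * b)"
      using U V by (simp add: kron_dag kron_mult[of _ a a _ a _ b b _ b] kron_one)
    have "kron U V * kron (mat_diag a (\<lambda>i. of_real (l i))) (mat_diag b (\<lambda>i. of_real (m i))) * kron (dag U) (dag V) = kron A B"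
      using U(1) V(1) by (simp add: kron_mult[of _ a a _ a _ b b _ b] flip: U(4) V(4))
    then show "kron A B = kron U V * mat_diag (a * b) (\<lambda>i. complex_of_real (l (i div b) * m (i mod b))) * dag (kron U V)"
      by (simp add: kron_mat_diag kron_dag)
  qed
qed

lemma psd_kron:
  assumes "positive_semidefinite a A" "positive_semidefinite b B"
  shows "positive_semidefinite (a * b) (kron A B)"
proof -
  obtain U l where A: "spectral a A U l" "\<And>i. 0 \<le> l i" using psd_spectral[OF assms(1)] by blast
  obtain V m where B: "spectral b B V m" "\<And>i. 0 \<le> m i" using psd_spectral[OF assms(2)] by blast
  show ?thesis by (rule spectral_psd[OF spectral_kron[OF A(1) B(1)]]) (simp add: A B)
qed

lemma cpow_kron:
  assumes "positive_semidefinite a A" "positive_semidefinite b B"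
  shows "mat_cpow (kron A B) z = kron (mat_cpow A z) (mat_cpow B z)"
proof -
  obtain U l where A: "spectral a A U l" "\<And>i. 0 \<le> l i" using psd_spectral[OF assms(1)] by blast
  obtain V m where B: "spectral b B V m" "\<And>i. 0 \<le> m i" using psd_spectral[OF assms(2)] by blast
  note U = spectralD[OF A(1)] and V = spectralD[OF B(1)]
  have m: "(if x * y = 0 then 0 else complex_of_real (x * y) powr z)
     = (if x = 0 then 0 else complex_of_real x powr z) * (if y = 0 then 0 else complex_of_real y powr z)"
    if "0 \<le> x" "0 \<le> y" for x y
  proof (cases "x = 0 \<or> y = 0")
    case False
    then have "0 < x" "0 < y" "0 < x * y" using that by auto
    then show ?thesis by (simp add: of_real_powr_eq ln_mult algebra_simps exp_add del: of_real_mult)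
  qed auto
  have gen: "kron (U * mat_diag a f * dag U) (V * mat_diag b g * dag V)
      = kron U V * mat_diag (a * b) (\<lambda>i. f (i div b) * g (i mod b)) * dag (kron U V)" for f g
    using U(1) V(1) by (simp add: kron_dag kron_mult[of _ a a _ a _ b b _ b] flip: kron_mat_diag[of a f b g])
  show ?thesis
    unfolding mat_cpow_def mat_fun_spectral[OF spectral_kron[OF A(1) B(1)]] mat_fun_spectral[OF A(1)] mat_fun_spectral[OF B(1)]
    by (simp only: m A(2) B(2) gen[where f = "\<lambda>i. if l i = 0 then 0 else complex_of_real (l i) powr z"
        and g = "\<lambda>i. if m i = 0 then 0 else complex_of_real (m i) powr z"])
qed

lemma spectral_one: "spectral n (1\<^sub>m n) (1\<^sub>m n) (\<lambda>_. 1)"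
  by (simp add: spectral_def)

lemma cpow_of_one: "mat_cpow (1\<^sub>m n) z = 1\<^sub>m n"
  unfolding mat_cpow_def mat_fun_spectral[OF spectral_one] by simp

lemma tensor_power_carrier [simp, intro]: "X \<in> carrier_mat a b \<Longrightarrow> tensor_power X n \<in> carrier_mat (a ^ n) (b ^ n)"
proof (induction n)
  case (Suc n)
  then show ?case using kron_carrier[of "tensor_power X n" "a ^ n" "b ^ n" X a b] by (simp add: mult.commute)
qed simp

lemma tensor_power_mult:
  assumes "X \<in> carrier_mat a b" "Y \<in> carrier_mat b c"
  shows "tensor_power X n * tensor_power Y n = tensor_power (X * Y) n"
proof (induction n)
  case (Suc n)
  then show ?case
    using kron_mult[OF tensor_power_carrier[OF assms(1), of n] tensor_power_carrier[OF assms(2), of n] assms] by simp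
qed simp

lemma tensor_power_trace:
  assumes "X \<in> carrier_mat a a"
  shows "mat_trace (tensor_power X n) = mat_trace X ^ n"
proof (induction n)
  case (Suc n)
  then show ?case
    using kron_trace[OF tensor_power_carrier[OF assms] assms, of n] by (simp add: mult.commute)
qed simp

lemma psd_tensor_power: "positive_semidefinite a A \<Longrightarrow> positive_semidefinite (a ^ n) (tensor_power A n)"
  by (induction n) (use psd_kron[of "a ^ n" _ a A for n] psd_one[of 1] in \<open>auto simp: mult.commute\<close>)

lemma cpow_tensor_power: "positive_semidefinite a A \<Longrightarrow> mat_cpow (tensor_power A n) z = tensor_power (mat_cpow A z) n"
  by (induction n) (simp_all add: cpow_of_one cpow_kron[OF psd_tensor_power])

subsection \<open>Partial trace\<close>

lemma partial_trace_carrier [simp, intro]: "partial_trace a b M \<in> carrier_mat a a"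
  by (simp add: partial_trace_def)

lemma partial_trace_dims [simp]: "dim_row (partial_trace a b M) = a" "dim_col (partial_trace a b M) = a"
  by (simp_all add: partial_trace_def)

text \<open>The dual description of the partial trace, through which marginals are mostly handled: X
  = 1 gives the total trace, and X of rank one gives positivity.\<close>

lemma trace_kron_one:
  assumes M: "M \<in> carrier_mat (a * b) (a * b)" and X: "X \<in> carrier_mat a a"
  shows "mat_trace (M * kron X (1\<^sub>m b)) = mat_trace (partial_trace a b M * X)"
proof -
  have "mat_trace (M * kron X (1\<^sub>m b)) = (\<Sum>p<a * b. \<Sum>q<a * b. M $$ (p, q) * kron X (1\<^sub>m b) $$ (q, p))"
    by (rule trace_mult[OF M]) (use X in auto)
  also have "\<dots> = (\<Sum>p<a * b. \<Sum>q<a * b. M $$ (p div b * b + p mod b, q div b * b + q mod b) * (X $$ (q div b, p div b) * (if q mod b = p mod b then 1 else 0)))"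
    by (intro sum.cong refl) (use div_mod_less in \<open>auto simp: kron_index[OF X one_carrier_mat]\<close>)
  also have "\<dots> = (\<Sum>i<a. \<Sum>k<b. \<Sum>j<a. \<Sum>l<b. M $$ (i * b + k, j * b + l) * (X $$ (j, i) * (if l = k then 1 else 0)))"
    by (subst sum_div_mod[symmetric], rule sum.cong[OF refl], subst sum_div_mod[symmetric], rule refl)
  also have "\<dots> = (\<Sum>i<a. \<Sum>k<b. \<Sum>j<a. M $$ (i * b + k, j * b + k) * X $$ (j, i))"
    by (intro sum.cong refl) (auto simp: if_distrib cong: if_cong)
  also have "\<dots> = (\<Sum>i<a. \<Sum>j<a. (\<Sum>k<b. M $$ (i * b + k, j * b + k)) * X $$ (j, i))"
    by (rule sum.cong[OF refl], subst sum.swap) (simp add: sum_distrib_right)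
  also have "\<dots> = mat_trace (partial_trace a b M * X)"
    by (subst trace_mult[OF partial_trace_carrier X]) (simp add: partial_trace_def)
  finally show ?thesis .
qed

lemma trace_partial_trace:
  assumes "M \<in> carrier_mat (a * b) (a * b)"
  shows "mat_trace (partial_trace a b M) = mat_trace M"
  using trace_kron_one[OF assms one_carrier_mat] assms by (simp add: kron_one)

lemma psd_partial_trace:
  assumes M: "positive_semidefinite (a * b) M"
  shows "positive_semidefinite a (partial_trace a b M)"
  unfolding positive_semidefinite_def
proof (intro conjI ballI)
  fix v :: "complex vec" assume v: "v \<in> carrier_vec a"
  define V where "V = mat a 1 (\<lambda>(i, j). v $ i)"
  have V: "V \<in> carrier_mat a 1" by (simp add: V_def)
  let ?T = "partial_trace a b M"
  have "(?T *\<^sub>v v) \<bullet>c v = (\<Sum>i<a. \<Sum>j<a. ?T $$ (i, j) * (v $ j * cnj (v $ i)))"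
    using v by (auto simp: scalar_prod_def atLeast0LessThan sum_distrib_left mult_ac intro!: sum.cong)
  also have "\<dots> = mat_trace (?T * (V * dag V))"
  proof -
    have "(V * dag V) $$ (j, i) = v $ j * cnj (v $ i)" if "i < a" "j < a" for i j
      using that by (simp add: times_mat_index[OF V dag_carrier[OF V]]) (simp add: V_def)
    then show ?thesis
      by (subst trace_mult[OF partial_trace_carrier]) (use V in auto)
  qed
  also have "\<dots> = mat_trace (M * kron (V * dag V) (1\<^sub>m b))"
    by (rule trace_kron_one[symmetric]) (use V psd_carrier[OF M] in auto)
  also have "0 \<le> \<dots>"
    by (intro psd_trace_mult_nonneg[OF M] psd_kron psd_one psd_mult_dag[OF V])
  finally show "0 \<le> (?T *\<^sub>v v) \<bullet>c v" .
qed auto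

subsection \<open>Regrouping tensor factors\<close>

lemma interleave_less:
  assumes "i < a ^ n" "j < b ^ n"
  shows "interleave a b n i j < (a * b) ^ n"
  using assms
proof (induction n arbitrary: i j)
  case (Suc n)
  have i: "i < a ^ n * a" and j: "j < b ^ n * b" using Suc.prems by (simp_all add: mult.commute)
  have "interleave a b n (i div a) (j div b) < (a * b) ^ n"
    by (rule Suc.IH) (use div_mod_less[OF i] div_mod_less[OF j] in auto)
  moreover have "i mod a * b + j mod b < a * b"
    by (intro mult_add_less) (use div_mod_less[OF i] div_mod_less[OF j] in auto)
  ultimately have "interleave a b (Suc n) i j < (a * b) ^ n * (a * b)"
    unfolding interleave.simps by (rule mult_add_less)
  then show ?case by (simp add: mult_ac)
qed simp

lemma interleave_div_mod:
  assumes "i < a ^ Suc n" "j < b ^ Suc n"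
  shows "interleave a b (Suc n) i j div (a * b) = interleave a b n (i div a) (j div b)"
    "interleave a b (Suc n) i j mod (a * b) = i mod a * b + j mod b"
proof -
  have i: "i < a ^ n * a" and j: "j < b ^ n * b" using assms by (simp_all add: mult.commute)
  have "i mod a * b + j mod b < a * b"
    by (intro mult_add_less) (use div_mod_less[OF i] div_mod_less[OF j] in auto)
  then show "interleave a b (Suc n) i j div (a * b) = interleave a b n (i div a) (j div b)"
    "interleave a b (Suc n) i j mod (a * b) = i mod a * b + j mod b"
    unfolding interleave.simps by (simp_all only: mult_add_div_mod)
qed

lemma interleave_inj:
  assumes "i < a ^ n" "j < b ^ n" "i' < a ^ n" "j' < b ^ n" "interleave a b n i j = interleave a b n i' j'"
  shows "i = i' \<and> j = j'"
  using assms
proof (induction n arbitrary: i j i' j')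
  case (Suc n)
  have i: "i < a ^ n * a" "i' < a ^ n * a" and j: "j < b ^ n * b" "j' < b ^ n * b" using Suc.prems by (simp_all add: mult.commute)
  note I = div_mod_less[OF i(1)] div_mod_less[OF i(2)] and J = div_mod_less[OF j(1)] div_mod_less[OF j(2)]
  note D = interleave_div_mod[OF Suc.prems(1,2)] interleave_div_mod[OF Suc.prems(3,4)]
  have "interleave a b n (i div a) (j div b) = interleave a b n (i' div a) (j' div b)"
    using D Suc.prems(5) by metis
  then have d: "i div a = i' div a \<and> j div b = j' div b"
    by (intro Suc.IH) (use I J in auto)
  have m: "i mod a * b + j mod b = i' mod a * b + j' mod b"
    using D Suc.prems(5) by metis
  have "(i mod a * b + j mod b) div b = i mod a" "(i' mod a * b + j' mod b) div b = i' mod a"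
    "(i mod a * b + j mod b) mod b = j mod b" "(i' mod a * b + j' mod b) mod b = j' mod b"
    using J by simp_all
  with m have "i mod a = i' mod a" "j mod b = j' mod b" by metis+
  with d show ?case by (metis div_mult_mod_eq)
qed simp

text \<open>The basis permutation behind \<open>regroup\<close>. Regrouping is conjugation by a
  permutation matrix and therefore respects products, adjoints, traces, spectra and powers.\<close>

definition regroup_index :: "nat \<Rightarrow> nat \<Rightarrow> nat \<Rightarrow> nat \<Rightarrow> nat" where
  "regroup_index a b n x = interleave a b n (x div b ^ n) (x mod b ^ n)"

lemma regroup_index_bij: "bij_betw (regroup_index a b n) {..<a ^ n * b ^ n} {..<a ^ n * b ^ n}"
proof -
  have inj: "inj_on (regroup_index a b n) {..<a ^ n * b ^ n}"
  proof (rule inj_onI)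
    fix x y assume "x \<in> {..<a ^ n * b ^ n}" "y \<in> {..<a ^ n * b ^ n}" "regroup_index a b n x = regroup_index a b n y"
    then show "x = y"
      unfolding regroup_index_def by (metis interleave_inj div_mod_less(1,2) div_mult_mod_eq lessThan_iff)
  qed
  moreover have "regroup_index a b n ` {..<a ^ n * b ^ n} \<subseteq> {..<a ^ n * b ^ n}"
  proof
    fix y assume "y \<in> regroup_index a b n ` {..<a ^ n * b ^ n}"
    then obtain x where x: "x < a ^ n * b ^ n" "y = regroup_index a b n x" by auto
    then show "y \<in> {..<a ^ n * b ^ n}"
      using interleave_less[OF div_mod_less(1,2)[OF x(1)]] by (simp add: regroup_index_def power_mult_distrib)
  qed
  ultimately show ?thesis
    by (simp add: bij_betw_def endo_inj_surj)
qed

lemma regroup_index_less: "x < a ^ n * b ^ n \<Longrightarrow> regroup_index a b n x < a ^ n * b ^ n"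
  using regroup_index_bij[of a b n] by (auto simp: bij_betw_def)

lemma regroup_carrier [simp, intro]: "regroup a b n M \<in> carrier_mat (a ^ n * b ^ n) (a ^ n * b ^ n)"
  by (simp add: regroup_def)

lemma regroup_dims [simp]: "dim_row (regroup a b n M) = a ^ n * b ^ n" "dim_col (regroup a b n M) = a ^ n * b ^ n"
  by (simp_all add: regroup_def)

lemma regroup_entry: "x < a ^ n * b ^ n \<Longrightarrow> y < a ^ n * b ^ n \<Longrightarrow>
    regroup a b n M $$ (x, y) = M $$ (regroup_index a b n x, regroup_index a b n y)"
  by (simp add: regroup_def regroup_index_def)

lemma regroup_mult:
  assumes "M \<in> carrier_mat (a ^ n * b ^ n) (a ^ n * b ^ n)" "N \<in> carrier_mat (a ^ n * b ^ n) (a ^ n * b ^ n)"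
  shows "regroup a b n (M * N) = regroup a b n M * regroup a b n N"
proof (rule eq_matI)
  fix x y assume "x < dim_row (regroup a b n M * regroup a b n N)" "y < dim_col (regroup a b n M * regroup a b n N)"
  then have xy: "x < a ^ n * b ^ n" "y < a ^ n * b ^ n" by auto
  have "regroup a b n (M * N) $$ (x, y) = (\<Sum>k<a ^ n * b ^ n. M $$ (regroup_index a b n x, k) * N $$ (k, regroup_index a b n y))"
    using xy by (simp add: regroup_entry times_mat_index[OF assms] regroup_index_less)
  also have "\<dots> = (\<Sum>k<a ^ n * b ^ n. M $$ (regroup_index a b n x, regroup_index a b n k) * N $$ (regroup_index a b n k, regroup_index a b n y))"
    by (rule sum.reindex_bij_betw[OF regroup_index_bij, symmetric])
  also have "\<dots> = (regroup a b n M * regroup a b n N) $$ (x, y)"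
    using xy by (subst times_mat_index[OF regroup_carrier regroup_carrier]) (auto simp: regroup_entry)
  finally show "regroup a b n (M * N) $$ (x, y) = (regroup a b n M * regroup a b n N) $$ (x, y)" .
qed auto

lemma regroup_index_eq_iff:
  "x < a ^ n * b ^ n \<Longrightarrow> y < a ^ n * b ^ n \<Longrightarrow> regroup_index a b n x = regroup_index a b n y \<longleftrightarrow> x = y"
  using regroup_index_bij[of a b n] by (auto simp: bij_betw_def inj_on_def)

lemma regroup_mat_diag: "regroup a b n (mat_diag (a ^ n * b ^ n) f) = mat_diag (a ^ n * b ^ n) (\<lambda>x. f (regroup_index a b n x))"
  by (rule eq_matI) (auto simp: regroup_entry mat_diag_index regroup_index_less regroup_index_eq_iff)

lemma regroup_one: "regroup a b n (1\<^sub>m (a ^ n * b ^ n)) = 1\<^sub>m (a ^ n * b ^ n)"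
  by (rule eq_matI) (auto simp: regroup_entry regroup_index_less regroup_index_eq_iff)

lemma regroup_dag: "M \<in> carrier_mat (a ^ n * b ^ n) (a ^ n * b ^ n) \<Longrightarrow> dag (regroup a b n M) = regroup a b n (dag M)"
  by (rule eq_matI) (auto simp: regroup_entry regroup_index_less)

lemma regroup_trace:
  assumes "M \<in> carrier_mat (a ^ n * b ^ n) (a ^ n * b ^ n)"
  shows "mat_trace (regroup a b n M) = mat_trace M"
proof -
  have "mat_trace M = (\<Sum>k<a ^ n * b ^ n. M $$ (k, k))" using assms by (auto simp: mat_trace_def)
  also have "\<dots> = (\<Sum>k<a ^ n * b ^ n. M $$ (regroup_index a b n k, regroup_index a b n k))"
    by (rule sum.reindex_bij_betw[OF regroup_index_bij, symmetric])
  finally show ?thesis by (simp add: mat_trace_def regroup_entry)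
qed

lemma spectral_regroup:
  assumes M: "spectral (a ^ n * b ^ n) M U l"
  shows "spectral (a ^ n * b ^ n) (regroup a b n M) (regroup a b n U) (\<lambda>x. l (regroup_index a b n x))"
proof -
  note U = spectralD[OF M]
  show ?thesis
    unfolding spectral_def
  proof (intro conjI)
    show "regroup a b n U * dag (regroup a b n U) = 1\<^sub>m (a ^ n * b ^ n)"
      using U by (simp add: regroup_dag regroup_mult[symmetric] regroup_one)
    show "regroup a b n M = regroup a b n U * mat_diag (a ^ n * b ^ n) (\<lambda>i. complex_of_real (l (regroup_index a b n i))) * dag (regroup a b n U)"
      by (subst U(4)) (use U(1) in \<open>simp add: regroup_dag regroup_mult regroup_mat_diag\<close>)
  qed simp
qed

lemma psd_regroup:
  assumes "positive_semidefinite (a ^ n * b ^ n) M"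
  shows "positive_semidefinite (a ^ n * b ^ n) (regroup a b n M)"
  by (rule psd_spectral[OF assms]) (rule spectral_psd[OF spectral_regroup])

lemma cpow_regroup:
  assumes "positive_semidefinite (a ^ n * b ^ n) M"
  shows "mat_cpow (regroup a b n M) z = regroup a b n (mat_cpow M z)"
proof (rule psd_spectral[OF assms])
  fix U l assume M: "spectral (a ^ n * b ^ n) M U l"
  note U = spectralD[OF M]
  show ?thesis
    unfolding mat_cpow_def mat_fun_spectral[OF spectral_regroup[OF M]] mat_fun_spectral[OF M]
    using U(1) by (simp add: regroup_dag regroup_mult regroup_mat_diag)
qed

text \<open>Induction splitting off the last copy. The interleaved index of (i, k) has as quotient
  the interleaved index of the quotients and as remainder the pair of remainders, so the sum over k
  factors into a sum over the first n copies of B and one over the last copy.\<close>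

lemma partial_trace_regroup:
  assumes R: "\<rho> \<in> carrier_mat (a * b) (a * b)"
  shows "partial_trace (a ^ n) (b ^ n) (regroup a b n (tensor_power \<rho> n)) = tensor_power (partial_trace a b \<rho>) n"
proof (induction n)
  case 0
  show ?case by (rule eq_matI) (auto simp: partial_trace_def regroup_def)
next
  case (Suc n)
  let ?T = "tensor_power \<rho> n"
  have T: "?T \<in> carrier_mat ((a * b) ^ n) ((a * b) ^ n)" using R by auto
  show ?case
  proof (rule eq_matI)
    fix i j assume "i < dim_row (tensor_power (partial_trace a b \<rho>) (Suc n))" "j < dim_col (tensor_power (partial_trace a b \<rho>) (Suc n))"
    then have ij: "i < a ^ n * a" "j < a ^ n * a"
      using tensor_power_carrier[OF partial_trace_carrier, of a b \<rho> n] by auto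
    then have ij': "i < a ^ Suc n" "j < a ^ Suc n" by (simp_all add: mult.commute)
    note I = div_mod_less[OF ij(1)] and J = div_mod_less[OF ij(2)]
    have e: "regroup a b (Suc n) (tensor_power \<rho> (Suc n)) $$ (i * b ^ Suc n + k, j * b ^ Suc n + k)
      = ?T $$ (interleave a b n (i div a) (k div b), interleave a b n (j div a) (k div b))
        * \<rho> $$ (i mod a * b + k mod b, j mod a * b + k mod b)" if k: "k < b ^ Suc n" for k
    proof -
      have l: "i * b ^ Suc n + k < a ^ Suc n * b ^ Suc n" "j * b ^ Suc n + k < a ^ Suc n * b ^ Suc n"
        using ij' k by (auto intro!: mult_add_less simp del: power_Suc)
      have r: "regroup_index a b (Suc n) (i * b ^ Suc n + k) = interleave a b (Suc n) i k"
        "regroup_index a b (Suc n) (j * b ^ Suc n + k) = interleave a b (Suc n) j k"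
        unfolding regroup_index_def mult_add_div_mod[OF k] by (rule refl)+
      have il: "interleave a b (Suc n) i k < (a * b) ^ n * (a * b)" "interleave a b (Suc n) j k < (a * b) ^ n * (a * b)"
        using interleave_less[OF ij'(1) k] interleave_less[OF ij'(2) k] by (simp_all add: mult.commute del: interleave.simps)
      show ?thesis
        unfolding regroup_entry[OF l] r tensor_power.simps kron_index[OF T R il] interleave_div_mod[OF ij'(1) k] interleave_div_mod[OF ij'(2) k] ..
    qed
    have "partial_trace (a ^ Suc n) (b ^ Suc n) (regroup a b (Suc n) (tensor_power \<rho> (Suc n))) $$ (i, j)
      = (\<Sum>k<b ^ Suc n. regroup a b (Suc n) (tensor_power \<rho> (Suc n)) $$ (i * b ^ Suc n + k, j * b ^ Suc n + k))"
      using ij' by (simp add: partial_trace_def del: tensor_power.simps power_Suc)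
    also have "\<dots> = (\<Sum>k<b ^ Suc n. ?T $$ (interleave a b n (i div a) (k div b), interleave a b n (j div a) (k div b))
        * \<rho> $$ (i mod a * b + k mod b, j mod a * b + k mod b))"
      by (rule sum.cong[OF refl]) (rule e, simp)
    also have "\<dots> = (\<Sum>k<b ^ n * b. ?T $$ (interleave a b n (i div a) (k div b), interleave a b n (j div a) (k div b))
        * \<rho> $$ (i mod a * b + k mod b, j mod a * b + k mod b))"
      by (simp add: mult.commute[of b])
    also have "\<dots> = (\<Sum>k<b ^ n. \<Sum>l<b. ?T $$ (interleave a b n (i div a) k, interleave a b n (j div a) k)
        * \<rho> $$ (i mod a * b + l, j mod a * b + l))"
      by (rule sum_div_mod)
    also have "\<dots> = (\<Sum>k<b ^ n. ?T $$ (interleave a b n (i div a) k, interleave a b n (j div a) k))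
        * (\<Sum>l<b. \<rho> $$ (i mod a * b + l, j mod a * b + l))"
      by (simp add: sum_product)
    also have "(\<Sum>k<b ^ n. ?T $$ (interleave a b n (i div a) k, interleave a b n (j div a) k))
       = partial_trace (a ^ n) (b ^ n) (regroup a b n ?T) $$ (i div a, j div a)"
      using I J by (auto simp: partial_trace_def regroup_def mult_add_less mult_add_div_mod intro!: sum.cong)
    also have "\<dots> = tensor_power (partial_trace a b \<rho>) n $$ (i div a, j div a)" unfolding Suc.IH ..
    also have "(\<Sum>l<b. \<rho> $$ (i mod a * b + l, j mod a * b + l)) = partial_trace a b \<rho> $$ (i mod a, j mod a)"
      using I J by (simp add: partial_trace_def)
    also have "tensor_power (partial_trace a b \<rho>) n $$ (i div a, j div a) * partial_trace a b \<rho> $$ (i mod a, j mod a)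
       = tensor_power (partial_trace a b \<rho>) (Suc n) $$ (i, j)"
      unfolding tensor_power.simps by (rule kron_index[symmetric]) (use ij in auto)
    finally show "partial_trace (a ^ Suc n) (b ^ Suc n) (regroup a b (Suc n) (tensor_power \<rho> (Suc n))) $$ (i, j)
      = tensor_power (partial_trace a b \<rho>) (Suc n) $$ (i, j)" .
  qed (use carrier_matD[OF tensor_power_carrier[OF partial_trace_carrier[of a b \<rho>], of n]] in auto)
qed

subsection \<open>Holomorphic families of matrices\<close>

text \<open>The analytic hypotheses on h in \<open>strip_derivative_le_ln\<close>. Closure under
  sums and products carries them from scalar exponentials to traces of matrix products.\<close>

definition strip_bounded :: "(complex \<Rightarrow> complex) \<Rightarrow> bool" where
  "strip_bounded f \<longleftrightarrow> f holomorphic_on UNIV \<and> (\<exists>B. \<forall>z. 0 \<le> Re z \<longrightarrow> Re z \<le> 1 \<longrightarrow> norm (f z) \<le> B)"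

lemma strip_bounded_const: "strip_bounded (\<lambda>_. c)"
  by (auto simp: strip_bounded_def)

lemma strip_bounded_exp: "strip_bounded (\<lambda>z. exp (of_real a * z))"
proof -
  have "norm (exp (of_real a * z)) \<le> exp \<bar>a\<bar>" if "0 \<le> Re z" "Re z \<le> 1" for z
  proof -
    have "a * Re z \<le> \<bar>a\<bar> * Re z" using that by (intro mult_right_mono) auto
    also have "\<dots> \<le> \<bar>a\<bar> * 1" using that by (intro mult_left_mono) auto
    finally have "a * Re z \<le> \<bar>a\<bar>" by simp
    then show ?thesis by (simp add: norm_exp_eq_Re)
  qed
  then show ?thesis unfolding strip_bounded_def by (auto intro!: holomorphic_intros)
qed

lemma strip_bounded_mult:
  assumes "strip_bounded f" "strip_bounded g"
  shows "strip_bounded (\<lambda>z. f z * g z)"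
proof -
  obtain B C where B: "\<And>z. 0 \<le> Re z \<Longrightarrow> Re z \<le> 1 \<Longrightarrow> norm (f z) \<le> B" "\<And>z. 0 \<le> Re z \<Longrightarrow> Re z \<le> 1 \<Longrightarrow> norm (g z) \<le> C"
    using assms unfolding strip_bounded_def by blast
  then have "norm (f z * g z) \<le> B * C" if "0 \<le> Re z" "Re z \<le> 1" for z
    using that order_trans[OF norm_ge_zero B(1)[OF that]] unfolding norm_mult by (intro mult_mono) auto
  then show ?thesis using assms unfolding strip_bounded_def by (auto intro!: holomorphic_intros)
qed

lemma strip_bounded_add:
  assumes "strip_bounded f" "strip_bounded g"
  shows "strip_bounded (\<lambda>z. f z + g z)"
proof -
  obtain B C where B: "\<And>z. 0 \<le> Re z \<Longrightarrow> Re z \<le> 1 \<Longrightarrow> norm (f z) \<le> B" "\<And>z. 0 \<le> Re z \<Longrightarrow> Re z \<le> 1 \<Longrightarrow> norm (g z) \<le> C"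
    using assms unfolding strip_bounded_def by blast
  then have "norm (f z + g z) \<le> B + C" if "0 \<le> Re z" "Re z \<le> 1" for z
    using that by (intro norm_triangle_mono) auto
  then show ?thesis using assms unfolding strip_bounded_def by (auto intro!: holomorphic_intros)
qed

lemma strip_bounded_sum:
  assumes "\<And>i. i \<in> A \<Longrightarrow> strip_bounded (f i)"
  shows "strip_bounded (\<lambda>z. \<Sum>i\<in>A. f i z)"
  using assms by (induction A rule: infinite_finite_induct) (auto intro: strip_bounded_add strip_bounded_const)

definition good_mat :: "nat \<Rightarrow> (complex \<Rightarrow> complex mat) \<Rightarrow> bool" where
  "good_mat n F \<longleftrightarrow> (\<forall>z. F z \<in> carrier_mat n n) \<and> (\<forall>i<n. \<forall>j<n. strip_bounded (\<lambda>z. F z $$ (i, j)))"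

lemma good_mat_const: "A \<in> carrier_mat n n \<Longrightarrow> good_mat n (\<lambda>_. A)"
  by (simp add: good_mat_def strip_bounded_const)

lemma good_mat_carrier: "good_mat n F \<Longrightarrow> F z \<in> carrier_mat n n"
  by (simp add: good_mat_def)

lemma good_mat_mult:
  assumes "good_mat n F" "good_mat n G"
  shows "good_mat n (\<lambda>z. F z * G z)"
  using assms unfolding good_mat_def
  by (auto simp: times_mat_index[of _ n n _ n] intro!: strip_bounded_sum strip_bounded_mult)

lemma good_mat_trace: "good_mat n F \<Longrightarrow> strip_bounded (\<lambda>z. mat_trace (F z))"
proof -
  assume F: "good_mat n F"
  then have "mat_trace (F z) = (\<Sum>i<n. F z $$ (i, i))" for z
    using carrier_matD[OF good_mat_carrier[OF F]] by (simp add: mat_trace_def)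
  then show ?thesis using F by (auto simp: good_mat_def intro!: strip_bounded_sum)
qed

lemma strip_bounded_integrable:
  assumes "strip_bounded f" "0 \<le> c" "c \<le> 1"
  shows "integrable lborel (\<lambda>t. of_real (beta0 t) * f (Complex c t))"
proof -
  obtain B where B: "\<And>z. 0 \<le> Re z \<Longrightarrow> Re z \<le> 1 \<Longrightarrow> norm (f z) \<le> B"
    using assms unfolding strip_bounded_def by blast
  have "continuous_on UNIV f"
    using assms(1) unfolding strip_bounded_def by (blast intro: holomorphic_on_imp_continuous_on)
  then have [measurable]: "(\<lambda>t. f (Complex c t)) \<in> borel_measurable borel"
    by (intro borel_measurable_continuous_onI continuous_on_compose2[where s = UNIV and g = f] continuous_intros) auto
  show ?thesis
    by (rule integrable_beta0_mult[of _ B])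
      (use B assms beta0_pos in \<open>auto simp: norm_mult abs_mult less_imp_le mult.commute intro!: mult_right_mono\<close>)
qed

definition mat_deriv :: "nat \<Rightarrow> (complex \<Rightarrow> complex mat) \<Rightarrow> complex mat \<Rightarrow> bool" where
  "mat_deriv n F L \<longleftrightarrow> L \<in> carrier_mat n n \<and>
     (\<forall>i<n. \<forall>j<n. ((\<lambda>z. F z $$ (i, j)) has_field_derivative L $$ (i, j)) (at 0))"

lemma good_mat_deriv:
  assumes "good_mat n F"
  shows "mat_deriv n F (mat n n (\<lambda>(i, j). deriv (\<lambda>z. F z $$ (i, j)) 0))"
  using assms unfolding mat_deriv_def good_mat_def strip_bounded_def
  by (auto intro: holomorphic_derivI[of _ UNIV])

lemma mat_deriv_mult:
  assumes "good_mat n F" "good_mat n G" and F: "mat_deriv n F L" and G: "mat_deriv n G K"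
  shows "mat_deriv n (\<lambda>z. F z * G z) (L * G 0 + F 0 * K)"
  unfolding mat_deriv_def
proof (intro conjI allI impI)
  have c: "\<And>z. F z \<in> carrier_mat n n" "\<And>z. G z \<in> carrier_mat n n" "L \<in> carrier_mat n n" "K \<in> carrier_mat n n"
    using assms by (auto simp: good_mat_def mat_deriv_def)
  show "L * G 0 + F 0 * K \<in> carrier_mat n n" using c by simp
  fix i j assume ij: "i < n" "j < n"
  have "((\<lambda>z. \<Sum>k<n. F z $$ (i, k) * G z $$ (k, j)) has_field_derivative
      (\<Sum>k<n. F 0 $$ (i, k) * K $$ (k, j) + L $$ (i, k) * G 0 $$ (k, j))) (at 0)"
    using F G ij by (intro DERIV_sum DERIV_mult') (auto simp: mat_deriv_def)
  moreover have "(L * G 0 + F 0 * K) $$ (i, j) = (\<Sum>k<n. F 0 $$ (i, k) * K $$ (k, j) + L $$ (i, k) * G 0 $$ (k, j))"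
    using c ij carrier_matD[OF c(1)] by (simp add: times_mat_index[of _ n n _ n] sum.distrib add.commute)
  ultimately show "((\<lambda>z. (F z * G z) $$ (i, j)) has_field_derivative (L * G 0 + F 0 * K) $$ (i, j)) (at 0)"
    using c ij by (simp add: times_mat_index[of _ n n _ n])
qed

lemma mat_deriv_trace:
  assumes P: "P \<in> carrier_mat n n" and "good_mat n F" and F: "mat_deriv n F L"
  shows "((\<lambda>z. mat_trace (P * F z)) has_field_derivative mat_trace (P * L)) (at 0)"
proof -
  have c: "\<And>z. F z \<in> carrier_mat n n" "L \<in> carrier_mat n n"
    using assms by (auto simp: good_mat_def mat_deriv_def)
  show ?thesis
    unfolding trace_mult[OF P c(1)] trace_mult[OF P c(2)]
    using F by (intro DERIV_sum DERIV_cmult) (auto simp: mat_deriv_def)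
qed

text \<open>
  Families that act trivially on the state \<open>P\<close> at \<open>z = 0\<close>, so that the derivative of the
  expectation value at \<open>0\<close> is additive under products.
\<close>

definition state_family :: "nat \<Rightarrow> complex mat \<Rightarrow> (complex \<Rightarrow> complex mat) \<Rightarrow> complex \<Rightarrow> bool" where
  "state_family n P F D \<longleftrightarrow> good_mat n F \<and> P * F 0 = P \<and> F 0 * P = P \<and>
     ((\<lambda>z. mat_trace (P * F z)) has_field_derivative D) (at 0)"

lemma trace_absorb:
  assumes "P \<in> carrier_mat n n" "L \<in> carrier_mat n n" "Z \<in> carrier_mat n n" "Z * P = P"
  shows "mat_trace (P * (L * Z)) = mat_trace (P * L)"
proof -
  have "mat_trace (P * (L * Z)) = mat_trace (Z * (P * L))"
    using assms by (subst trace_comm[of Z n n]) (auto simp: square_assoc[of _ n])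
  also have "Z * (P * L) = (Z * P) * L" by (rule assoc_mult_mat[symmetric]) (use assms in auto)
  finally show ?thesis using assms by simp
qed

text \<open>The product rule gives tr P (L G(0) + F(0) K). P absorbs F(0) directly and G(0) after a
  cyclic shift, which is why a family has to fix P from both sides.\<close>

lemma state_family_mult:
  assumes P: "P \<in> carrier_mat n n" and F: "state_family n P F D" and G: "state_family n P G E"
  shows "state_family n P (\<lambda>z. F z * G z) (D + E)"
proof -
  have gF: "good_mat n F" and gG: "good_mat n G" using F G by (auto simp: state_family_def)
  obtain L K where L: "mat_deriv n F L" "mat_deriv n G K" using good_mat_deriv[OF gF] good_mat_deriv[OF gG] by blast
  have c [simp]: "\<And>z. F z \<in> carrier_mat n n" "\<And>z. G z \<in> carrier_mat n n" "L \<in> carrier_mat n n" "K \<in> carrier_mat n n"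
    using gF gG L by (auto simp: good_mat_def mat_deriv_def)
  have D: "D = mat_trace (P * L)" "E = mat_trace (P * K)"
    using mat_deriv_trace[OF P gF L(1)] mat_deriv_trace[OF P gG L(2)] F G DERIV_unique
    unfolding state_family_def by blast+
  have s: "P * F 0 = P" "F 0 * P = P" "P * G 0 = P" "G 0 * P = P"
    using F G by (auto simp: state_family_def)
  have "mat_trace (P * (L * G 0 + F 0 * K)) = mat_trace (P * (L * G 0)) + mat_trace ((P * F 0) * K)"
    using P by (simp add: mult_add_distrib_mat[of _ n n _ n] trace_add[of _ n] square_assoc[of _ n] del: s)
  also have "\<dots> = D + E" using P s by (simp add: trace_absorb[of P n] D)
  finally have "((\<lambda>z. mat_trace (P * (F z * G z))) has_field_derivative D + E) (at 0)"
    using mat_deriv_trace[OF P good_mat_mult[OF gF gG] mat_deriv_mult[OF gF gG L]] by simp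
  moreover have "P * (F 0 * G 0) = (P * F 0) * G 0" "(F 0 * G 0) * P = F 0 * (G 0 * P)"
    using P by (simp_all add: square_assoc[of _ n] del: s)
  ultimately show ?thesis
    using good_mat_mult[OF gF gG] unfolding state_family_def by (simp add: s)
qed

text \<open>Families \<open>z \<mapsto> exp (z H)\<close>, restricted to an invariant subspace of the Hermitian matrix \<open>H\<close>.\<close>

definition exp_family :: "nat \<Rightarrow> (complex \<Rightarrow> complex mat) \<Rightarrow> bool" where
  "exp_family n F \<longleftrightarrow> (\<exists>U c (a :: nat \<Rightarrow> real). U \<in> carrier_mat n n \<and> U * dag U = 1\<^sub>m n \<and> (\<forall>i. c i = 0 \<or> c i = 1) \<and>
     F = (\<lambda>z. U * mat_diag n (\<lambda>i. c i * exp (complex_of_real (a i) * z)) * dag U))"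

lemma exp_family_good:
  assumes "exp_family n F"
  shows "good_mat n F"
proof -
  obtain U c and a :: "nat \<Rightarrow> real" where U: "U \<in> carrier_mat n n"
    and F: "F = (\<lambda>z. U * mat_diag n (\<lambda>i. c i * exp (complex_of_real (a i) * z)) * dag U)"
    using assms unfolding exp_family_def by blast
  have "good_mat n (\<lambda>z. mat_diag n (\<lambda>i. c i * exp (complex_of_real (a i) * z)))"
    unfolding good_mat_def
  proof (intro conjI allI impI)
    fix i j assume "i < n" "j < n"
    then show "strip_bounded (\<lambda>z. mat_diag n (\<lambda>i. c i * exp (complex_of_real (a i) * z)) $$ (i, j))"
      by (cases "i = j") (simp_all add: mat_diag_index strip_bounded_mult strip_bounded_const strip_bounded_exp)
  qed simp
  then show ?thesis unfolding F
    by (intro good_mat_mult good_mat_const) (use U in auto)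
qed

lemma exp_family_zero_hermitian:
  assumes "exp_family n F"
  shows "dag (F 0) = F 0"
proof -
  obtain U c and a :: "nat \<Rightarrow> real" where U: "U \<in> carrier_mat n n" "\<And>i. c i = 0 \<or> c i = 1"
    and F: "F = (\<lambda>z. U * mat_diag n (\<lambda>i. c i * exp (complex_of_real (a i) * z)) * dag U)"
    using assms unfolding exp_family_def by blast
  have "cnj (c i) = c i" for i using U(2)[of i] by auto
  then show ?thesis using U(1) by (simp add: F dag_mult[of _ n n _ n] square_assoc[of _ n])
qed

text \<open>For imaginary z the exponentials are phases, and each c i is 0 or 1, so F is a
  contraction: in its eigenbasis the diagonal entries of P are multiplied by |d i|^2 \<le>
  1.\<close>

lemma exp_family_imaginary:
  assumes "exp_family n F" and P: "positive_semidefinite n P"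
  shows "positive_semidefinite n (F (Complex 0 t) * P * dag (F (Complex 0 t)))"
    "Re (mat_trace (F (Complex 0 t) * P * dag (F (Complex 0 t)))) \<le> Re (mat_trace P)"
proof -
  obtain U c and a :: "nat \<Rightarrow> real" where U: "U \<in> carrier_mat n n" "U * dag U = 1\<^sub>m n" "\<And>i. c i = 0 \<or> c i = 1"
    and F: "F = (\<lambda>z. U * mat_diag n (\<lambda>i. c i * exp (complex_of_real (a i) * z)) * dag U)"
    using assms unfolding exp_family_def by blast
  note C [simp] = psd_carrier[OF P] note [simp] = U(1) note U' = unitary_left[OF U(1,2)]
  show "positive_semidefinite n (F (Complex 0 t) * P * dag (F (Complex 0 t)))"
    by (rule psd_congruence[OF P good_mat_carrier[OF exp_family_good[OF assms(1)]]])
  define d where "d = (\<lambda>i. c i * exp (complex_of_real (a i) * Complex 0 t))"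
  define Q where "Q = dag U * P * U"
  have Q: "Q \<in> carrier_mat n n" by (simp add: Q_def)
  have Q0: "0 \<le> Q $$ (i, i)" if "i < n" for i
    using psd_diagonal[OF psd_congruence[OF P, of "dag U"] that] by (simp add: Q_def)
  have "mat_trace (F (Complex 0 t) * P * dag (F (Complex 0 t)))
      = mat_trace (U * (mat_diag n d * Q * mat_diag n (\<lambda>i. cnj (d i)) * dag U))"
    unfolding F d_def[symmetric] Q_def by (simp add: dag_mult[of _ n n _ n] square_assoc[of _ n])
  also have "\<dots> = mat_trace (mat_diag n d * Q * mat_diag n (\<lambda>i. cnj (d i)))"
    using Q by (subst trace_comm[of _ n n]) (auto simp: square_assoc[of _ n] U')
  also have "\<dots> = (\<Sum>i<n. d i * Q $$ (i, i) * cnj (d i))"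
    using Q by (simp add: mat_diag_mult_left[OF Q] mat_diag_mult_right[of _ n n] mat_trace_def)
  also have "\<dots> = (\<Sum>i<n. Q $$ (i, i) * of_real ((cmod (d i))\<^sup>2))"
    by (intro sum.cong refl) (simp add: complex_norm_square mult_ac del: of_real_power)
  finally have "Re (mat_trace (F (Complex 0 t) * P * dag (F (Complex 0 t)))) = (\<Sum>i<n. Re (Q $$ (i, i)) * (cmod (d i))\<^sup>2)"
    by simp
  also have "\<dots> \<le> (\<Sum>i<n. Re (Q $$ (i, i)))"
  proof (rule sum_mono)
    fix i assume "i \<in> {..<n}"
    then have "0 \<le> Re (Q $$ (i, i))" using Q0 by (simp add: less_eq_complex_def)
    moreover have "cmod (d i) \<le> 1" using U(3)[of i] by (auto simp: d_def norm_mult norm_exp_eq_Re)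
    then have "(cmod (d i))\<^sup>2 \<le> 1" by (simp add: power_le_one)
    ultimately show "Re (Q $$ (i, i)) * (cmod (d i))\<^sup>2 \<le> Re (Q $$ (i, i))" by (rule mult_left_le[rotated])
  qed
  also have "\<dots> = Re (mat_trace Q)" using Q by (simp add: mat_trace_def)
  also have "mat_trace Q = mat_trace (U * (dag U * P))" unfolding Q_def by (rule trace_comm[of _ n n, symmetric]) auto
  also have "U * (dag U * P) = P" by (rule mult_cancel_inverse[of _ n]) (use U in auto)
  finally show "Re (mat_trace (F (Complex 0 t) * P * dag (F (Complex 0 t)))) \<le> Re (mat_trace P)" .
qed

lemma exp_family_mat_fun:
  assumes M: "positive_semidefinite n M" and c: "\<And>x. c x = 0 \<or> c x = 1"
  shows "exp_family n (\<lambda>z. mat_fun (\<lambda>x. c x * exp (complex_of_real (a x) * z)) M)"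
proof (rule psd_spectral[OF M])
  fix U l assume S: "spectral n M U l"
  show ?thesis
    unfolding exp_family_def mat_fun_spectral[OF S]
    by (intro exI[of _ U] exI[of _ "\<lambda>i. c (l i)"] exI[of _ "\<lambda>i. a (l i)"]) (use spectralD[OF S] c in auto)
qed

lemma trace_mat_fun_deriv:
  assumes M: "positive_semidefinite n M" and P: "P \<in> carrier_mat n n"
  shows "((\<lambda>z. mat_trace (P * mat_fun (\<lambda>x. c x * exp (complex_of_real (a x) * z)) M))
    has_field_derivative mat_trace (P * mat_fun (\<lambda>x. c x * of_real (a x)) M)) (at 0)"
proof (rule psd_spectral[OF M])
  fix U l assume S: "spectral n M U l"
  have d: "((\<lambda>z. c x * exp (complex_of_real (a x) * z)) has_field_derivative c x * of_real (a x)) (at 0)" for x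
    by (auto intro!: derivative_eq_intros)
  show ?thesis
    unfolding trace_mat_fun_spectral[OF S P] by (rule DERIV_sum, rule DERIV_cmult, rule d)
qed

lemma state_family_mat_fun:
  assumes M: "positive_semidefinite n M" and P: "positive_semidefinite n P" and c: "\<And>x. c x = 0 \<or> c x = 1"
    and supp: "P * mat_fun c M = P"
  shows "state_family n P (\<lambda>z. mat_fun (\<lambda>x. c x * exp (complex_of_real (a x) * z)) M) (mat_trace (P * mat_fun (\<lambda>x. c x * of_real (a x)) M))"
proof -
  note C = psd_carrier[OF P]
  note E = exp_family_mat_fun[OF M, of c a, OF c]
  have "dag (P * mat_fun c M) = mat_fun c M * P"
    using C M exp_family_zero_hermitian[OF E] by (simp add: dag_mult[of _ n n _ n] psd_hermitian[OF P])
  then have "mat_fun c M * P = P" using supp psd_hermitian[OF P] by simp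
  then show ?thesis
    unfolding state_family_def using exp_family_good[OF E] supp trace_mat_fun_deriv[OF M C] by simp
qed

lemma cpow_eq_mat_fun:
  assumes M: "positive_semidefinite n M"
  shows "mat_cpow M (of_real s * z) = mat_fun (\<lambda>x. (if x = 0 then 0 else 1) * exp (complex_of_real (s * ln x) * z)) M"
  unfolding mat_cpow_def by (rule mat_fun_cong[OF M]) (auto simp: of_real_powr_eq less_le mult_ac)

lemma cpow_zero: "mat_cpow M 0 = mat_fun (\<lambda>x. if x = 0 then 0 else 1) M"
  unfolding mat_cpow_def by (rule arg_cong[where f = "\<lambda>f. mat_fun f M"]) auto

lemma exp_family_cpow:
  assumes M: "positive_semidefinite n M"
  shows "exp_family n (\<lambda>z. mat_cpow M (of_real s * z))"
  unfolding cpow_eq_mat_fun[OF M] by (rule exp_family_mat_fun[OF M]) auto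

lemma mat_fun_smult:
  assumes M: "positive_semidefinite n M"
  shows "mat_fun (\<lambda>x. s * f x) M = s \<cdot>\<^sub>m mat_fun f M"
proof (rule psd_spectral[OF M])
  fix U l assume S: "spectral n M U l"
  note U = spectralD(1)[OF S]
  have "mat_diag n (\<lambda>i. s * f (l i)) = s \<cdot>\<^sub>m mat_diag n (\<lambda>i. f (l i))"
    by (rule eq_matI) (auto simp: mat_diag_index)
  then show ?thesis using U
    by (simp add: mat_fun_spectral[OF S] mult_smult_distrib[of _ n n _ n] mult_smult_assoc_mat[of _ n n _ n])
qed

text \<open>On the support the power is an exponential, whose derivative at 0 produces the
  logarithm. At z = 0 the family is the support projection, and \<open>supp\<close> says that it
  fixes P.\<close>

lemma state_family_cpow:
  assumes M: "positive_semidefinite n M" and P: "positive_semidefinite n P" and supp: "P * mat_cpow M 0 = P"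
  shows "state_family n P (\<lambda>z. mat_cpow M (of_real s * z)) (of_real s * mat_trace (P * mat_log M))"
proof -
  note C = psd_carrier[OF P]
  have "mat_fun (\<lambda>x. (if x = 0 then 0 else 1) * complex_of_real (s * ln x)) M = of_real s \<cdot>\<^sub>m mat_log M"
    unfolding mat_log_def mat_fun_smult[OF M, symmetric] by (rule arg_cong[where f = "\<lambda>f. mat_fun f M"]) auto
  then have "mat_trace (P * mat_fun (\<lambda>x. (if x = 0 then 0 else 1) * complex_of_real (s * ln x)) M) = of_real s * mat_trace (P * mat_log M)"
    using C M by (simp add: mult_smult_distrib[of _ n n _ n] trace_smult[of _ n])
  then show ?thesis
    unfolding cpow_eq_mat_fun[OF M]
    using state_family_mat_fun[OF M P, of "\<lambda>x. if x = 0 then 0 else 1" "\<lambda>x. s * ln x"] supp by (simp add: cpow_zero)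
qed

subsection \<open>The multivariate trace inequality\<close>

text \<open>Cauchy-Schwarz in the Hilbert-Schmidt inner product for Y and G Y, where
  \<open>P = Y * dag Y\<close>.\<close>

lemma trace_state_cauchy_schwarz:
  assumes P: "positive_semidefinite n P" and G: "G \<in> carrier_mat n n"
  shows "(cmod (mat_trace (P * G)))\<^sup>2 \<le> Re (mat_trace P) * Re (mat_trace (G * P * dag G))"
proof -
  obtain Y where Y: "Y \<in> carrier_mat n n" "P = Y * dag Y" using psd_factor[OF P] by blast
  have "mat_trace (P * G) = mat_trace (dag Y * (G * Y))"
    using Y G trace_comm[of Y n n "dag Y * G"] by (simp add: square_assoc[of _ n])
  moreover have "mat_trace P = mat_trace (dag Y * Y)"
    using Y trace_comm[of Y n n "dag Y"] by simp
  moreover have "mat_trace (G * P * dag G) = mat_trace (dag (G * Y) * (G * Y))"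
    using Y G trace_comm[of "dag (G * Y)" n n "G * Y"] by (simp add: square_assoc[of _ n] dag_mult[of _ n n _ n])
  ultimately show ?thesis using trace_cauchy_schwarz[of Y n n "G * Y"] Y G by simp
qed

text \<open>The factor 2 is the derivative of the square and compensates the exponents 1/2 of the
  applications. Admitting a majorant u of the sandwich on Re z = 1 leaves room to estimate, in
  particular to pinch, before averaging over t.\<close>

lemma multivariate_trace_bound:
  assumes P: "positive_semidefinite n P" and tr: "mat_trace P = 1"
    and E: "exp_family n F1" "exp_family n F2" "exp_family n F3" "exp_family n F4"
    and S: "state_family n P F1 D1" "state_family n P F2 D2" "state_family n P F3 D3" "state_family n P F4 D4"
    and u: "\<And>t z. z = Complex 1 t \<Longrightarrow> Re (mat_trace (F1 z * (F2 z * (F3 z * (F4 z * P * dag (F4 z)) * dag (F3 z)) * dag (F2 z)) * dag (F1 z))) \<le> u t"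
    and ui: "integrable lborel (\<lambda>t. beta0 t * u t)" and uc: "(LINT t|lborel. beta0 t * u t) \<le> c" and c: "0 < c"
  shows "2 * Re (D1 + D2 + D3 + D4) \<le> ln c"
proof -
  define G where "G = (\<lambda>z. F1 z * F2 z * F3 z * F4 z)"
  note C [simp] = psd_carrier[OF P]
  note car [simp] = E[THEN exp_family_good, THEN good_mat_carrier]
  have S: "state_family n P G (D1 + D2 + D3 + D4)"
    unfolding G_def by (intro state_family_mult[OF C] S)
  have G: "G z \<in> carrier_mat n n" for z by (simp add: G_def)
  have nest: "G z * P * dag (G z) = F1 z * (F2 z * (F3 z * (F4 z * P * dag (F4 z)) * dag (F3 z)) * dag (F2 z)) * dag (F1 z)" for z
    by (simp add: G_def dag_mult[of _ n n _ n] square_assoc[of _ n])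
  define g where "g = (\<lambda>z. mat_trace (P * G z))"
  define h where "h = (\<lambda>z. g z * g z)"
  have h_le: "norm (h z) \<le> Re (mat_trace (G z * P * dag (G z)))" for z
    using trace_state_cauchy_schwarz[OF P G, of z] tr by (simp add: h_def g_def norm_mult power2_eq_square)
  have sb: "strip_bounded h"
    unfolding h_def g_def using S
    by (intro strip_bounded_mult good_mat_trace good_mat_mult good_mat_const) (auto simp: state_family_def)
  then obtain B where B: "h holomorphic_on UNIV" "\<And>z. 0 \<le> Re z \<Longrightarrow> Re z \<le> 1 \<Longrightarrow> norm (h z) \<le> B"
    unfolding strip_bounded_def by blast
  have g0: "g 0 = 1" using S tr by (simp add: g_def state_family_def)
  have "(g has_field_derivative (D1 + D2 + D3 + D4)) (at 0)" using S by (simp add: g_def state_family_def)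
  then have "(h has_field_derivative g 0 * (D1 + D2 + D3 + D4) + (D1 + D2 + D3 + D4) * g 0) (at 0)"
    unfolding h_def by (rule DERIV_mult'[OF _ ]) fact
  then have deriv: "(h has_field_derivative 2 * (D1 + D2 + D3 + D4)) (at 0)"
    by (rule DERIV_cong) (simp add: g0)
  have "Re (2 * (D1 + D2 + D3 + D4)) \<le> ln c"
  proof (rule strip_derivative_le_ln[OF B _ _ deriv c])
    show "h 0 = 1" by (simp add: h_def g0)
    show "norm (h (Complex 0 t)) \<le> 1" for t
    proof -
      let ?z = "Complex 0 t"
      \<comment> \<open>The contractions are peeled off one at a time from the inside; each sandwich
        stays positive and loses trace at most.\<close>
      note e = exp_family_imaginary[of n _ _ t]
      have p4: "positive_semidefinite n (F4 ?z * P * dag (F4 ?z))" by (rule e(1)[OF E(4) P])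
      have p3: "positive_semidefinite n (F3 ?z * (F4 ?z * P * dag (F4 ?z)) * dag (F3 ?z))" by (rule e(1)[OF E(3) p4])
      have p2: "positive_semidefinite n (F2 ?z * (F3 ?z * (F4 ?z * P * dag (F4 ?z)) * dag (F3 ?z)) * dag (F2 ?z))" by (rule e(1)[OF E(2) p3])
      have "Re (mat_trace (G ?z * P * dag (G ?z))) \<le> Re (mat_trace P)"
        unfolding nest using e(2)[OF E(1) p2] e(2)[OF E(2) p3] e(2)[OF E(3) p4] e(2)[OF E(4) P] by linarith
      then show ?thesis using h_le[of ?z] tr by simp
    qed
    have "(LINT t|lborel. beta0 t * norm (h (Complex 1 t))) \<le> (LINT t|lborel. beta0 t * u t)"
    proof (rule integral_mono[OF _ ui])
      show "integrable lborel (\<lambda>t. beta0 t * norm (h (Complex 1 t)))"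
        using strip_bounded_integrable[OF sb, of 1, THEN integrable_norm] beta0_pos by (simp add: norm_mult less_imp_le)
      show "beta0 t * norm (h (Complex 1 t)) \<le> beta0 t * u t" for t
        using order_trans[OF h_le[of "Complex 1 t", unfolded nest] u[OF refl]] beta0_pos[of t] by (simp add: mult_left_mono)
    qed
    then show "(LINT t|lborel. beta0 t * norm (h (Complex 1 t))) \<le> c" using uc by simp
  qed
  then show ?thesis by simp
qed

subsection \<open>Support projections\<close>

lemma trace_eq_imp_eq:
  assumes A: "A \<in> carrier_mat n n" and B: "B \<in> carrier_mat n n"
    and eq: "\<And>C :: complex mat. C \<in> carrier_mat n n \<Longrightarrow> mat_trace (C * A) = mat_trace (C * B)"
  shows "A = B"
proof (rule eq_matI)
  fix i j assume "i < dim_row B" "j < dim_col B"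
  then have ij: "i < n" "j < n" using B by auto
  define C where "C = mat n n (\<lambda>(k, l). if k = j \<and> l = i then 1 else (0 :: complex))"
  have C: "C \<in> carrier_mat n n" by (simp add: C_def)
  have "mat_trace (C * M) = M $$ (i, j)" if "M \<in> carrier_mat n n" for M
  proof -
    have "mat_trace (C * M) = (\<Sum>k<n. \<Sum>l<n. if l = i then (if k = j then M $$ (l, k) else 0) else 0)"
      unfolding trace_mult[OF C that] by (intro sum.cong refl) (auto simp: C_def)
    then show ?thesis using ij by simp
  qed
  then show "A $$ (i, j) = B $$ (i, j)" using eq[OF C] A B by simp
qed (use A B in auto)

text \<open>The rank one tests formed from v and its adjoint already recover the quadratic form.
  Phrased with traces, positivity passes from the integrand \<open>X t\<close> to its
  average.\<close>

lemma psd_if_trace_nonneg: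
  assumes M: "M \<in> carrier_mat n n" and pos: "\<And>C. positive_semidefinite n C \<Longrightarrow> 0 \<le> mat_trace (C * M)"
  shows "positive_semidefinite n M"
  unfolding positive_semidefinite_def
proof (intro conjI ballI M)
  fix v :: "complex vec" assume v: "v \<in> carrier_vec n"
  define V where "V = mat n 1 (\<lambda>(i, j). v $ i)"
  have V: "V \<in> carrier_mat n 1" by (simp add: V_def)
  have VV: "(V * dag V) $$ (j, i) = v $ j * cnj (v $ i)" if "i < n" "j < n" for i j
    using that by (simp add: times_mat_index[OF V dag_carrier[OF V]]) (simp add: V_def)
  have "(M *\<^sub>v v) \<bullet>c v = (\<Sum>i<n. \<Sum>j<n. M $$ (i, j) * (v $ j * cnj (v $ i)))"
    using v M by (auto simp: scalar_prod_def atLeast0LessThan sum_distrib_left mult_ac intro!: sum.cong)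
  also have "\<dots> = mat_trace (M * (V * dag V))"
    by (subst trace_mult[OF M]) (use V VV in auto)
  also have "\<dots> = mat_trace ((V * dag V) * M)"
    by (rule trace_comm[OF M]) (use V in auto)
  also have "0 \<le> \<dots>" by (rule pos[OF psd_mult_dag[OF V]])
  finally show "0 \<le> (M *\<^sub>v v) \<bullet>c v" .
qed

lemma complement_idempotent:
  assumes Q: "(Q :: complex mat) \<in> carrier_mat n n" and QQ: "Q * Q = Q"
  shows "(1\<^sub>m n - Q) * (1\<^sub>m n - Q) = 1\<^sub>m n - Q"
proof -
  have c: "1\<^sub>m n - Q \<in> carrier_mat n n" by (rule minus_carrier_mat[OF Q])
  have "(1\<^sub>m n - Q) * (1\<^sub>m n - Q) = (1\<^sub>m n - Q) * 1\<^sub>m n - (1\<^sub>m n - Q) * Q"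
    by (rule mult_minus_distrib_mat[OF c one_carrier_mat Q])
  also have "(1\<^sub>m n - Q) * Q = 1\<^sub>m n * Q - Q * Q"
    by (rule minus_mult_distrib_mat[OF one_carrier_mat Q Q])
  also have "(1\<^sub>m n - Q) * 1\<^sub>m n - (1\<^sub>m n * Q - Q * Q) = 1\<^sub>m n - Q"
    by (rule eq_matI) (use Q in \<open>auto simp: QQ one_mult_square[OF c] one_mult_square[OF Q]\<close>)
  finally show ?thesis .
qed

lemma hermitian_projection_psd:
  assumes "Q \<in> carrier_mat n n" "Q * Q = Q" "dag Q = Q"
  shows "positive_semidefinite n Q" "positive_semidefinite n (1\<^sub>m n - Q)"
proof -
  show "positive_semidefinite n Q" using psd_mult_dag[OF assms(1)] assms by simp
  have c: "1\<^sub>m n - Q \<in> carrier_mat n n" by (rule minus_carrier_mat[OF assms(1)])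
  have "(1\<^sub>m n - Q) * dag (1\<^sub>m n - Q) = 1\<^sub>m n - Q"
    using assms by (simp add: dag_minus[of _ n n] complement_idempotent)
  then show "positive_semidefinite n (1\<^sub>m n - Q)" using psd_mult_dag[OF c] by simp
qed

text \<open>Removes from a sandwich the support projection that is left where a state meets its own
  negative powers.\<close>

lemma trace_sandwich_le:
  assumes C: "positive_semidefinite n C" and K: "K \<in> carrier_mat n n" and Q: "Q \<in> carrier_mat n n"
    and Q1: "positive_semidefinite n (1\<^sub>m n - Q)"
  shows "Re (mat_trace (C * (K * Q * dag K))) \<le> Re (mat_trace (C * (K * dag K)))"
proof -
  have "0 \<le> mat_trace (C * (K * (1\<^sub>m n - Q) * dag K))"
    by (rule psd_trace_mult_nonneg[OF C psd_congruence[OF Q1 K]])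
  also have "K * (1\<^sub>m n - Q) * dag K = K * dag K - K * Q * dag K"
    using K Q by (simp add: mult_minus_distrib_mat[of _ n n _ n] minus_mult_distrib_mat[of _ n n _ _ n])
  also have "mat_trace (C * \<dots>) = mat_trace (C * (K * dag K)) - mat_trace (C * (K * Q * dag K))"
    using K Q psd_carrier[OF C] by (simp add: mult_minus_distrib_mat[of _ n n _ n] trace_minus[of _ n])
  finally show ?thesis by (simp add: less_eq_complex_def)
qed

context
  fixes n M
  assumes M: "positive_semidefinite n M"
begin

lemma cpow_zero_projection:
  "mat_cpow M 0 * mat_cpow M 0 = mat_cpow M 0" "dag (mat_cpow M 0) = mat_cpow M 0"
  "positive_semidefinite n (mat_cpow M 0)" "positive_semidefinite n (1\<^sub>m n - mat_cpow M 0)"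
proof -
  show 1: "mat_cpow M 0 * mat_cpow M 0 = mat_cpow M 0" and 2: "dag (mat_cpow M 0) = mat_cpow M 0"
    using cpow_mult[OF M, of 0 0] cpow_dag[OF M, of 0] by simp_all
  show "positive_semidefinite n (mat_cpow M 0)" "positive_semidefinite n (1\<^sub>m n - mat_cpow M 0)"
    using hermitian_projection_psd[OF cpow_carrier[OF M] 1 2] by auto
qed

lemma cpow_zero_mult: "mat_cpow M 0 * M = M" "M * mat_cpow M 0 = M"
  using cpow_mult[OF M, of 0 1] cpow_mult[OF M, of 1 0] cpow_one[OF M] by simp_all

lemma cpow_minus_one_mult: "mat_cpow M (-1) * M = mat_cpow M 0" "M * mat_cpow M (-1) = mat_cpow M 0"
  using cpow_mult[OF M, of "-1" 1] cpow_mult[OF M, of 1 "-1"] cpow_one[OF M] by simp_all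

text \<open>The projection M^0 = M^(-1) M kills the kernel, so its fixed vectors are orthogonal to
  the kernel. Conversely, for v in the support, w = v - M^0 v lies in the kernel, is thus orthogonal
  to v and to M^0 v, and so to itself.\<close>

lemma supp_iff: "v \<in> supp M \<longleftrightarrow> v \<in> carrier_vec n \<and> mat_cpow M 0 *\<^sub>v v = v"
proof -
  note C [simp] = psd_carrier[OF M] cpow_carrier[OF M]
  let ?Q = "mat_cpow M 0"
  have d: "dim_row M = n" "dim_col M = n" using carrier_matD[OF psd_carrier[OF M]] by auto
  have sufficient: "v \<in> supp M" if v: "v \<in> carrier_vec n" "?Q *\<^sub>v v = v" for v
    unfolding supp_def d
  proof (intro CollectI conjI ballI v)
    fix w assume "w \<in> mat_kernel M"
    then have w: "w \<in> carrier_vec n" "M *\<^sub>v w = 0\<^sub>v n" using mat_kernelD[OF C(1)] by auto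
    have "?Q *\<^sub>v w = mat_cpow M (-1) *\<^sub>v (M *\<^sub>v w)"
      using w(1) by (simp add: assoc_mult_mat_vec[of _ n n _ n, symmetric] cpow_minus_one_mult)
    then have "?Q *\<^sub>v w = 0\<^sub>v n" using w(2) carrier_matD[OF cpow_carrier[OF M]] by (auto intro!: eq_vecI)
    moreover have "(?Q *\<^sub>v v) \<bullet>c w = v \<bullet>c (dag ?Q *\<^sub>v w)" by (rule adjoint_inner) (use v w in auto)
    ultimately show "v \<bullet>c w = 0" using v by (simp add: cpow_zero_projection)
  qed
  have "?Q *\<^sub>v v = v" if v: "v \<in> supp M" for v
  proof -
    have vn: "v \<in> carrier_vec n" using v by (simp add: supp_def d)
    have Qv: "?Q *\<^sub>v v \<in> carrier_vec n" by (rule mult_mat_vec_carrier[OF C(2) vn])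
    have QQv: "?Q *\<^sub>v (?Q *\<^sub>v v) = ?Q *\<^sub>v v"
      using vn by (simp add: assoc_mult_mat_vec[of _ n n _ n, symmetric] cpow_zero_projection)
    define w where "w = v - ?Q *\<^sub>v v"
    have w: "w \<in> carrier_vec n" using vn Qv by (simp add: w_def)
    have "M *\<^sub>v w = M *\<^sub>v v - M *\<^sub>v (?Q *\<^sub>v v)"
      unfolding w_def by (rule mult_minus_distrib_mat_vec[OF C(1) vn Qv])
    also have "M *\<^sub>v (?Q *\<^sub>v v) = M *\<^sub>v v"
      using vn by (simp add: assoc_mult_mat_vec[of _ n n _ n, symmetric] cpow_zero_mult)
    also have "M *\<^sub>v v - M *\<^sub>v v = 0\<^sub>v n" using vn mult_mat_vec_carrier[OF C(1) vn] by simp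
    finally have ker: "w \<in> mat_kernel M" using w by (intro mat_kernelI[OF C(1)])
    have "v \<bullet>c w = 0" "(?Q *\<^sub>v v) \<bullet>c w = 0"
      using v ker sufficient[OF Qv QQv] by (auto simp: supp_def)
    then have "w \<bullet>c w = 0"
      using minus_scalar_prod_distrib[of v n "?Q *\<^sub>v v" "conjugate w"] vn Qv w by (simp add: w_def)
    then have "w = 0\<^sub>v n" using conjugate_square_eq_0_vec[OF w] by simp
    then have z: "(v - ?Q *\<^sub>v v) $ i = 0" if "i < n" for i using that by (simp add: w_def)
    show ?thesis
    proof (rule eq_vecI)
      fix i assume "i < dim_vec v"
      then have i: "i < n" using vn by simp
      then have "v $ i - (?Q *\<^sub>v v) $ i = 0" using z[OF i] index_minus_vec(1)[of i "?Q *\<^sub>v v" v] carrier_vecD[OF Qv] by metis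
      then show "(?Q *\<^sub>v v) $ i = v $ i" by (metis eq_iff_diff_eq_0)
    qed (use carrier_vecD[OF Qv] vn in simp)
  qed
  then show ?thesis using sufficient by (auto simp: supp_def d)
qed

end

text \<open>The algebraic form in which \<open>state_family_cpow\<close> takes support inclusion.
  The columns of P lie in its support, so the inclusion makes M^0 fix each of them; conversely P^0 =
  P P^(-1) inherits invariance from P.\<close>

lemma supp_subset_iff:
  assumes M: "positive_semidefinite n M" and P: "positive_semidefinite n P"
  shows "supp P \<subseteq> supp M \<longleftrightarrow> P * mat_cpow M 0 = P"
proof -
  note C [simp] = psd_carrier[OF M] cpow_carrier[OF M] psd_carrier[OF P] cpow_carrier[OF P]
  let ?Q = "mat_cpow M 0"
  have dag_iff: "P * ?Q = P \<longleftrightarrow> ?Q * P = P"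
    using dag_mult[of P n n ?Q n] dag_mult[of ?Q n n P n] cpow_zero_projection[OF M] psd_hermitian[OF P] by auto
  note suppP = supp_iff[OF P]
  show ?thesis
  proof
    assume sub: "supp P \<subseteq> supp M"
    have "?Q * P = P"
    proof (rule mat_col_eqI)
      fix j assume "j < dim_col P"
      then have j: "j < n" using C(3) by auto
      have c: "col P j \<in> carrier_vec n" by (rule col_carrier_vec[OF j psd_carrier[OF P]])
      have "col (mat_cpow P 0 * P) j = mat_cpow P 0 *\<^sub>v col P j" by (rule col_mult2[of _ n n _ n]) (use j in auto)
      then have "mat_cpow P 0 *\<^sub>v col P j = col P j" 
        using cpow_mult[OF P, of 0 1] cpow_one[OF P] by simp
      then have "col P j \<in> supp M" using c sub suppP by auto
      then have "?Q *\<^sub>v col P j = col P j" by (simp add: supp_iff[OF M])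
      moreover have "col (?Q * P) j = ?Q *\<^sub>v col P j" by (rule col_mult2[of _ n n _ n]) (use j in auto)
      ultimately show "col (?Q * P) j = col P j" by simp
    qed (use carrier_matD[OF psd_carrier[OF P]] carrier_matD[OF cpow_carrier[OF M]] in auto)
    then show "P * ?Q = P" by (simp add: dag_iff)
  next
    assume "P * ?Q = P"
    then have QP: "?Q * P = P" by (simp add: dag_iff)
    have P0: "mat_cpow P 0 = P * mat_cpow P (-1)" using cpow_mult[OF P, of 1 "-1"] cpow_one[OF P] by simp
    have "?Q * mat_cpow P 0 = (?Q * P) * mat_cpow P (-1)"
      unfolding P0 by (rule assoc_mult_mat[of _ n n _ n _ n, symmetric]) auto
    then have QP0: "?Q * mat_cpow P 0 = mat_cpow P 0" by (simp add: QP P0)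
    show "supp P \<subseteq> supp M"
    proof
      fix v assume "v \<in> supp P"
      then have v: "v \<in> carrier_vec n" "mat_cpow P 0 *\<^sub>v v = v" by (auto simp: suppP)
      have "?Q *\<^sub>v v = ?Q *\<^sub>v (mat_cpow P 0 *\<^sub>v v)" by (simp add: v)
      also have "\<dots> = (?Q * mat_cpow P 0) *\<^sub>v v" by (rule assoc_mult_mat_vec[of _ n n _ n, symmetric]) (use v in auto)
      also have "\<dots> = v" by (simp add: QP0 v)
      finally show "v \<in> supp M" using v by (simp add: supp_iff[OF M])
    qed
  qed
qed

text \<open>For the complementary projection E the equality of traces says tr E P E = 0, which
  forces P E = 0. A scalar test suits tensor powers, where traces are multiplicative.\<close>

lemma trace_cpow_zero_iff:
  assumes M: "positive_semidefinite n M" and P: "positive_semidefinite n P"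
  shows "P * mat_cpow M 0 = P \<longleftrightarrow> mat_trace (P * mat_cpow M 0) = mat_trace P"
proof
  note C [simp] = psd_carrier[OF M] cpow_carrier[OF M] psd_carrier[OF P]
  let ?E = "1\<^sub>m n - mat_cpow M 0"
  assume tr: "mat_trace (P * mat_cpow M 0) = mat_trace P"
  have E: "?E \<in> carrier_mat n n" by (rule minus_carrier_mat) simp
  have EE: "?E * ?E = ?E" "dag ?E = ?E"
    by (simp_all add: complement_idempotent cpow_zero_projection[OF M] dag_minus[of _ n n])
  have PE: "P * ?E = P - P * mat_cpow M 0" by (simp add: mult_minus_distrib_mat[of _ n n _ n])
  have "mat_trace (dag ?E * (P * ?E)) = mat_trace (P * ?E * ?E)"
    unfolding EE(2) by (rule trace_comm[of _ n n]) (use E in auto)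
  also have "P * ?E * ?E = P * ?E" using E EE(1) by (simp add: assoc_mult_mat[of _ n n _ n _ n] del: PE)
  also have "mat_trace (P * ?E) = 0" unfolding PE by (simp add: trace_minus[of _ n] tr)
  finally have "P * ?E = 0\<^sub>m n n" by (rule psd_kernel[OF P E])
  then have z: "P - P * mat_cpow M 0 = 0\<^sub>m n n" by (simp add: PE)
  show "P * mat_cpow M 0 = P"
  proof (rule eq_matI)
    fix i j assume ij: "i < dim_row P" "j < dim_col P"
    then have ij': "i < n" "j < n" using C(3) by auto
    have "(P - P * mat_cpow M 0) $$ (i, j) = 0" using z ij' by simp
    then show "(P * mat_cpow M 0) $$ (i, j) = P $$ (i, j)"
      using ij' carrier_matD[OF C(3)] carrier_matD[OF cpow_carrier[OF M]] by simp
  qed (use carrier_matD[OF C(3)] carrier_matD[OF cpow_carrier[OF M]] in auto)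
qed simp

subsection \<open>The rotated extension in one shot\<close>

lemma kron_one_square: "X \<in> carrier_mat a a \<Longrightarrow> kron X (1\<^sub>m b) \<in> carrier_mat (a * b) (a * b)"
  by auto

lemma kron_one_mult:
  "X \<in> carrier_mat a a \<Longrightarrow> Y \<in> carrier_mat a a \<Longrightarrow> kron X (1\<^sub>m b) * kron Y (1\<^sub>m b) = kron (X * Y) (1\<^sub>m b)"
  by (simp add: kron_mult[of _ a a _ a _ b b _ b])

lemma kron_minus_left:
  assumes A: "A \<in> carrier_mat a a'" and B: "B \<in> carrier_mat a a'" and C: "C \<in> carrier_mat c c'"
  shows "kron (A - B) C = kron A C - kron B C"
proof (rule eq_matI)
  fix i j assume "i < dim_row (kron A C - kron B C)" "j < dim_col (kron A C - kron B C)"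
  then have ij: "i < a * c" "j < a' * c'" using B C by auto
  have m: "A - B \<in> carrier_mat a a'" by (rule minus_carrier_mat[OF B])
  have "kron (A - B) C $$ (i, j) = (A $$ (i div c, j div c') - B $$ (i div c, j div c')) * C $$ (i mod c, j mod c')"
    using div_mod_less[OF ij(1)] div_mod_less[OF ij(2)] B by (simp add: kron_index[OF m C ij])
  also have "\<dots> = kron A C $$ (i, j) - kron B C $$ (i, j)"
    by (simp only: kron_index[OF A C ij] kron_index[OF B C ij] left_diff_distrib)
  also have "\<dots> = (kron A C - kron B C) $$ (i, j)" using ij B C by simp
  finally show "kron (A - B) C $$ (i, j) = (kron A C - kron B C) $$ (i, j)" .
qed (use A B in auto)

lemma cpow_kron_one: "positive_semidefinite a A \<Longrightarrow> mat_cpow (kron A (1\<^sub>m b)) z = kron (mat_cpow A z) (1\<^sub>m b)"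
  by (simp add: cpow_kron[OF _ psd_one] cpow_of_one)

text \<open>A single bipartite state suffices for all inequalities; the tensor structure enters only
  when P and s are taken to be n-fold states.\<close>

locale rotated_extension =
  fixes a b :: nat and P s :: "complex mat"
  assumes P: "positive_semidefinite (a * b) P" and tr_P: "mat_trace P = 1"
    and s: "positive_semidefinite a s" and tr_s: "mat_trace s = 1"
begin

abbreviation N where "N \<equiv> a * b"
definition r where "r = partial_trace a b P"
definition S where "S = kron s (1\<^sub>m b)"
definition R where "R = kron r (1\<^sub>m b)"
definition K where "K z = mat_cpow s (of_real (1/2) * z) * mat_cpow r (of_real (-1/2) * z)"
definition A where "A z = mat_cpow S (of_real (1/2) * z) * mat_cpow R (of_real (-1/2) * z)"
definition X where "X t = A (Complex 1 t) * P * dag (A (Complex 1 t))"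
definition \<tau> where "\<tau> = mat N N (\<lambda>(i, j). LINT t|lborel. of_real (beta0 t) * X t $$ (i, j))"

lemma r: "positive_semidefinite a r"
  unfolding r_def by (rule psd_partial_trace[OF P])

lemma tr_r: "mat_trace r = 1"
  unfolding r_def using trace_partial_trace[OF psd_carrier[OF P]] tr_P by simp

lemma S: "positive_semidefinite N S" and R: "positive_semidefinite N R"
  unfolding S_def R_def by (intro psd_kron psd_one s r)+

lemma carriers [simp]:
  "P \<in> carrier_mat N N" "s \<in> carrier_mat a a" "r \<in> carrier_mat a a" "S \<in> carrier_mat N N" "R \<in> carrier_mat N N"
  "mat_cpow s z \<in> carrier_mat a a" "mat_cpow r z \<in> carrier_mat a a" "mat_cpow S z \<in> carrier_mat N N"
  "mat_cpow R z \<in> carrier_mat N N" "mat_cpow P z \<in> carrier_mat N N" "\<tau> \<in> carrier_mat N N" "A z \<in> carrier_mat N N"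
  "K z \<in> carrier_mat a a" "X t \<in> carrier_mat N N"
  using P S R s r by (auto simp: psd_carrier \<tau>_def A_def K_def X_def cpow_carrier)

lemma A_eq: "A z = kron (K z) (1\<^sub>m b)"
  by (simp add: A_def K_def S_def R_def cpow_kron_one[OF s] cpow_kron_one[OF r] kron_one_mult[of _ a])

lemma X_psd: "positive_semidefinite N (X t)"
  unfolding X_def by (rule psd_congruence[OF P]) simp

text \<open>The adjoint in \<open>X t\<close> is antiholomorphic in z, but on Re z = 1 the conjugate
  of z/2 is 1 - z/2. There \<open>X t\<close> coincides with a holomorphic family, which settles
  measurability and integrability.\<close>

lemma X_good: "\<exists>F. good_mat N F \<and> (\<forall>t. X t = F (Complex 1 t))"
proof (intro exI conjI allI)
  let ?F = "\<lambda>z. A z * P * (mat_cpow R (-1) * mat_cpow R (of_real (1/2) * z) * (S * mat_cpow S (of_real (-1/2) * z)))"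
  show "good_mat N ?F"
    unfolding A_def
    by (intro good_mat_mult good_mat_const exp_family_good[OF exp_family_cpow[OF R]] exp_family_good[OF exp_family_cpow[OF S]] carriers)
  fix t
  let ?z = "Complex 1 t"
  have "dag (A ?z) = mat_cpow R (cnj (of_real (-1/2) * ?z)) * mat_cpow S (cnj (of_real (1/2) * ?z))"
    by (simp add: A_def dag_mult[of _ N N _ N] cpow_dag[OF R] cpow_dag[OF S])
  also have "cnj (of_real (-1/2) * ?z) = -1 + of_real (1/2) * ?z" by (simp add: complex_eq_iff)
  also have "mat_cpow R \<dots> = mat_cpow R (-1) * mat_cpow R (of_real (1/2) * ?z)" by (rule cpow_mult[OF R, symmetric])
  also have "cnj (of_real (1/2) * ?z) = 1 + of_real (-1/2) * ?z" by (simp add: complex_eq_iff)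
  also have "mat_cpow S \<dots> = S * mat_cpow S (of_real (-1/2) * ?z)"
    by (rule cpow_mult[OF S, of 1, unfolded cpow_one[OF S], symmetric])
  finally show "X t = ?F ?z" by (simp add: X_def)
qed

lemma X_functional:
  assumes C: "C \<in> carrier_mat n N" and D: "D \<in> carrier_mat N m" and ij: "i < n" "j < m"
  shows "integrable lborel (\<lambda>t. of_real (beta0 t) * (C * X t * D) $$ (i, j))"
    "(LINT t|lborel. of_real (beta0 t) * (C * X t * D) $$ (i, j)) = (C * \<tau> * D) $$ (i, j)"
proof -
  obtain F where F: "good_mat N F" "\<And>t. X t = F (Complex 1 t)" using X_good by blast
  have i: "integrable lborel (\<lambda>t. of_real (beta0 t) * X t $$ (k, l))" if "k < N" "l < N" for k l
    unfolding F(2) by (rule strip_bounded_integrable) (use F(1) that in \<open>auto simp: good_mat_def\<close>)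
  have e: "(C * Y * D) $$ (i, j) = (\<Sum>l<N. \<Sum>k<N. C $$ (i, k) * Y $$ (k, l) * D $$ (l, j))"
    if "Y \<in> carrier_mat N N" for Y
    using ij by (simp add: times_mat_index[OF mult_carrier_mat[OF C that] D ij] times_mat_index[OF C that] sum_distrib_right del: assoc_mult_mat)
  have e': "of_real (beta0 t) * (C * X t * D) $$ (i, j) = (\<Sum>l<N. \<Sum>k<N. C $$ (i, k) * (of_real (beta0 t) * X t $$ (k, l)) * D $$ (l, j))" for t
    by (simp add: e sum_distrib_left mult_ac)
  show "integrable lborel (\<lambda>t. of_real (beta0 t) * (C * X t * D) $$ (i, j))"
    unfolding e' by (intro Bochner_Integration.integrable_sum integrable_mult_left integrable_mult_right) (auto intro: i)
  have "(LINT t|lborel. of_real (beta0 t) * (C * X t * D) $$ (i, j))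
      = (\<Sum>l<N. LINT t|lborel. (\<Sum>k<N. C $$ (i, k) * (of_real (beta0 t) * X t $$ (k, l)) * D $$ (l, j)))"
    unfolding e' by (intro Bochner_Integration.integral_sum Bochner_Integration.integrable_sum integrable_mult_left integrable_mult_right) (auto intro: i)
  also have "\<dots> = (\<Sum>l<N. \<Sum>k<N. LINT t|lborel. C $$ (i, k) * (of_real (beta0 t) * X t $$ (k, l)) * D $$ (l, j))"
    by (intro sum.cong refl Bochner_Integration.integral_sum integrable_mult_left integrable_mult_right) (auto intro: i)
  also have "\<dots> = (\<Sum>l<N. \<Sum>k<N. C $$ (i, k) * (LINT t|lborel. of_real (beta0 t) * X t $$ (k, l)) * D $$ (l, j))"
    by (simp only: integral_mult_left_zero integral_mult_right_zero)
  also have "\<dots> = (C * \<tau> * D) $$ (i, j)"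
    by (simp add: e) (simp add: \<tau>_def)
  finally show "(LINT t|lborel. of_real (beta0 t) * (C * X t * D) $$ (i, j)) = (C * \<tau> * D) $$ (i, j)" .
qed

lemma X_trace_functional:
  assumes C: "C \<in> carrier_mat N N"
  shows "integrable lborel (\<lambda>t. of_real (beta0 t) * mat_trace (C * X t))"
    "(LINT t|lborel. of_real (beta0 t) * mat_trace (C * X t)) = mat_trace (C * \<tau>)"
proof -
  note f = X_functional[OF C one_carrier_mat]
  have e: "mat_trace (C * Y) = (\<Sum>i<N. (C * Y * 1\<^sub>m N) $$ (i, i))" if "Y \<in> carrier_mat N N" for Y
    using C that by (simp add: mat_trace_def)
  have e': "of_real (beta0 t) * mat_trace (C * X t) = (\<Sum>i<N. of_real (beta0 t) * (C * X t * 1\<^sub>m N) $$ (i, i))" for t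
    by (simp add: e sum_distrib_left)
  show "integrable lborel (\<lambda>t. of_real (beta0 t) * mat_trace (C * X t))"
    unfolding e' by (intro Bochner_Integration.integrable_sum) (auto intro: f)
  have "(LINT t|lborel. of_real (beta0 t) * mat_trace (C * X t)) = (\<Sum>i<N. LINT t|lborel. of_real (beta0 t) * (C * X t * 1\<^sub>m N) $$ (i, i))"
    unfolding e' by (rule Bochner_Integration.integral_sum) (auto intro: f)
  also have "\<dots> = mat_trace (C * \<tau>)" by (simp add: e f)
  finally show "(LINT t|lborel. of_real (beta0 t) * mat_trace (C * X t)) = mat_trace (C * \<tau>)" .
qed

lemma trace_beta0_mono:
  assumes C: "C \<in> carrier_mat N N" and le: "\<And>t. Re (mat_trace (C * X t)) \<le> c"
  shows "Re (mat_trace (C * \<tau>)) \<le> c"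
proof -
  note f = X_trace_functional[OF C]
  have "Re (mat_trace (C * \<tau>)) = (LINT t|lborel. Re (of_real (beta0 t) * mat_trace (C * X t)))"
    unfolding f(2)[symmetric] by (rule integral_Re[OF f(1), symmetric])
  also have "\<dots> \<le> (LINT t|lborel. beta0 t * c)"
  proof (rule integral_mono)
    show "integrable lborel (\<lambda>t. Re (of_real (beta0 t) * mat_trace (C * X t)))" by (rule integrable_Re[OF f(1)])
    show "integrable lborel (\<lambda>t. beta0 t * c)" using integrable_beta0 by simp
    show "Re (of_real (beta0 t) * mat_trace (C * X t)) \<le> beta0 t * c" for t
      using le[of t] beta0_pos[of t] by (simp add: mult_left_mono)
  qed
  also have "\<dots> = c" by (simp add: integral_beta0)
  finally show ?thesis .
qed

lemma \<tau>_psd: "positive_semidefinite N \<tau>"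
proof (rule psd_if_trace_nonneg)
  fix C assume C: "positive_semidefinite N C"
  note f = X_trace_functional[OF psd_carrier[OF C]]
  have p: "0 \<le> mat_trace (C * X t)" for t by (rule psd_trace_mult_nonneg[OF C X_psd])
  have "Re (mat_trace (C * \<tau>)) = (LINT t|lborel. Re (of_real (beta0 t) * mat_trace (C * X t)))"
    "Im (mat_trace (C * \<tau>)) = (LINT t|lborel. Im (of_real (beta0 t) * mat_trace (C * X t)))"
    unfolding f(2)[symmetric] integral_Re[OF f(1), symmetric] integral_Im[OF f(1), symmetric] by (rule refl)+
  moreover have "0 \<le> (LINT t|lborel. Re (of_real (beta0 t) * mat_trace (C * X t)))"
    using p beta0_pos by (intro Bochner_Integration.integral_nonneg) (auto simp: less_eq_complex_def less_imp_le)
  moreover have "(LINT t|lborel. Im (of_real (beta0 t) * mat_trace (C * X t))) = 0"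
    using p by (simp add: less_eq_complex_def)
  ultimately show "0 \<le> mat_trace (C * \<tau>)" by (simp add: less_eq_complex_def)
qed simp

lemma K_conj: "K (Complex 1 t) * r * dag (K (Complex 1 t))
    = mat_cpow s (of_real (1/2) * Complex 1 t) * mat_cpow r 0 * dag (mat_cpow s (of_real (1/2) * Complex 1 t))"
proof -
  let ?z = "Complex 1 t" and ?w = "of_real (-1/2) * Complex 1 t"
  have "mat_cpow r ?w * (r * dag (mat_cpow r ?w)) = mat_cpow r ?w * (mat_cpow r 1 * mat_cpow r (cnj ?w))"
    by (simp only: cpow_dag[OF r] cpow_one[OF r])
  also have "\<dots> = mat_cpow r (?w + (1 + cnj ?w))" by (simp only: cpow_mult[OF r])
  also have "?w + (1 + cnj ?w) = 0" by (simp add: complex_eq_iff)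
  finally have "mat_cpow r ?w * (r * dag (mat_cpow r ?w)) = mat_cpow r 0" .
  moreover have "mat_cpow r ?w * (r * (dag (mat_cpow r ?w) * Z)) = (mat_cpow r ?w * (r * dag (mat_cpow r ?w))) * Z" if "Z \<in> carrier_mat a a" for Z
    using that by (simp add: square_assoc[of _ a])
  ultimately have m: "mat_cpow r ?w * (r * (dag (mat_cpow r ?w) * Z)) = mat_cpow r 0 * Z" if "Z \<in> carrier_mat a a" for Z
    using that by simp
  show ?thesis unfolding K_def using m by (simp add: dag_mult[of _ a a _ a] square_assoc[of _ a])
qed

lemma s_half: "mat_cpow s (of_real (1/2) * Complex 1 t) * dag (mat_cpow s (of_real (1/2) * Complex 1 t)) = s"
proof -
  have "of_real (1/2) * Complex 1 t + cnj (of_real (1/2) * Complex 1 t) = 1" by (simp add: complex_eq_iff)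
  then show ?thesis by (simp only: cpow_dag[OF s] cpow_mult[OF s] cpow_one[OF s])
qed

text \<open>\<open>X t\<close> arises from P by operators on A alone, so its A-marginal depends on P
  only through r.\<close>

lemma trace_marginal_X:
  assumes C: "C \<in> carrier_mat a a"
  shows "mat_trace (kron C (1\<^sub>m b) * X t) = mat_trace (C * (K (Complex 1 t) * r * dag (K (Complex 1 t))))"
proof -
  let ?K = "K (Complex 1 t)"
  have "kron C (1\<^sub>m b) * X t = (kron (C * ?K) (1\<^sub>m b) * P) * kron (dag ?K) (1\<^sub>m b)"
    unfolding X_def A_eq kron_dag dag_one using C
    by (simp add: kron_one_mult[of _ a, symmetric] kron_one_square square_assoc[of _ N])
  then have "mat_trace (kron C (1\<^sub>m b) * X t) = mat_trace (kron (dag ?K) (1\<^sub>m b) * (kron (C * ?K) (1\<^sub>m b) * P))"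
    using C by (simp only:) (rule trace_comm[of _ N N]; auto intro!: kron_one_square)
  also have "\<dots> = mat_trace (kron (dag ?K * (C * ?K)) (1\<^sub>m b) * P)"
    using C by (simp add: kron_one_mult[of _ a, symmetric] kron_one_square square_assoc[of _ N])
  also have "\<dots> = mat_trace (P * kron (dag ?K * (C * ?K)) (1\<^sub>m b))"
    using C by (intro trace_comm[of _ N N]) (auto intro!: kron_one_square)
  also have "\<dots> = mat_trace (r * (dag ?K * (C * ?K)))"
    unfolding r_def using C by (intro trace_kron_one) auto
  also have "\<dots> = mat_trace ((r * dag ?K) * (C * ?K))"
    using C by (simp add: square_assoc[of _ a])
  also have "\<dots> = mat_trace ((C * ?K) * (r * dag ?K))"
    using C by (intro trace_comm[of _ a a]) auto
  also have "\<dots> = mat_trace (C * (?K * r * dag ?K))" using C by (simp add: square_assoc[of _ a])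
  finally show ?thesis .
qed

lemma trace_marginal:
  assumes C: "C \<in> carrier_mat a a"
  shows "mat_trace (kron C (1\<^sub>m b) * \<tau>) = mat_trace (C * partial_trace a b \<tau>)"
proof -
  have "mat_trace (kron C (1\<^sub>m b) * \<tau>) = mat_trace (\<tau> * kron C (1\<^sub>m b))"
    using C by (intro trace_comm[of _ N N]) (auto intro!: kron_one_square)
  also have "\<dots> = mat_trace (partial_trace a b \<tau> * C)" using C by (intro trace_kron_one) auto
  also have "\<dots> = mat_trace (C * partial_trace a b \<tau>)" using C by (intro trace_comm[of _ a a]) auto
  finally show ?thesis .
qed

text \<open>The A-marginal of \<open>X t\<close> is the sandwich of the projection r^0 by s^(z/2).
  Weight of s outside the support of r is lost, so in general only an inequality survives.\<close>

lemma marginal_le: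
  assumes C: "positive_semidefinite a C"
  shows "Re (mat_trace (kron C (1\<^sub>m b) * \<tau>)) \<le> Re (mat_trace (C * s))"
proof (rule trace_beta0_mono)
  fix t
  have "Re (mat_trace (kron C (1\<^sub>m b) * X t)) \<le> Re (mat_trace (C * (mat_cpow s (of_real (1/2) * Complex 1 t) * dag (mat_cpow s (of_real (1/2) * Complex 1 t)))))"
    unfolding trace_marginal_X[OF psd_carrier[OF C]] K_conj
    by (rule trace_sandwich_le[OF C]) (use cpow_zero_projection[OF r] in auto)
  then show "Re (mat_trace (kron C (1\<^sub>m b) * X t)) \<le> Re (mat_trace (C * s))" by (simp only: s_half)
qed (use psd_carrier[OF C] in \<open>auto intro!: kron_one_square\<close>)

lemma trace_\<tau>_le: "Re (mat_trace \<tau>) \<le> 1"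
  using marginal_le[OF psd_one] tr_s by (simp add: kron_one)

text \<open>With s supported in r, the powers of s absorb r^0. Then every \<open>X t\<close>, and
  not only the average, has marginal s.\<close>

lemma marginal_eq:
  assumes supp: "s * mat_cpow r 0 = s"
  shows "partial_trace a b \<tau> = s"
proof (rule trace_eq_imp_eq[OF partial_trace_carrier carriers(2)])
  fix C :: "complex mat" assume C: "C \<in> carrier_mat a a"
  have sr: "mat_cpow s z * mat_cpow r 0 = mat_cpow s z" for z
  proof -
    have e: "mat_cpow s z = mat_cpow s (z - 1) * s"
      using cpow_mult[OF s, of "z - 1" 1] by (simp add: cpow_one[OF s])
    have "mat_cpow s z * mat_cpow r 0 = mat_cpow s (z - 1) * (s * mat_cpow r 0)"
      unfolding e by (rule assoc_mult_mat[of _ a a _ a _ a]) auto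
    then show ?thesis unfolding supp e[symmetric] .
  qed
  have "mat_trace (kron C (1\<^sub>m b) * X t) = mat_trace (C * s)" for t
    unfolding trace_marginal_X[OF C] K_conj sr s_half ..
  then have "mat_trace (kron C (1\<^sub>m b) * \<tau>) = (LINT t|lborel. of_real (beta0 t) * mat_trace (C * s))"
    using X_trace_functional(2)[OF kron_one_square[OF C, of b]] by simp
  also have "\<dots> = (LINT t|lborel. complex_of_real (beta0 t)) * mat_trace (C * s)"
    by (rule integral_mult_left_zero)
  also have "(LINT t|lborel. complex_of_real (beta0 t)) = 1"
    using integral_beta0 by simp
  finally show "mat_trace (C * partial_trace a b \<tau>) = mat_trace (C * s)"
    by (simp add: trace_marginal[OF C])
qed

text \<open>By \<open>marginal_le\<close>, \<tau> puts no weight on the complement of the support of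
  S, so \<tau> annihilates it, and so does any P supported in \<tau>.\<close>

lemma support_\<tau>_imp_S:
  assumes "P * mat_cpow \<tau> 0 = P"
  shows "P * mat_cpow S 0 = P"
proof -
  let ?Q = "mat_cpow S 0" and ?q = "mat_cpow s 0"
  let ?E = "1\<^sub>m N - ?Q" and ?e = "1\<^sub>m a - ?q"
  have Q: "?Q = kron ?q (1\<^sub>m b)" unfolding S_def by (rule cpow_kron_one[OF s])
  have E: "?E \<in> carrier_mat N N" and e: "?e \<in> carrier_mat a a" by (auto intro!: minus_carrier_mat)
  have EE: "?E * ?E = ?E" "dag ?E = ?E"
    by (simp_all add: complement_idempotent cpow_zero_projection[OF S] dag_minus[of _ N N])
  have ek: "kron ?e (1\<^sub>m b) = ?E"
    unfolding Q kron_one[of a b, symmetric] by (rule kron_minus_left[of _ a a _ _ b b]) auto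
  have "Re (mat_trace (?E * \<tau>)) \<le> Re (mat_trace (?e * s))"
    unfolding ek[symmetric] by (rule marginal_le) (rule cpow_zero_projection[OF s])
  also have "?e * s = 0\<^sub>m a a"
    by (simp add: minus_mult_distrib_mat[of _ a a _ _ a] cpow_zero_mult[OF s])
  finally have "Re (mat_trace (?E * \<tau>)) \<le> 0" by (simp add: mat_trace_def)
  moreover have "0 \<le> mat_trace (?E * \<tau>)"
    by (rule psd_trace_mult_nonneg[OF cpow_zero_projection(4)[OF S] \<tau>_psd])
  ultimately have 0: "mat_trace (?E * \<tau>) = 0" by (simp add: complex_eq_iff less_eq_complex_def)
  have "mat_trace (dag ?E * (\<tau> * ?E)) = mat_trace ((\<tau> * ?E) * ?E)"
    unfolding EE(2) by (rule trace_comm[of _ N N]) (use E in auto)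
  also have "(\<tau> * ?E) * ?E = \<tau> * (?E * ?E)" by (rule assoc_mult_mat[of _ N N _ N _ N]) (use E in auto)
  also have "mat_trace (\<tau> * (?E * ?E)) = mat_trace (?E * \<tau>)"
    unfolding EE(1) by (rule trace_comm[of _ N N]) (use E in auto)
  finally have \<tau>E: "\<tau> * ?E = 0\<^sub>m N N" by (intro psd_kernel[OF \<tau>_psd E]) (simp add: 0)
  have c\<tau>: "mat_cpow \<tau> z \<in> carrier_mat N N" for z by (rule cpow_carrier[OF \<tau>_psd])
  have "P * ?E = (P * (mat_cpow \<tau> (-1) * \<tau>)) * ?E"
    using assms by (simp add: cpow_minus_one_mult[OF \<tau>_psd])
  also have "\<dots> = P * (mat_cpow \<tau> (-1) * (\<tau> * ?E))"
    using E c\<tau> by (simp add: square_assoc[of _ N])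
  also have "\<dots> = 0\<^sub>m N N" unfolding \<tau>E by (simp add: right_mult_zero_mat[OF c\<tau>] right_mult_zero_mat[of P N N])
  finally have "P - P * ?Q = 0\<^sub>m N N" by (simp add: mult_minus_distrib_mat[of _ N N _ N])
  then have "mat_trace (P - P * ?Q) = 0" by (simp add: mat_trace_def)
  then have "mat_trace (P * ?Q) = mat_trace P" by (simp add: trace_minus[of _ N])
  then show ?thesis by (simp add: trace_cpow_zero_iff[OF S P])
qed

text \<open>
  Exact data-processing: the trace inequality is applied to
  \<open>R\<^sup>z\<^sup>/\<^sup>2 S\<^sup>-\<^sup>z\<^sup>/\<^sup>2 \<tau>\<^sup>z\<^sup>/\<^sup>2 P\<^sup>-\<^sup>z\<^sup>/\<^sup>2\<close>, for which the right-hand side is at most \<open>ln 1\<close>.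
\<close>

lemma data_processing:
  assumes P\<tau>: "P * mat_cpow \<tau> 0 = P" and PS: "P * mat_cpow S 0 = P" and PR: "P * mat_cpow R 0 = P"
  shows "Re (mat_trace (P * mat_log R)) - Re (mat_trace (P * mat_log S))
    \<le> Re (mat_trace (P * mat_log P)) - Re (mat_trace (P * mat_log \<tau>))"
proof -
  let ?F1 = "\<lambda>z. mat_cpow R (of_real (1/2) * z)" and ?F2 = "\<lambda>z. mat_cpow S (of_real (-1/2) * z)"
    and ?F3 = "\<lambda>z. mat_cpow \<tau> (of_real (1/2) * z)" and ?F4 = "\<lambda>z. mat_cpow P (of_real (-1/2) * z)"
  note [simp] = cpow_carrier[OF \<tau>_psd]
  have "2 * Re (of_real (1/2) * mat_trace (P * mat_log R) + of_real (-1/2) * mat_trace (P * mat_log S)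
      + of_real (1/2) * mat_trace (P * mat_log \<tau>) + of_real (-1/2) * mat_trace (P * mat_log P)) \<le> ln 1"
  proof (rule multivariate_trace_bound[OF P tr_P, where u = "\<lambda>_. 1"])
    show "exp_family N ?F1" "exp_family N ?F2" "exp_family N ?F3" "exp_family N ?F4"
      by (intro exp_family_cpow R S P \<tau>_psd)+
    show "state_family N P ?F1 (of_real (1/2) * mat_trace (P * mat_log R))"
      "state_family N P ?F2 (of_real (-1/2) * mat_trace (P * mat_log S))"
      "state_family N P ?F3 (of_real (1/2) * mat_trace (P * mat_log \<tau>))"
      "state_family N P ?F4 (of_real (-1/2) * mat_trace (P * mat_log P))"
      by (intro state_family_cpow R S P \<tau>_psd P\<tau> PS PR cpow_zero_mult(2)[OF P])+
    show "integrable lborel (\<lambda>t. beta0 t * 1)" "(LINT t|lborel. beta0 t * 1) \<le> 1"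
      using integrable_beta0 integral_beta0 by auto
    fix t z assume z: "z = Complex 1 t"
    have half: "of_real (1/2) * z + cnj (of_real (1/2) * z) = 1" "of_real (-1/2) * z + (1 + cnj (of_real (-1/2) * z)) = 0"
      by (simp_all add: z complex_eq_iff)
    have "?F4 z * P * dag (?F4 z) = mat_cpow P (of_real (-1/2) * z) * (mat_cpow P 1 * mat_cpow P (cnj (of_real (-1/2) * z)))"
      by (simp only: cpow_dag[OF P] cpow_one[OF P]) (rule assoc_mult_mat[of _ N N _ N _ N]; auto)
    also have "\<dots> = mat_cpow P 0" by (simp only: cpow_mult[OF P] half)
    finally have F4: "?F4 z * P * dag (?F4 z) = mat_cpow P 0" .
    have F3: "?F3 z * dag (?F3 z) = \<tau>" by (simp only: cpow_dag[OF \<tau>_psd] cpow_mult[OF \<tau>_psd] cpow_one[OF \<tau>_psd] half)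
    \<comment> \<open>The two outer factors form h on A. By cyclicity only the A-marginal of \<tau>
      enters, which is at most s; then s^(-z/2) s s^(-z/2) with the second exponent conjugated is
      the projection s^0, and dropping it leaves tr r = 1.\<close>
    define h where "h = mat_cpow r (of_real (1/2) * z) * mat_cpow s (of_real (-1/2) * z)"
    have h: "h \<in> carrier_mat a a" by (simp add: h_def)
    have F12: "?F1 z * ?F2 z = kron h (1\<^sub>m b)"
      by (simp add: S_def R_def h_def cpow_kron_one[OF s] cpow_kron_one[OF r] kron_one_mult[of _ a])
    let ?Y = "?F3 z * mat_cpow P 0 * dag (?F3 z)"
    have "?F1 z * (?F2 z * ?Y * dag (?F2 z)) * dag (?F1 z) = (?F1 z * ?F2 z * ?Y) * dag (?F1 z * ?F2 z)"
      by (simp add: dag_mult[of _ N N _ N] square_assoc[of _ N])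
    also have "mat_trace \<dots> = mat_trace (dag (kron h (1\<^sub>m b)) * (kron h (1\<^sub>m b) * ?Y))"
      unfolding F12 by (rule trace_comm[of _ N N]) (use h in \<open>auto intro!: kron_one_square\<close>)
    also have "\<dots> = mat_trace (kron (dag h * h) (1\<^sub>m b) * ?Y)"
      using h by (simp add: kron_dag kron_one_mult[of _ a, symmetric] kron_one_square square_assoc[of _ N])
    finally have eq: "mat_trace (?F1 z * (?F2 z * ?Y * dag (?F2 z)) * dag (?F1 z)) = mat_trace (kron (dag h * h) (1\<^sub>m b) * ?Y)" .
    have hh: "positive_semidefinite a (dag h * h)" using psd_mult_dag[of "dag h" a a] h by simp
    have "Re (mat_trace (kron (dag h * h) (1\<^sub>m b) * ?Y)) \<le> Re (mat_trace (kron (dag h * h) (1\<^sub>m b) * (?F3 z * dag (?F3 z))))"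
      by (rule trace_sandwich_le) (use cpow_zero_projection[OF P] in \<open>auto intro!: psd_kron psd_one hh\<close>)
    also have "\<dots> \<le> Re (mat_trace ((dag h * h) * s))" unfolding F3 by (rule marginal_le[OF hh])
    also have "mat_trace ((dag h * h) * s) = mat_trace (dag h * (h * s))" using h by (simp add: square_assoc[of _ a])
    also have "\<dots> = mat_trace ((h * s) * dag h)" by (rule trace_comm[of _ a a]) (use h in auto)
    also have "(h * s) * dag h = mat_cpow r (of_real (1/2) * z) * (mat_cpow s (of_real (-1/2) * z) * s * dag (mat_cpow s (of_real (-1/2) * z))) * dag (mat_cpow r (of_real (1/2) * z))"
      unfolding h_def by (simp add: dag_mult[of _ a a _ a] square_assoc[of _ a])
    also have "mat_cpow s (of_real (-1/2) * z) * s * dag (mat_cpow s (of_real (-1/2) * z)) = mat_cpow s (of_real (-1/2) * z) * (mat_cpow s 1 * mat_cpow s (cnj (of_real (-1/2) * z)))"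
      by (simp only: cpow_dag[OF s] cpow_one[OF s]) (rule assoc_mult_mat[of _ a a _ a _ a]; auto)
    also have "\<dots> = mat_cpow s 0" by (simp only: cpow_mult[OF s] half)
    also have "Re (mat_trace (mat_cpow r (of_real (1/2) * z) * mat_cpow s 0 * dag (mat_cpow r (of_real (1/2) * z))))
        \<le> Re (mat_trace (mat_cpow r (of_real (1/2) * z) * dag (mat_cpow r (of_real (1/2) * z))))"
      using trace_sandwich_le[OF psd_one, of "mat_cpow r (of_real (1/2) * z)" a "mat_cpow s 0"] cpow_zero_projection[OF s] by simp
    also have "mat_cpow r (of_real (1/2) * z) * dag (mat_cpow r (of_real (1/2) * z)) = r"
      by (simp only: cpow_dag[OF r] cpow_mult[OF r] cpow_one[OF r] half)
    finally show "Re (mat_trace (?F1 z * (?F2 z * (?F3 z * (?F4 z * P * dag (?F4 z)) * dag (?F3 z)) * dag (?F2 z)) * dag (?F1 z))) \<le> 1"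
      unfolding F4 eq by (simp add: tr_r)
  qed simp
  then show ?thesis by simp
qed

end

subsection \<open>Weighted pinching\<close>

text \<open>Weighted Cauchy-Schwarz for a positive form q: with F_k the restriction of f to the
  level set k of \<kappa>, q(sum of F_k) is at most (sum of w_k) times (sum of q(F_k) / w_k). Equal
  weights give the usual pinching inequality with the number of levels as factor; summable weights
  replace that number by their sum.\<close>

lemma weighted_pinching:
  fixes B :: "nat \<Rightarrow> nat \<Rightarrow> complex" and \<kappa> :: "nat \<Rightarrow> nat" and w :: "nat \<Rightarrow> real"
  assumes pos: "\<And>f. 0 \<le> Re (\<Sum>i<n. \<Sum>j<n. B i j * f i * cnj (f j))" and w: "\<And>k. 0 < w k"
  defines "K \<equiv> \<kappa> ` {..<n}"
  shows "Re (\<Sum>i<n. \<Sum>j<n. B i j * f i * cnj (f j)) \<le> (\<Sum>k\<in>K. w k) * (\<Sum>k\<in>K. 1 / w k *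
     Re (\<Sum>i<n. \<Sum>j<n. B i j * (if \<kappa> i = k then f i else 0) * cnj (if \<kappa> j = k then f j else 0)))"
proof -
  define Q where "Q = (\<lambda>f g. \<Sum>i<n. \<Sum>j<n. B i j * f i * cnj (g j))"
  define F where "F = (\<lambda>k i. if \<kappa> i = k then f i else 0)"
  have fin: "finite K" by (simp add: K_def)
  have lin1: "Q (\<lambda>i. \<Sum>k\<in>K. F k i) g = (\<Sum>k\<in>K. Q (F k) g)" for g
  proof -
    have "Q (\<lambda>i. \<Sum>k\<in>K. F k i) g = (\<Sum>i<n. \<Sum>j<n. \<Sum>k\<in>K. B i j * F k i * cnj (g j))"
      by (simp add: Q_def sum_distrib_left sum_distrib_right)
    also have "\<dots> = (\<Sum>i<n. \<Sum>k\<in>K. \<Sum>j<n. B i j * F k i * cnj (g j))"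
      by (rule sum.cong[OF refl], rule sum.swap)
    also have "\<dots> = (\<Sum>k\<in>K. Q (F k) g)" unfolding Q_def by (rule sum.swap)
    finally show ?thesis .
  qed
  have lin2: "Q g (\<lambda>i. \<Sum>k\<in>K. F k i) = (\<Sum>k\<in>K. Q g (F k))" for g
  proof -
    have "Q g (\<lambda>i. \<Sum>k\<in>K. F k i) = (\<Sum>i<n. \<Sum>j<n. \<Sum>k\<in>K. B i j * g i * cnj (F k j))"
      by (simp add: Q_def sum_distrib_left)
    also have "\<dots> = (\<Sum>i<n. \<Sum>k\<in>K. \<Sum>j<n. B i j * g i * cnj (F k j))"
      by (rule sum.cong[OF refl], rule sum.swap)
    also have "\<dots> = (\<Sum>k\<in>K. Q g (F k))" unfolding Q_def by (rule sum.swap)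
    finally show ?thesis .
  qed
  have "(\<Sum>k\<in>K. F k i) = f i" if "i < n" for i
    using that fin by (simp add: F_def K_def)
  then have "Q f f = Q (\<lambda>i. \<Sum>k\<in>K. F k i) (\<lambda>i. \<Sum>k\<in>K. F k i)"
    by (simp add: Q_def)
  then have Qff: "Q f f = (\<Sum>k\<in>K. \<Sum>l\<in>K. Q (F k) (F l))" unfolding lin1 lin2 .
  have pair: "Re (Q (F k) (F l)) + Re (Q (F l) (F k)) \<le> w l / w k * Re (Q (F k) (F k)) + w k / w l * Re (Q (F l) (F l))" for k l
  proof -
    \<comment> \<open>Since p q = 1, expanding the nonnegative value of the form at p F_k - q F_l
      leaves the cross terms with coefficient 1.\<close>
    define p where "p = sqrt (w l / w k)"
    define q where "q = sqrt (w k / w l)"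
    have pq: "p * q = 1" "p * p = w l / w k" "q * q = w k / w l"
      using w[of k] w[of l] by (simp_all add: p_def q_def real_sqrt_mult[symmetric])
    define h where "h = (\<lambda>i. of_real p * F k i - of_real q * F l i)"
    have "Q h h = of_real (p * p) * Q (F k) (F k) - of_real (p * q) * Q (F k) (F l) - of_real (p * q) * Q (F l) (F k) + of_real (q * q) * Q (F l) (F l)"
      unfolding Q_def h_def sum_distrib_left sum_subtractf[symmetric] sum.distrib[symmetric]
      by (intro sum.cong refl) (simp add: algebra_simps)
    moreover have "0 \<le> Re (Q h h)" unfolding Q_def by (rule pos)
    ultimately show ?thesis unfolding pq by simp
  qed
  have "2 * Re (Q f f) = (\<Sum>k\<in>K. \<Sum>l\<in>K. Re (Q (F k) (F l))) + (\<Sum>k\<in>K. \<Sum>l\<in>K. Re (Q (F l) (F k)))"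
    by (subst (2) sum.swap) (simp add: Qff)
  also have "\<dots> \<le> (\<Sum>k\<in>K. \<Sum>l\<in>K. w l / w k * Re (Q (F k) (F k)) + w k / w l * Re (Q (F l) (F l)))"
    unfolding sum.distrib[symmetric] by (intro sum_mono pair)
  also have "\<dots> = (\<Sum>k\<in>K. \<Sum>l\<in>K. w l * (1 / w k * Re (Q (F k) (F k)))) + (\<Sum>k\<in>K. \<Sum>l\<in>K. w k * (1 / w l * Re (Q (F l) (F l))))"
    by (simp add: sum.distrib)
  also have "(\<Sum>k\<in>K. \<Sum>l\<in>K. w l * (1 / w k * Re (Q (F k) (F k)))) = (\<Sum>k\<in>K. w k) * (\<Sum>k\<in>K. 1 / w k * Re (Q (F k) (F k)))"
    by (subst sum.swap) (simp only: sum_product)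
  also have "(\<Sum>k\<in>K. \<Sum>l\<in>K. w k * (1 / w l * Re (Q (F l) (F l)))) = (\<Sum>k\<in>K. w k) * (\<Sum>k\<in>K. 1 / w k * Re (Q (F k) (F k)))"
    by (simp only: sum_product)
  finally show ?thesis by (simp add: Q_def F_def)
qed

section \<open>The trace inequality with pinched phases\<close>

context rotated_extension
begin

text \<open>
  The trace inequality is applied to
  \<open>P\<^sup>z\<^sup>/\<^sup>2 f(\<tau>)\<^sup>-\<^sup>z\<^sup>/\<^sup>2 S\<^sup>z\<^sup>/\<^sup>2 R\<^sup>-\<^sup>z\<^sup>/\<^sup>2\<close> with \<open>f (x) = exp (- 2 \<alpha> (\<kappa> x))\<close>.  If
  \<open>\<tau>\<close> itself stood in place of \<open>f(\<tau>)\<close>, the phases \<open>\<tau>\<^sup>i\<^sup>t\<close> would not be under control; those of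
  \<open>f(\<tau>)\<close> are constant on each level set of \<open>\<kappa>\<close> and are removed by weighted pinching.
\<close>

lemma pinched_bound:
  fixes \<kappa> :: "real \<Rightarrow> nat" and \<alpha> w :: "nat \<Rightarrow> real"
  assumes PS: "P * mat_cpow S 0 = P" and PR: "P * mat_cpow R 0 = P"
    and w: "\<And>k. 0 < w k" and W: "\<And>K. finite K \<Longrightarrow> sum w K \<le> W" and W0: "0 < W"
    and bound: "\<And>x. 0 \<le> x \<Longrightarrow> x \<le> 1 \<Longrightarrow> x * exp (2 * \<alpha> (\<kappa> x)) \<le> w (\<kappa> x)"
  shows "Re (mat_trace (P * mat_log P)) + 2 * Re (mat_trace (P * mat_fun (\<lambda>x. of_real (\<alpha> (\<kappa> x))) \<tau>))
    + Re (mat_trace (P * mat_log S)) - Re (mat_trace (P * mat_log R)) \<le> ln W"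
proof (rule psd_spectral[OF \<tau>_psd])
  fix U l assume sp: "spectral N \<tau> U l" and l0: "\<And>i. 0 \<le> l i"
  note U = spectralD[OF sp] note [simp] = U(1)
  have tr_l: "mat_trace \<tau> = (\<Sum>i<N. of_real (l i))"
  proof -
    have "mat_trace \<tau> = mat_trace (1\<^sub>m N * mat_fun complex_of_real \<tau>)" by (simp add: mat_fun_of_real[OF \<tau>_psd])
    also have "\<dots> = (\<Sum>i<N. of_real (l i))"
      by (subst trace_mat_fun_spectral[OF sp]) (simp_all add: U(3))
    finally show ?thesis .
  qed
  \<comment> \<open>\<open>bound\<close> concerns the unit interval only; the eigenvalues lie in it
    because tr \<tau> \<le> 1.\<close>
  have l1: "l i \<le> 1" if "i < N" for i
  proof -
    have "l i \<le> (\<Sum>i<N. l i)" by (rule member_le_sum) (use that l0 in auto)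
    then show ?thesis using trace_\<tau>_le by (simp add: tr_l)
  qed
  define k' where "k' = (\<lambda>i. \<kappa> (l i))"
  define K' where "K' = k' ` {..<N}"
  define P' where "P' = dag U * P * U"
  define X' where "X' = (\<lambda>t. dag U * X t * U)"
  have [simp]: "P' \<in> carrier_mat N N" "X' t \<in> carrier_mat N N" for t by (simp_all add: P'_def X'_def)
  have P'_nonneg: "0 \<le> Re (P' $$ (i, i))" if "i < N" for i
    using psd_diagonal[OF psd_congruence[OF P, of "dag U"] that] by (simp add: P'_def less_eq_complex_def)
  have P'_sum: "(\<Sum>i<N. Re (P' $$ (i, i))) = 1"
  proof -
    have "mat_trace P' = mat_trace (U * (dag U * P))" unfolding P'_def by (rule trace_comm[of _ N N, symmetric]) auto
    also have "U * (dag U * P) = P" by (rule mult_cancel_inverse[of _ N]) (use U in auto)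
    finally have "mat_trace P' = 1" using tr_P by simp
    then have "Re (mat_trace P') = 1" by simp
    then show ?thesis using carrier_matD[of P' N N] by (simp add: mat_trace_def)
  qed
  \<comment> \<open>In the eigenbasis of \<tau> the trace becomes a quadratic form in the diagonal
    d, with coefficients the entrywise product of X' and the transpose of P'.\<close>
  define B where "B = (\<lambda>t i j. P' $$ (j, i) * X' t $$ (i, j))"
  have expand: "mat_trace (P * (U * mat_diag N d * dag U * X t * dag (U * mat_diag N d * dag U)))
      = (\<Sum>i<N. \<Sum>j<N. B t i j * d i * cnj (d j))" for d t
  proof -
    let ?D = "mat_diag N d" and ?D' = "mat_diag N (\<lambda>i. cnj (d i))"
    have DX: "?D * X' t * ?D' \<in> carrier_mat N N" by simp
    have "P * (U * ?D * dag U * X t * dag (U * ?D * dag U)) = (P * U) * ((?D * X' t * ?D') * dag U)"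
      by (simp add: X'_def dag_mult[of _ N N _ N] square_assoc[of _ N])
    also have "mat_trace \<dots> = mat_trace (((?D * X' t * ?D') * dag U) * (P * U))"
      by (rule trace_comm[of _ N N]) auto
    also have "\<dots> = mat_trace ((?D * X' t * ?D') * P')"
      by (simp add: P'_def square_assoc[of _ N])
    also have "\<dots> = (\<Sum>i<N. \<Sum>j<N. (?D * X' t * ?D') $$ (i, j) * P' $$ (j, i))"
      by (rule trace_mult[OF DX]) simp
    also have "\<dots> = (\<Sum>i<N. \<Sum>j<N. B t i j * d i * cnj (d j))"
      by (intro sum.cong refl) (auto simp: mat_diag_mult_left[of "X' t" N N] mat_diag_mult_right[of _ N N] B_def mult_ac)
    finally show ?thesis .
  qed
  have B_pos: "0 \<le> Re (\<Sum>i<N. \<Sum>j<N. B t i j * d i * cnj (d j))" for d t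
  proof -
    have "0 \<le> mat_trace (P * (U * mat_diag N d * dag U * X t * dag (U * mat_diag N d * dag U)))"
      by (rule psd_trace_mult_nonneg[OF P psd_congruence[OF X_psd]]) simp
    then show ?thesis unfolding expand by (simp add: less_eq_complex_def)
  qed
  define c where "c = (\<lambda>k. exp (2 * \<alpha> k) / w k)"
  have c0: "0 \<le> c k" for k using w[of k] by (simp add: c_def)
  define u where "u = (\<lambda>t. W * (\<Sum>k\<in>K'. c k * Re (\<Sum>i<N. \<Sum>j<N. if k' i = k \<and> k' j = k then B t i j else 0)))"
  let ?F1 = "\<lambda>z. mat_cpow P (of_real (1/2) * z)" and ?F2 = "\<lambda>z. mat_fun (\<lambda>x. 1 * exp (complex_of_real (\<alpha> (\<kappa> x)) * z)) \<tau>"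
    and ?F3 = "\<lambda>z. mat_cpow S (of_real (1/2) * z)" and ?F4 = "\<lambda>z. mat_cpow R (of_real (-1/2) * z)"
  note [simp] = mat_fun_carrier[OF \<tau>_psd]
  have "2 * Re (of_real (1/2) * mat_trace (P * mat_log P) + mat_trace (P * mat_fun (\<lambda>x. 1 * of_real (\<alpha> (\<kappa> x))) \<tau>)
      + of_real (1/2) * mat_trace (P * mat_log S) + of_real (-1/2) * mat_trace (P * mat_log R)) \<le> ln W"
  proof (rule multivariate_trace_bound[OF P tr_P, where u = u])
    show "exp_family N ?F1" by (rule exp_family_cpow[OF P])
    show "exp_family N ?F2" by (rule exp_family_mat_fun[OF \<tau>_psd]) simp
    show "exp_family N ?F3" by (rule exp_family_cpow[OF S])
    show "exp_family N ?F4" by (rule exp_family_cpow[OF R])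
    show "state_family N P ?F1 (of_real (1/2) * mat_trace (P * mat_log P))"
      by (rule state_family_cpow[OF P P cpow_zero_mult(2)[OF P]])
    show "state_family N P ?F2 (mat_trace (P * mat_fun (\<lambda>x. 1 * of_real (\<alpha> (\<kappa> x))) \<tau>))"
      by (rule state_family_mat_fun[OF \<tau>_psd P]) (simp_all add: mat_fun_one[OF \<tau>_psd])
    show "state_family N P ?F3 (of_real (1/2) * mat_trace (P * mat_log S))"
      by (rule state_family_cpow[OF S P PS])
    show "state_family N P ?F4 (of_real (-1/2) * mat_trace (P * mat_log R))"
      by (rule state_family_cpow[OF R P PR])
    show "0 < W" by (rule W0)
  next
    fix t z assume z: "z = Complex 1 t"
    define d where "d = (\<lambda>i. exp (complex_of_real (\<alpha> (k' i)) * z))"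
    have F2: "?F2 z = U * mat_diag N d * dag U"
      unfolding mat_fun_spectral[OF sp] by (simp add: d_def k'_def)
    have X: "?F3 z * (?F4 z * P * dag (?F4 z)) * dag (?F3 z) = X t"
      by (simp add: X_def A_def z dag_mult[of _ N N _ N] square_assoc[of _ N])
    let ?Y = "?F2 z * X t * dag (?F2 z)"
    have "mat_trace (?F1 z * ?Y * dag (?F1 z)) = mat_trace (dag (?F1 z) * (?F1 z * ?Y))"
      by (rule trace_comm[of _ N N]) auto
    also have "dag (?F1 z) * (?F1 z * ?Y) = (dag (?F1 z) * ?F1 z) * ?Y"
      by (rule assoc_mult_mat[of _ N N _ N _ N, symmetric]) auto
    also have "dag (?F1 z) * ?F1 z = P"
    proof -
      have "cnj (of_real (1/2) * z) + of_real (1/2) * z = 1" by (simp add: z complex_eq_iff)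
      then show ?thesis by (simp only: cpow_dag[OF P] cpow_mult[OF P] cpow_one[OF P])
    qed
    also have "mat_trace (P * ?Y) = (\<Sum>i<N. \<Sum>j<N. B t i j * d i * cnj (d j))"
      unfolding F2 by (rule expand)
    finally have eq: "mat_trace (?F1 z * ?Y * dag (?F1 z)) = (\<Sum>i<N. \<Sum>j<N. B t i j * d i * cnj (d j))" .
    \<comment> \<open>Within a level the phases cancel and |d i|^2 is exp(2 \<alpha> k) on Re z = 1.
      After pinching, t occurs only in X, so the average can be taken there.\<close>
    have block: "(\<Sum>i<N. \<Sum>j<N. B t i j * (if k' i = k then d i else 0) * cnj (if k' j = k then d j else 0))
      = of_real (exp (2 * \<alpha> k)) * (\<Sum>i<N. \<Sum>j<N. if k' i = k \<and> k' j = k then B t i j else 0)" for k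
    proof -
      have "exp (complex_of_real (\<alpha> k) * z) * cnj (exp (complex_of_real (\<alpha> k) * z)) = of_real ((cmod (exp (complex_of_real (\<alpha> k) * z)))\<^sup>2)"
        by (rule complex_norm_square[symmetric])
      also have "(cmod (exp (complex_of_real (\<alpha> k) * z)))\<^sup>2 = exp (2 * \<alpha> k)"
        by (simp add: norm_exp_eq_Re z power2_eq_square exp_add[symmetric])
      finally have dd: "d i * cnj (d j) = of_real (exp (2 * \<alpha> k))" if "k' i = k" "k' j = k" for i j
        using that by (simp add: d_def)
      show ?thesis
        unfolding sum_distrib_left
        by (intro sum.cong refl) (use dd in \<open>auto simp: mult.assoc mult.commute[of _ "B _ _ _"]\<close>)
    qed
    have "Re (\<Sum>i<N. \<Sum>j<N. B t i j * d i * cnj (d j)) \<le> (\<Sum>k\<in>K'. w k) * (\<Sum>k\<in>K'. 1 / w k *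
       Re (\<Sum>i<N. \<Sum>j<N. B t i j * (if k' i = k then d i else 0) * cnj (if k' j = k then d j else 0)))"
      unfolding K'_def by (rule weighted_pinching[OF B_pos w])
    also have "\<dots> \<le> W * (\<Sum>k\<in>K'. 1 / w k *
       Re (\<Sum>i<N. \<Sum>j<N. B t i j * (if k' i = k then d i else 0) * cnj (if k' j = k then d j else 0)))"
      by (intro mult_right_mono W sum_nonneg mult_nonneg_nonneg B_pos) (use w in \<open>auto simp: K'_def less_imp_le\<close>)
    also have "\<dots> = u t"
      unfolding block u_def c_def by simp
    finally show "Re (mat_trace (?F1 z * (?F2 z * (?F3 z * (?F4 z * P * dag (?F4 z)) * dag (?F3 z)) * dag (?F2 z)) * dag (?F1 z))) \<le> u t"
      unfolding X eq .
  next
    note xf = X_functional[OF dag_carrier[OF U(1)] U(1)]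
    define T where "T = (\<lambda>i j t. P' $$ (j, i) * (of_real (beta0 t) * X' t $$ (i, j)))"
    have T_int: "integrable lborel (T i j)" if "i < N" "j < N" for i j
      unfolding T_def X'_def by (intro integrable_mult_right xf that)
    \<comment> \<open>The average of X is \<tau>, diagonal in this basis, so the off-diagonal terms
      that pinching kept within a level integrate to 0.\<close>
    have T_val: "(LINT t|lborel. T i j t) = (if i = j then P' $$ (i, i) * of_real (l i) else 0)" if "i < N" "j < N" for i j
    proof -
      have "dag U * \<tau> * U = mat_diag N (\<lambda>i. of_real (l i))"
        by (subst U(4)) (simp add: square_assoc[of _ N] mult_cancel_inverse[of _ N] U(3))
      then show ?thesis using that by (simp add: T_def X'_def xf mat_diag_index)
    qed
    have bu: "beta0 t * u t = W * (\<Sum>k\<in>K'. c k * (\<Sum>i<N. \<Sum>j<N. if k' i = k \<and> k' j = k then Re (T i j t) else 0))" for t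
    proof -
      have blk: "beta0 t * Re (\<Sum>i<N. \<Sum>j<N. if k' i = k \<and> k' j = k then B t i j else 0)
        = (\<Sum>i<N. \<Sum>j<N. if k' i = k \<and> k' j = k then Re (T i j t) else 0)" for k
        unfolding Re_sum sum_distrib_left
        by (intro sum.cong refl) (auto simp: T_def B_def algebra_simps)
      have "x * (W * (\<Sum>k\<in>K'. c k * y k)) = W * (\<Sum>k\<in>K'. c k * (x * y k))" for x y
        by (simp add: sum_distrib_left mult_ac)
      then show ?thesis unfolding u_def by (simp only: blk)
    qed
    have i: "integrable lborel (\<lambda>t. if k' i = k \<and> k' j = k then Re (T i j t) else 0)" if "i < N" "j < N" for i j k
      using integrable_Re[OF T_int[OF that]] by (cases "k' i = k"; cases "k' j = k") simp_all
    show "integrable lborel (\<lambda>t. beta0 t * u t)"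
      unfolding bu by (intro integrable_mult_right Bochner_Integration.integrable_sum) (auto intro: i)
    have "(LINT t|lborel. beta0 t * u t) = W * (\<Sum>k\<in>K'. c k * (LINT t|lborel. (\<Sum>i<N. \<Sum>j<N. if k' i = k \<and> k' j = k then Re (T i j t) else 0)))"
      unfolding bu integral_mult_right_zero
      by (subst Bochner_Integration.integral_sum) (auto intro!: integrable_mult_right Bochner_Integration.integrable_sum i)
    also have "\<dots> = W * (\<Sum>k\<in>K'. c k * (\<Sum>i<N. \<Sum>j<N. LINT t|lborel. (if k' i = k \<and> k' j = k then Re (T i j t) else 0)))"
    proof -
      have "(LINT t|lborel. (\<Sum>i<N. \<Sum>j<N. if k' i = k \<and> k' j = k then Re (T i j t) else 0))
        = (\<Sum>i<N. LINT t|lborel. (\<Sum>j<N. if k' i = k \<and> k' j = k then Re (T i j t) else 0))" for k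
        by (intro Bochner_Integration.integral_sum Bochner_Integration.integrable_sum) (auto intro: i)
      moreover have "(\<Sum>i<N. LINT t|lborel. (\<Sum>j<N. if k' i = k \<and> k' j = k then Re (T i j t) else 0))
        = (\<Sum>i<N. \<Sum>j<N. LINT t|lborel. (if k' i = k \<and> k' j = k then Re (T i j t) else 0))" for k
        by (intro sum.cong refl Bochner_Integration.integral_sum) (auto intro: i)
      ultimately show ?thesis by simp
    qed
    also have "\<dots> = W * (\<Sum>k\<in>K'. c k * (\<Sum>i<N. \<Sum>j<N. if j = i then (if k' i = k then Re (P' $$ (i, i)) * l i else 0) else 0))"
    proof -
      have "(LINT t|lborel. (if k' i = k \<and> k' j = k then Re (T i j t) else 0)) = (if j = i then (if k' i = k then Re (P' $$ (i, i)) * l i else 0) else 0)"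
        if "i < N" "j < N" for i j k
        using T_val[OF that] integral_Re[OF T_int[OF that]]
        by (cases "k' i = k"; cases "k' j = k"; cases "i = j") auto
      then show ?thesis by simp
    qed
    also have "\<dots> = W * (\<Sum>k\<in>K'. \<Sum>i<N. if k' i = k then Re (P' $$ (i, i)) * (c k * l i) else 0)"
    proof -
      have "(\<Sum>i<N. \<Sum>j<N. if j = i then (if k' i = k then Re (P' $$ (i, i)) * l i else 0) else 0)
        = (\<Sum>i<N. if k' i = k then Re (P' $$ (i, i)) * l i else 0)" for k
        by simp
      moreover have "c k * (\<Sum>i<N. if k' i = k then Re (P' $$ (i, i)) * l i else 0)
        = (\<Sum>i<N. if k' i = k then Re (P' $$ (i, i)) * (c k * l i) else 0)" for k
        unfolding sum_distrib_left by (intro sum.cong refl) auto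
      ultimately show ?thesis by simp
    qed
    also have "\<dots> \<le> W * (\<Sum>k\<in>K'. \<Sum>i<N. if k' i = k then Re (P' $$ (i, i)) else 0)"
    proof (intro mult_left_mono sum_mono)
      fix k i assume "i \<in> {..<N}"
      then have iN: "i < N" by simp
      \<comment> \<open>The weights cancel here: \<open>bound\<close> says that the eigenvalue times
        exp(2 \<alpha>) is at most the weight of its level, leaving tr P = 1 as the second
        factor.\<close>
      have "c (k' i) * l i \<le> 1"
        using bound[OF l0 l1[OF iN]] w[of "k' i"] by (simp add: c_def k'_def divide_le_eq mult.commute)
      then show "(if k' i = k then Re (P' $$ (i, i)) * (c k * l i) else 0) \<le> (if k' i = k then Re (P' $$ (i, i)) else 0)"
        using mult_left_mono[of "c (k' i) * l i" 1 "Re (P' $$ (i, i))"] P'_nonneg[OF iN] by auto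
    qed (use W0 in simp)
    also have "(\<Sum>k\<in>K'. \<Sum>i<N. if k' i = k then Re (P' $$ (i, i)) else 0) = (\<Sum>i<N. \<Sum>k\<in>K'. if k' i = k then Re (P' $$ (i, i)) else 0)"
      by (rule sum.swap)
    also have "\<dots> = (\<Sum>i<N. Re (P' $$ (i, i)))"
      by (intro sum.cong refl) (simp add: K'_def)
    finally show "(LINT t|lborel. beta0 t * u t) \<le> W" by (simp add: P'_sum)
  qed
  then show ?thesis by simp
qed

end

section \<open>The converse of data processing\<close>

context rotated_extension
begin

text \<open>The parameter \<Lambda> is the value given to the eigenvalue 0; it multiplies the weight
  of P outside the support of \<tau>. The term -1 on the support anticipates the loss from
  rounding.\<close>

lemma trace_regularized_log:
  fixes \<Lambda> \<epsilon> :: real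
  shows "Re (mat_trace (P * mat_fun (\<lambda>x. of_real (if x = 0 then \<Lambda> else (1 - \<epsilon>) * - ln x - 1)) \<tau>))
    = \<Lambda> * (1 - Re (mat_trace (P * mat_cpow \<tau> 0))) - (1 - \<epsilon>) * Re (mat_trace (P * mat_log \<tau>)) - Re (mat_trace (P * mat_cpow \<tau> 0))"
proof (rule psd_spectral[OF \<tau>_psd])
  fix U l assume S: "spectral N \<tau> U l"
  define q where "q = (\<lambda>i. (dag U * P * U) $$ (i, i))"
  note tr = trace_mat_fun_spectral[OF S carriers(1), folded q_def]
  have "(\<Sum>i<N. q i) = mat_trace (P * mat_fun (\<lambda>_. 1) \<tau>)" by (simp add: tr q_def)
  then have q: "(\<Sum>i<N. q i) = 1" by (simp add: mat_fun_one[OF \<tau>_psd] tr_P)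
  have "mat_trace (P * mat_fun (\<lambda>x. of_real (if x = 0 then \<Lambda> else (1 - \<epsilon>) * - ln x - 1)) \<tau>)
    = (\<Sum>i<N. of_real \<Lambda> * (q i - q i * (if l i = 0 then 0 else 1)) - of_real (1 - \<epsilon>) * (q i * (if l i = 0 then 0 else of_real (ln (l i))))
       - q i * (if l i = 0 then 0 else 1))"
    unfolding tr by (intro sum.cong refl) (simp add: q_def algebra_simps)
  also have "\<dots> = of_real \<Lambda> * ((\<Sum>i<N. q i) - mat_trace (P * mat_cpow \<tau> 0)) - of_real (1 - \<epsilon>) * mat_trace (P * mat_log \<tau>)
       - mat_trace (P * mat_cpow \<tau> 0)"
    unfolding cpow_zero mat_log_def tr sum_subtractf sum_distrib_left
    by (simp add: q_def sum_distrib_left right_diff_distrib sum_subtractf)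
  finally show ?thesis unfolding q by simp
qed

text \<open>Level k \<ge> 1 meets the unit interval in exp(-k) < x \<le> exp(1 - k). There x exp((1
  - \<epsilon>) k - 1) is at most exp(-\<epsilon> k), the weight of the level, and the weights form
  a geometric series; its sum is the argument of the logarithm.\<close>

lemma regularized_bound:
  fixes \<epsilon> \<Lambda> :: real
  assumes PS: "P * mat_cpow S 0 = P" and PR: "P * mat_cpow R 0 = P" and \<epsilon>: "0 < \<epsilon>" "\<epsilon> < 1"
  shows "Re (mat_trace (P * mat_log P)) + \<Lambda> * (1 - Re (mat_trace (P * mat_cpow \<tau> 0)))
      - (1 - \<epsilon>) * Re (mat_trace (P * mat_log \<tau>)) - Re (mat_trace (P * mat_cpow \<tau> 0))
    + Re (mat_trace (P * mat_log S)) - Re (mat_trace (P * mat_log R)) \<le> ln (1 / (1 - exp (- \<epsilon>)))"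
proof -
  \<comment> \<open>Level 0 is reserved for the eigenvalue 0, where \<open>bound\<close> holds
    trivially and \<alpha> may be arbitrary. The summand 1 rounds -ln x up.\<close>
  define \<kappa> where "\<kappa> = (\<lambda>x :: real. if x \<le> 0 then 0 else nat \<lfloor>- ln x\<rfloor> + 1)"
  \<comment> \<open>The -1 compensates for k exceeding -ln x by up to 1, so that the product with x
    stays below the weight.\<close>
  define \<alpha> where "\<alpha> = (\<lambda>k. if k = 0 then \<Lambda> / 2 else ((1 - \<epsilon>) * real k - 1) / 2)"
  define w where "w = (\<lambda>k. exp (- \<epsilon>) ^ k)"
  have e: "exp (- \<epsilon>) < 1" using \<epsilon> by simp
  have "Re (mat_trace (P * mat_log P)) + 2 * Re (mat_trace (P * mat_fun (\<lambda>x. of_real (\<alpha> (\<kappa> x))) \<tau>))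
    + Re (mat_trace (P * mat_log S)) - Re (mat_trace (P * mat_log R)) \<le> ln (1 / (1 - exp (- \<epsilon>)))"
  proof (rule pinched_bound[OF PS PR, where w = w])
    show "0 < w k" for k by (simp add: w_def)
    show "sum w K \<le> 1 / (1 - exp (- \<epsilon>))" if "finite K" for K
      using sum_le_suminf[OF summable_geometric that, of "exp (- \<epsilon>)"] suminf_geometric[of "exp (- \<epsilon>)"] e by (simp add: w_def)
    show "0 < 1 / (1 - exp (- \<epsilon>))" using e by simp
    fix x :: real assume x: "0 \<le> x" "x \<le> 1"
    show "x * exp (2 * \<alpha> (\<kappa> x)) \<le> w (\<kappa> x)"
    proof (cases "x = 0")
      case False
      then have x0: "0 < x" using x by simp
      then have l: "0 \<le> - ln x" using x by simp
      have k: "\<kappa> x = nat \<lfloor>- ln x\<rfloor> + 1" using x0 by (simp add: \<kappa>_def)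
      have k1: "real (\<kappa> x) - 1 \<le> - ln x" unfolding k using l by simp
      have "x * exp (2 * \<alpha> (\<kappa> x)) = exp (ln x + ((1 - \<epsilon>) * real (\<kappa> x) - 1))"
        using x0 k by (simp add: \<alpha>_def exp_add)
      also have "\<dots> \<le> exp (real (\<kappa> x) * - \<epsilon>)" using k1 by (simp add: algebra_simps)
      also have "\<dots> = w (\<kappa> x)" unfolding w_def by (rule exp_of_nat_mult)
      finally show ?thesis .
    qed (simp add: w_def)
  qed
  moreover have "Re (mat_trace (P * mat_fun (\<lambda>x. of_real (if x = 0 then \<Lambda> else (1 - \<epsilon>) * - ln x - 1)) \<tau>))
     \<le> Re (mat_trace (P * mat_fun (\<lambda>x. of_real (2 * \<alpha> (\<kappa> x))) \<tau>))"
  proof (rule trace_mat_fun_mono[OF \<tau>_psd P])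
    fix x :: real assume "0 \<le> x"
    show "(if x = 0 then \<Lambda> else (1 - \<epsilon>) * - ln x - 1) \<le> 2 * \<alpha> (\<kappa> x)"
    proof (cases "x = 0")
      case False
      then have k: "\<kappa> x = nat \<lfloor>- ln x\<rfloor> + 1" using \<open>0 \<le> x\<close> by (simp add: \<kappa>_def)
      have "- ln x \<le> real (\<kappa> x)" unfolding k by linarith
      then have "(1 - \<epsilon>) * - ln x \<le> (1 - \<epsilon>) * real (\<kappa> x)" using \<epsilon> by (intro mult_left_mono) auto
      moreover have "2 * \<alpha> (\<kappa> x) = (1 - \<epsilon>) * real (\<kappa> x) - 1" by (simp add: \<alpha>_def k)
      ultimately have "(1 - \<epsilon>) * - ln x - 1 \<le> 2 * \<alpha> (\<kappa> x)" by (simp only: diff_right_mono)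
      then show ?thesis by (simp only: False if_False)
    qed (simp add: \<alpha>_def \<kappa>_def)
  qed
  moreover have "mat_fun (\<lambda>x. complex_of_real (2 * \<alpha> (\<kappa> x))) \<tau> = 2 \<cdot>\<^sub>m mat_fun (\<lambda>x. complex_of_real (\<alpha> (\<kappa> x))) \<tau>"
    using mat_fun_smult[OF \<tau>_psd, of 2 "\<lambda>x. complex_of_real (\<alpha> (\<kappa> x))"] by simp
  then have "mat_trace (P * mat_fun (\<lambda>x. complex_of_real (2 * \<alpha> (\<kappa> x))) \<tau>) = 2 * mat_trace (P * mat_fun (\<lambda>x. complex_of_real (\<alpha> (\<kappa> x))) \<tau>)"
    using mat_fun_carrier[OF \<tau>_psd] by (simp add: mult_smult_distrib[of _ N N _ N] trace_smult[of _ N])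
  ultimately show ?thesis unfolding trace_regularized_log by simp
qed

text \<open>In \<open>regularized_bound\<close> only one term contains \<Lambda>, with the factor 1
  - q for the weight q of P on the support of \<tau>. Boundedness for all \<Lambda> forces q =
  1.\<close>

lemma support_\<tau>:
  assumes PS: "P * mat_cpow S 0 = P" and PR: "P * mat_cpow R 0 = P"
  shows "P * mat_cpow \<tau> 0 = P"
proof -
  let ?q = "Re (mat_trace (P * mat_cpow \<tau> 0))"
  have "0 \<le> mat_trace (P * (1\<^sub>m N - mat_cpow \<tau> 0))"
    by (rule psd_trace_mult_nonneg[OF P]) (rule cpow_zero_projection[OF \<tau>_psd])
  then have "0 \<le> 1 - mat_trace (P * mat_cpow \<tau> 0)"
    using cpow_carrier[OF \<tau>_psd] by (simp add: mult_minus_distrib_mat[of _ N N _ N] trace_minus[of _ N] tr_P)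
  then have q: "?q \<le> 1" "Im (mat_trace (P * mat_cpow \<tau> 0)) = 0" by (auto simp: less_eq_complex_def)
  obtain c where c: "\<And>\<Lambda>. \<Lambda> * (1 - ?q) \<le> c"
  proof
    show "\<Lambda> * (1 - ?q) \<le> ln (1 / (1 - exp (- (1/2)))) - Re (mat_trace (P * mat_log P)) + (1 - 1/2) * Re (mat_trace (P * mat_log \<tau>)) + ?q
      - Re (mat_trace (P * mat_log S)) + Re (mat_trace (P * mat_log R))" for \<Lambda>
      \<comment> \<open>Any fixed value of \<epsilon> between 0 and 1 serves here.\<close>
      using regularized_bound[OF PS PR, of "1/2" \<Lambda>] by simp
  qed
  have "\<not> ?q < 1"
  proof
    assume "?q < 1"
    then show False using c[of "(c + 1) / (1 - ?q)"] by simp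
  qed
  then have "mat_trace (P * mat_cpow \<tau> 0) = mat_trace P"
    using q by (simp add: complex_eq_iff tr_P)
  then show ?thesis by (simp add: trace_cpow_zero_iff[OF \<tau>_psd P])
qed

text \<open>In the remainder, 1 is the rounding loss and the logarithm comes from the total pinching
  weight; both are independent of the dimension.\<close>

lemma entropy_upper_bound:
  assumes PS: "P * mat_cpow S 0 = P" and PR: "P * mat_cpow R 0 = P" and \<epsilon>: "0 < \<epsilon>" "\<epsilon> < 1"
  shows "Re (mat_trace (P * mat_log P)) - (1 - \<epsilon>) * Re (mat_trace (P * mat_log \<tau>))
    \<le> Re (mat_trace (P * mat_log R)) - Re (mat_trace (P * mat_log S)) + (1 + ln (1 / (1 - exp (- \<epsilon>))))"
  using regularized_bound[OF PS PR \<epsilon>, of 0] by (simp add: support_\<tau>[OF PS PR] tr_P)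

end

subsection \<open>Many copies\<close>

lemma trace_cpow_deriv:
  assumes M: "positive_semidefinite n M" and P: "P \<in> carrier_mat n n"
  shows "((\<lambda>z. mat_trace (P * mat_cpow M z)) has_field_derivative mat_trace (P * mat_log M)) (at 0)"
proof -
  have "mat_fun (\<lambda>x. (if x = 0 then 0 else 1) * complex_of_real (1 * ln x)) M = mat_log M"
    unfolding mat_log_def by (rule arg_cong[where f = "\<lambda>f. mat_fun f M"]) auto
  then show ?thesis
    using trace_mat_fun_deriv[OF M P, of "\<lambda>x. if x = 0 then 0 else 1" "\<lambda>x. 1 * ln x"] cpow_eq_mat_fun[OF M, of 1]
    by simp
qed

text \<open>Additivity of logarithmic expectations without computing the logarithm of a tensor
  product: the traces of powers are multiplicative, and differentiation at 0 yields the logarithm.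
  The value 1 at z = 0 removes the remaining factors of the power rule.\<close>

lemma trace_log_power:
  assumes M: "positive_semidefinite m M" and P: "P \<in> carrier_mat m m"
    and M': "positive_semidefinite k M'" and P': "P' \<in> carrier_mat k k"
    and eq: "\<And>z. mat_trace (P * mat_cpow M z) = mat_trace (P' * mat_cpow M' z) ^ n"
    and one: "mat_trace (P' * mat_cpow M' 0) = 1"
  shows "mat_trace (P * mat_log M) = of_nat n * mat_trace (P' * mat_log M')"
proof -
  have "((\<lambda>z. mat_trace (P' * mat_cpow M' z) ^ n) has_field_derivative
      of_nat n * (mat_trace (P' * mat_log M') * mat_trace (P' * mat_cpow M' 0) ^ (n - Suc 0))) (at 0)"
    by (rule DERIV_power[OF trace_cpow_deriv[OF M' P']])
  then have "((\<lambda>z. mat_trace (P * mat_cpow M z)) has_field_derivative of_nat n * mat_trace (P' * mat_log M')) (at 0)"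
    by (simp add: one eq)
  then show ?thesis using trace_cpow_deriv[OF M P] DERIV_unique by blast
qed

section \<open>The n-fold states of a bipartite density matrix\<close>

locale density_pair =
  fixes dA dB :: nat and \<rho> \<sigma> :: "complex mat"
  assumes \<rho>_density: "\<rho> \<in> density_matrices (dA * dB)" and \<sigma>_density: "\<sigma> \<in> density_matrices dA"
begin

abbreviation \<rho>A where "\<rho>A \<equiv> partial_trace dA dB \<rho>"
definition P where "P n = regroup dA dB n (tensor_power \<rho> n)"

lemma \<rho>: "positive_semidefinite (dA * dB) \<rho>" "mat_trace \<rho> = 1"
  and \<sigma>: "positive_semidefinite dA \<sigma>" "mat_trace \<sigma> = 1"
  using \<rho>_density \<sigma>_density by (auto simp: density_matrices_def)

lemma \<rho>A: "positive_semidefinite dA \<rho>A" "mat_trace \<rho>A = 1"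
  using psd_partial_trace[OF \<rho>(1)] trace_partial_trace[OF psd_carrier[OF \<rho>(1)]] \<rho>(2) by auto

lemma psd_\<rho>_power: "positive_semidefinite (dA ^ n * dB ^ n) (tensor_power \<rho> n)"
  using psd_tensor_power[OF \<rho>(1), of n] by (simp add: power_mult_distrib)

sublocale copies: rotated_extension "dA ^ n" "dB ^ n" "P n" "tensor_power \<sigma> n" for n
proof
  show "positive_semidefinite (dA ^ n * dB ^ n) (P n)"
    unfolding P_def by (rule psd_regroup[OF psd_\<rho>_power])
  show "mat_trace (P n) = 1"
    unfolding P_def regroup_trace[OF psd_carrier[OF psd_\<rho>_power]]
    by (simp add: tensor_power_trace[OF psd_carrier[OF \<rho>(1)]] \<rho>)
  show "positive_semidefinite (dA ^ n) (tensor_power \<sigma> n)" by (rule psd_tensor_power[OF \<sigma>(1)])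
  show "mat_trace (tensor_power \<sigma> n) = 1"
    by (simp add: tensor_power_trace[OF psd_carrier[OF \<sigma>(1)]] \<sigma>)
qed

lemma r_eq: "copies.r n = tensor_power \<rho>A n"
  unfolding copies.r_def unfolding P_def by (rule partial_trace_regroup[OF psd_carrier[OF \<rho>(1)]])

lemma cpow_S: "mat_cpow (copies.S n) z = kron (tensor_power (mat_cpow \<sigma> z) n) (1\<^sub>m (dB ^ n))"
  unfolding copies.S_def cpow_kron_one[OF copies.s] cpow_tensor_power[OF \<sigma>(1)] ..

lemma cpow_R: "mat_cpow (copies.R n) z = kron (tensor_power (mat_cpow \<rho>A z) n) (1\<^sub>m (dB ^ n))"
  unfolding copies.R_def cpow_kron_one[OF copies.r] unfolding r_eq cpow_tensor_power[OF \<rho>A(1)] ..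

lemma sigma_ext_eq: "sigma_ext dA dB \<rho> \<sigma> n = copies.\<tau> n"
proof -
  have "sigma_integrand dA dB \<rho> \<sigma> n t = complex_of_real (beta0 t) \<cdot>\<^sub>m copies.X n t" for t
  proof -
    \<comment> \<open>The exponents to the right of the state are the conjugates of those to its
      left, so the integrand is a sandwich by an operator and its adjoint.\<close>
    have z: "(1 + \<i> * complex_of_real t) / 2 = of_real (1/2) * Complex 1 t"
      "- (of_real (1/2) * Complex 1 t) = of_real (-1/2) * Complex 1 t"
      "(1 - \<i> * complex_of_real t) / 2 = cnj (of_real (1/2) * Complex 1 t)"
      "- cnj (of_real (1/2) * Complex 1 t) = cnj (of_real (-1/2) * Complex 1 t)"
      by (simp_all add: complex_eq_iff)
    have d: "dag (mat_cpow (copies.S n) z) = mat_cpow (copies.S n) (cnj z)" "dag (mat_cpow (copies.R n) z) = mat_cpow (copies.R n) (cnj z)" for z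
      by (simp_all only: cpow_dag[OF copies.S] cpow_dag[OF copies.R])
    show ?thesis
      unfolding sigma_integrand_def Let_def z cpow_S[symmetric] cpow_R[symmetric] d[symmetric] P_def[symmetric]
      by (simp add: copies.X_def copies.A_def dag_mult[of _ "dA ^ n * dB ^ n" "dA ^ n * dB ^ n" _ "dA ^ n * dB ^ n"] square_assoc[of _ "dA ^ n * dB ^ n"])
  qed
  then show ?thesis
    unfolding sigma_ext_def copies.\<tau>_def
    by (intro eq_matI) (auto simp: carrier_matD[OF copies.carriers(14)])
qed

lemma trace_kron_power:
  assumes Y: "Y \<in> carrier_mat dA dA"
  shows "mat_trace (P n * kron (tensor_power Y n) (1\<^sub>m (dB ^ n))) = mat_trace (\<rho>A * Y) ^ n"
proof -
  have "mat_trace (P n * kron (tensor_power Y n) (1\<^sub>m (dB ^ n))) = mat_trace (copies.r n * tensor_power Y n)"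
    unfolding copies.r_def by (rule trace_kron_one) (use Y in auto)
  also have "copies.r n * tensor_power Y n = tensor_power (\<rho>A * Y) n"
    unfolding r_eq by (rule tensor_power_mult[OF partial_trace_carrier Y])
  also have "mat_trace \<dots> = mat_trace (\<rho>A * Y) ^ n"
    by (rule tensor_power_trace) (use Y in auto)
  finally show ?thesis .
qed

lemma trace_cpow_S: "mat_trace (P n * mat_cpow (copies.S n) z) = mat_trace (\<rho>A * mat_cpow \<sigma> z) ^ n"
  unfolding cpow_S by (rule trace_kron_power[OF cpow_carrier[OF \<sigma>(1)]])

lemma trace_cpow_R: "mat_trace (P n * mat_cpow (copies.R n) z) = mat_trace (\<rho>A * mat_cpow \<rho>A z) ^ n"
  unfolding cpow_R by (rule trace_kron_power[OF cpow_carrier[OF \<rho>A(1)]])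

lemma trace_cpow_P: "mat_trace (P n * mat_cpow (P n) z) = mat_trace (\<rho> * mat_cpow \<rho> z) ^ n"
proof -
  let ?N = "dA ^ n * dB ^ n"
  have c: "\<rho> \<in> carrier_mat (dA * dB) (dA * dB)" "mat_cpow \<rho> z \<in> carrier_mat (dA * dB) (dA * dB)"
    by (rule psd_carrier[OF \<rho>(1)], rule cpow_carrier[OF \<rho>(1)])
  have t: "tensor_power Y n \<in> carrier_mat ?N ?N" if "Y \<in> carrier_mat (dA * dB) (dA * dB)" for Y
    using tensor_power_carrier[OF that, of n] by (simp add: power_mult_distrib)
  have "P n * mat_cpow (P n) z = regroup dA dB n (tensor_power \<rho> n * tensor_power (mat_cpow \<rho> z) n)"
    unfolding P_def cpow_regroup[OF psd_\<rho>_power] cpow_tensor_power[OF \<rho>(1)]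
    by (rule regroup_mult[symmetric]) (use t c in auto)
  also have "tensor_power \<rho> n * tensor_power (mat_cpow \<rho> z) n = tensor_power (\<rho> * mat_cpow \<rho> z) n"
    by (rule tensor_power_mult[OF c])
  also have "mat_trace (regroup dA dB n \<dots>) = mat_trace (tensor_power (\<rho> * mat_cpow \<rho> z) n)"
    by (rule regroup_trace[OF t]) (use c in auto)
  also have "\<dots> = mat_trace (\<rho> * mat_cpow \<rho> z) ^ n"
    by (rule tensor_power_trace) (use c in auto)
  finally show ?thesis .
qed

text \<open>A state is supported in its marginal: the scalar test only asks that the n-th power of
  tr \<rho>A = 1 be 1.\<close>

lemma support_R: "P n * mat_cpow (copies.R n) 0 = P n"
  unfolding trace_cpow_zero_iff[OF copies.R copies.P] trace_cpow_R cpow_zero_mult[OF \<rho>A(1)]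
  by (simp add: \<rho>A copies.tr_P)

lemma support_S:
  assumes "\<rho>A * mat_cpow \<sigma> 0 = \<rho>A"
  shows "P n * mat_cpow (copies.S n) 0 = P n"
  unfolding trace_cpow_zero_iff[OF copies.S copies.P] trace_cpow_S assms
  by (simp add: \<rho>A copies.tr_P)

lemma trace_log:
  shows "mat_trace (P n * mat_log (P n)) = of_nat n * mat_trace (\<rho> * mat_log \<rho>)"
    and "mat_trace (P n * mat_log (copies.R n)) = of_nat n * mat_trace (\<rho>A * mat_log \<rho>A)"
    and "\<rho>A * mat_cpow \<sigma> 0 = \<rho>A \<Longrightarrow> mat_trace (P n * mat_log (copies.S n)) = of_nat n * mat_trace (\<rho>A * mat_log \<sigma>)"
proof -
  show "mat_trace (P n * mat_log (P n)) = of_nat n * mat_trace (\<rho> * mat_log \<rho>)"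
    by (rule trace_log_power[OF copies.P copies.carriers(1) \<rho>(1) psd_carrier[OF \<rho>(1)] trace_cpow_P])
      (simp add: cpow_zero_mult[OF \<rho>(1)] \<rho>)
  show "mat_trace (P n * mat_log (copies.R n)) = of_nat n * mat_trace (\<rho>A * mat_log \<rho>A)"
    by (rule trace_log_power[OF copies.R copies.carriers(1) \<rho>A(1) partial_trace_carrier trace_cpow_R])
      (simp add: cpow_zero_mult[OF \<rho>A(1)] \<rho>A)
  show "mat_trace (P n * mat_log (copies.S n)) = of_nat n * mat_trace (\<rho>A * mat_log \<sigma>)" if "\<rho>A * mat_cpow \<sigma> 0 = \<rho>A"
    by (rule trace_log_power[OF copies.S copies.carriers(1) \<sigma>(1) partial_trace_carrier trace_cpow_S])
      (simp add: that \<rho>A)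
qed

lemma extension:
  assumes "supp \<sigma> \<subseteq> supp \<rho>A"
  shows "is_extension (dA ^ n) (dB ^ n) (tensor_power \<sigma> n) (sigma_ext dA dB \<rho> \<sigma> n)"
proof -
  have "\<sigma> * mat_cpow \<rho>A 0 = \<sigma>" using assms supp_subset_iff[OF \<rho>A(1) \<sigma>(1)] by simp
  then have "tensor_power \<sigma> n * mat_cpow (copies.r n) 0 = tensor_power \<sigma> n"
    unfolding r_eq cpow_tensor_power[OF \<rho>A(1)]
    by (subst tensor_power_mult[OF psd_carrier[OF \<sigma>(1)] cpow_carrier[OF \<rho>A(1)]]) simp
  then have pt: "partial_trace (dA ^ n) (dB ^ n) (copies.\<tau> n) = tensor_power \<sigma> n" by (rule copies.marginal_eq)
  have "mat_trace (copies.\<tau> n) = 1"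
    using trace_partial_trace[OF copies.carriers(11)[of n]] by (simp add: pt copies.tr_s)
  then show ?thesis
    unfolding is_extension_def sigma_ext_eq using copies.\<tau>_psd pt by (simp add: density_matrices_def)
qed

text \<open>D n lies between n k and (n (k - \<epsilon> h) + const) / (1 - \<epsilon>). The entropy
  term h appears because the factor 1 - \<epsilon> multiplies only the logarithm of \<tau> in
  \<open>entropy_upper_bound\<close>.\<close>

lemma entropy_limit_finite:
  assumes sub: "supp \<rho>A \<subseteq> supp \<sigma>"
  shows "(\<lambda>n. ereal (1 / real n) * relative_entropy (P n) (copies.\<tau> n)) \<longlonglongrightarrow> relative_entropy \<rho>A \<sigma>"
proof -
  have sup: "\<rho>A * mat_cpow \<sigma> 0 = \<rho>A" using sub supp_subset_iff[OF \<sigma>(1) \<rho>A(1)] by simp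
  note PS = support_S[OF sup] and PR = support_R
  note P\<tau> = copies.support_\<tau>[OF PS PR]
  define k where "k = Re (mat_trace (\<rho>A * mat_log \<rho>A)) - Re (mat_trace (\<rho>A * mat_log \<sigma>))"
  define h where "h = Re (mat_trace (\<rho> * mat_log \<rho>))"
  define D where "D = (\<lambda>n. real n * h - Re (mat_trace (P n * mat_log (copies.\<tau> n))))"
  have diff: "Re (mat_trace (Q * (mat_log Q - mat_log M))) = Re (mat_trace (Q * mat_log Q)) - Re (mat_trace (Q * mat_log M))"
    if "positive_semidefinite m Q" "positive_semidefinite m M" for m Q M
    using psd_carrier[OF that(1)] log_carrier[OF that(1)] log_carrier[OF that(2)]
    by (simp add: mult_minus_distrib_mat[of _ m m _ m] trace_minus[of _ m])
  have e1: "relative_entropy \<rho>A \<sigma> = ereal k"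
    using sub by (simp add: relative_entropy_def diff[OF \<rho>A(1) \<sigma>(1)] k_def)
  have e2: "relative_entropy (P n) (copies.\<tau> n) = ereal (D n)" for n
    using P\<tau>[of n] supp_subset_iff[OF copies.\<tau>_psd copies.P, of n]
    by (simp add: relative_entropy_def diff[OF copies.P copies.\<tau>_psd] D_def h_def trace_log)
  have lower: "real n * k \<le> D n" for n
    using copies.data_processing[OF P\<tau> PS PR, of n] by (simp add: trace_log sup k_def D_def h_def algebra_simps)
  have upper: "(1 - \<epsilon>) * D n \<le> real n * (k - \<epsilon> * h) + (1 + ln (1 / (1 - exp (- \<epsilon>))))" if "0 < \<epsilon>" "\<epsilon> < 1" for \<epsilon> n
    using copies.entropy_upper_bound[OF PS PR that, of n] by (simp add: trace_log sup k_def D_def h_def algebra_simps)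
  have "(\<lambda>n. D n / real n) \<longlonglongrightarrow> k"
  proof (rule LIMSEQ_I)
    fix e :: real assume e: "0 < e"
    \<comment> \<open>\<epsilon> is fixed before n, since the constant c grows without bound as
      \<epsilon> tends to 0; half of e is spent on each choice.\<close>
    have "((\<lambda>\<epsilon>. (k - \<epsilon> * h) / (1 - \<epsilon>)) \<longlongrightarrow> (k - 0 * h) / (1 - 0)) (at_right 0)"
      by (intro tendsto_intros) auto
    then have "eventually (\<lambda>\<epsilon>. (k - \<epsilon> * h) / (1 - \<epsilon>) < k + e / 2) (at_right 0)"
      using e by (auto intro: order_tendstoD)
    moreover have "eventually (\<lambda>\<epsilon>::real. \<epsilon> < 1) (at_right 0)"
      by (rule eventually_at_rightI[of 0 1]) auto
    moreover have "eventually (\<lambda>\<epsilon>::real. 0 < \<epsilon>) (at_right 0)" by (rule eventually_at_right_less)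
    ultimately have "eventually (\<lambda>\<epsilon>. (k - \<epsilon> * h) / (1 - \<epsilon>) < k + e / 2 \<and> \<epsilon> < 1 \<and> 0 < \<epsilon>) (at_right 0)"
      by eventually_elim auto
    then obtain \<epsilon> where \<epsilon>: "(k - \<epsilon> * h) / (1 - \<epsilon>) < k + e / 2" "0 < \<epsilon>" "\<epsilon> < 1"
      using eventually_happens'[OF trivial_limit_at_right_real] by blast
    define c where "c = (1 + ln (1 / (1 - exp (- \<epsilon>)))) / (1 - \<epsilon>)"
    have "(\<lambda>n. c / real n) \<longlonglongrightarrow> 0" by (rule lim_const_over_n)
    then have "eventually (\<lambda>n. c / real n < e / 2) sequentially"
      by (rule order_tendstoD(2)) (use e in simp)
    then obtain n0 where n0: "\<And>n. n \<ge> n0 \<Longrightarrow> c / real n < e / 2" by (auto simp: eventually_sequentially)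
    have "norm (D n / real n - k) < e" if n: "n \<ge> max 1 n0" for n
    proof -
      have n1: "0 < real n" using n by simp
      have "k \<le> D n / real n" using lower[of n] n1 by (simp add: pos_le_divide_eq mult.commute)
      have "D n \<le> real n * ((k - \<epsilon> * h) / (1 - \<epsilon>)) + c"
        using upper[OF \<epsilon>(2,3), of n] \<epsilon>(3) by (simp add: c_def pos_le_divide_eq add_divide_distrib[symmetric] mult.commute)
      then have "D n / real n \<le> (real n * ((k - \<epsilon> * h) / (1 - \<epsilon>)) + c) / real n"
        by (rule divide_right_mono) simp
      also have "\<dots> = (k - \<epsilon> * h) / (1 - \<epsilon>) + c / real n"
        using n1 by (simp add: add_divide_distrib)
      finally have "D n / real n \<le> (k - \<epsilon> * h) / (1 - \<epsilon>) + c / real n" .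
      moreover have "c / real n < e / 2" by (rule n0) (use n in simp)
      ultimately have "D n / real n - k < e" using \<epsilon>(1) by linarith
      then show ?thesis using \<open>k \<le> D n / real n\<close> by simp
    qed
    then show "\<exists>no. \<forall>n\<ge>no. norm (D n / real n - k) < e" by blast
  qed
  then show ?thesis unfolding e1 e2 by (simp add: mult.commute)
qed

text \<open>Every term with n > 0 is infinite. Otherwise P would be supported in \<tau> and so in S;
  the scalar test then reads q^n = 1 with q = tr \<rho>A \<sigma>^0 nonnegative, so q = 1 and
  \<rho>A would be supported in \<sigma>.\<close>

lemma entropy_limit_infinite:
  assumes sub: "\<not> supp \<rho>A \<subseteq> supp \<sigma>"
  shows "(\<lambda>n. ereal (1 / real n) * relative_entropy (P n) (copies.\<tau> n)) \<longlonglongrightarrow> relative_entropy \<rho>A \<sigma>"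
proof -
  have c: "mat_cpow \<sigma> 0 \<in> carrier_mat dA dA" by (rule cpow_carrier[OF \<sigma>(1)])
  let ?q = "mat_trace (\<rho>A * mat_cpow \<sigma> 0)"
  have q0: "0 \<le> ?q" by (rule psd_trace_mult_nonneg[OF \<rho>A(1)]) (rule cpow_zero_projection[OF \<sigma>(1)])
  have "relative_entropy (P n) (copies.\<tau> n) = \<infinity>" if n: "0 < n" for n
  proof -
    have "\<not> supp (P n) \<subseteq> supp (copies.\<tau> n)"
    proof
      assume "supp (P n) \<subseteq> supp (copies.\<tau> n)"
      then have "P n * mat_cpow (copies.S n) 0 = P n"
        by (intro copies.support_\<tau>_imp_S) (simp add: supp_subset_iff[OF copies.\<tau>_psd copies.P])
      then have q1: "?q ^ n = 1" using trace_cpow_S[of n 0] by (simp add: copies.tr_P)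
      have "?q = of_real (Re ?q)" using q0 by (simp add: complex_eq_iff less_eq_complex_def)
      then have "Re ?q ^ n = 1" using q1 by (metis of_real_power of_real_eq_1_iff)
      then have "Re ?q = 1"
        using power_eq_imp_eq_base[of "Re ?q" n 1] q0 n by (simp add: less_eq_complex_def)
      then have "?q = mat_trace \<rho>A" using q0 by (simp add: complex_eq_iff less_eq_complex_def \<rho>A)
      then have "\<rho>A * mat_cpow \<sigma> 0 = \<rho>A" by (simp add: trace_cpow_zero_iff[OF \<sigma>(1) \<rho>A(1)])
      then show False using sub by (simp add: supp_subset_iff[OF \<sigma>(1) \<rho>A(1)])
    qed
    then show ?thesis by (simp add: relative_entropy_def)
  qed
  then have "eventually (\<lambda>n. ereal (1 / real n) * relative_entropy (P n) (copies.\<tau> n) = relative_entropy \<rho>A \<sigma>) sequentially"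
    using sub by (intro eventually_sequentiallyI[of 1]) (simp add: relative_entropy_def)
  then show ?thesis by (rule tendsto_eventually)
qed

end

text \<open>The extension property is conditional because the powers of \<rho>A vanish off its
  support: the integral has trace (tr \<sigma> \<rho>A^0)^n, which for n > 0 equals 1 only if
  \<sigma> is supported in \<rho>A.\<close>

theorem mainTheorem5:
  fixes dA dB :: nat and \<rho> \<sigma> :: "complex mat"
  assumes "\<rho> \<in> density_matrices (dA * dB)"
    and "\<sigma> \<in> density_matrices dA"
  shows "prob_space (density lborel (\<lambda>t. ennreal (beta0 t)))
    \<and> (supp \<sigma> \<subseteq> supp (partial_trace dA dB \<rho>) \<longrightarrow>
         (\<forall>n. is_extension (dA ^ n) (dB ^ n) (tensor_power \<sigma> n) (sigma_ext dA dB \<rho> \<sigma> n)))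
    \<and> ((\<lambda>n. ereal (1 / real n) *
              relative_entropy (regroup dA dB n (tensor_power \<rho> n)) (sigma_ext dA dB \<rho> \<sigma> n))
          \<longlonglongrightarrow> relative_entropy (partial_trace dA dB \<rho>) \<sigma>)"
proof -
  interpret density_pair dA dB \<rho> \<sigma> by unfold_locales (use assms in auto)
  show ?thesis
    unfolding sigma_ext_eq P_def[symmetric]
    using prob_space_beta0 extension[unfolded sigma_ext_eq] entropy_limit_finite entropy_limit_infinite by blast
qed

end
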